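(* Let $\pi:(M,\varphi,\xi,\eta,g)\to(M',J,g')$ be a contact-complex Riemannian submersion with $\dim M=2m+1\ge5$ and $\dim M'=2n\ge2$. Assume that $M$ is a $C_{12}$-manifold. Then: (1) $M'$ is a Kähler manifold. (2) The horizontal distribution is totally geodesic. (3) Any fibre $F$ inherits from $M$ a $C_{12}$-structure, provided that $\dim F\ge3$. (4) The invariant $T$ satisfies, for all $U,V\in\chi^v(M)$, \[T_U\varphi V=\varphi(T_UV)-\eta(U)\eta(V)\varphi(T_\xi\xi),\qquad T_UV+T_{\varphi U}\varphi V=\eta(U)\eta(V)T_\xi\xi.\] (5) For every $U\in\chi^v(M)$ and $X\in\chi^h(M)$, \[(\nabla_U\varphi)X=-\eta(U)g(T_\xi\xi,\varphi X)\xi,\qquad(\nabla_X\varphi)U=0.\]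
   Context: All objects are smooth. An almost contact metric (ACM) manifold $(M,\varphi,\xi,\eta,g)$ is a $(2m+1)$-dimensional Riemannian manifold with a $(1,1)$-tensor field $\varphi$, a vector field $\xi$ and a 1-form $\eta$ such that $\varphi^2=-I+\eta\otimes\xi$, $\eta(\xi)=1$, $g(\varphi X,\varphi Y)=g(X,Y)-\eta(X)\eta(Y)$. $\nabla$ is the Levi-Civita connection. $M$ is a $C_{12}$-manifold if for all vector fields $X,Y$ \[(\nabla_X\varphi)Y=-\eta(X)\big((\nabla_\xi\eta)(\varphi Y)\,\xi+\eta(Y)\varphi(\nabla_\xi\xi)\big).\] A contact-complex Riemannian submersion $\pi:(M,\varphi,\xi,\eta,g)\to(M',J,g')$ is a Riemannian submersion from an ACM manifold onto an almost Hermitian manifold ($J^2=-I$, $g'(J\cdot,J\cdot)=g'$) with $J\circ\pi_*=\pi_*\circ\varphi$. Let $\mathcal V=\ker\pi_*$, $\mathcal H=\mathcal V^\perp$ be the vertical and horizontal distributions, $v,h$ the orthogonal projections, and $\chi^v(M),\chi^h(M)$ the vertical and horizontal vector fields. $\xi$ is vertical, $\varphi$ preserves $\mathcal V$ and $\mathcal H$, and every fibre $F$ of dimension $\ge3$ is an ACM manifold with the induced structure $\hat\varphi=\varphi|_{TF}$, $\hat\xi=\xi|_F$, $\hat\eta=\eta|_{TF}$, $\hat g=g|_{TF\times TF}$. The O'Neill invariant $T$ is $T_EF=h(\nabla_{vE}vF)+v(\nabla_{vE}hF)$. $\mathcal H$ is totally geodesic if $\nabla_XY\in\chi^h(M)$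 for all $X,Y\in\chi^h(M)$. *)

theory Defs
  imports "HOL-Analysis.Analysis" "HOL-Library.Function_Algebras"
begin

section \<open>Smooth maps between Euclidean spaces\<close>

instantiation "fun" :: (type, scaleR) scaleR
begin
definition scaleR_fun_def: "c *\<^sub>R f = (\<lambda>x. c *\<^sub>R f x)"
instance ..
end

lemma scaleR_fun_apply [simp]: "(c *\<^sub>R f) x = c *\<^sub>R f x"
  by (simp add: scaleR_fun_def)

instance "fun" :: (type, real_vector) real_vector
  by standard (simp_all add: fun_eq_iff scaleR_add_right scaleR_add_left)

primrec C_k_on :: "nat \<Rightarrow> 'e set \<Rightarrow> ('e::real_normed_vector \<Rightarrow> 'f::real_normed_vector) \<Rightarrow> bool" where
  "C_k_on 0 S f \<longleftrightarrow> continuous_on S f"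
| "C_k_on (Suc k) S f \<longleftrightarrow> (\<forall>x\<in>S. f differentiable (at x)) \<and>
     (\<forall>v. C_k_on k S (\<lambda>x. frechet_derivative f (at x) v))"

text \<open>Only used for open \<^term>\<open>S\<close> and finite-dimensional domains.\<close>

definition smooth_on :: "'e set \<Rightarrow> ('e::real_normed_vector \<Rightarrow> 'f::real_normed_vector) \<Rightarrow> bool" where
  "smooth_on S f \<longleftrightarrow> (\<forall>k. C_k_on k S f)"

section \<open>Smooth manifolds\<close>

text \<open>The dimension of a manifold is \<^term>\<open>DIM('e::euclidean_space)\<close>, that of its model space \<^typ>\<open>'e\<close>. The atlas need
  not be maximal, and the points may form a proper subset of \<^typ>\<open>'a\<close>.\<close>

record ('a, 'e) manifold =
  mfd_top :: "'a topology"
  atlas :: "('a set \<times> ('a \<Rightarrow> 'e)) set"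

definition points :: "('a, 'e) manifold \<Rightarrow> 'a set" where
  "points M = topspace (mfd_top M)"

definition is_chart :: "'a topology \<Rightarrow> 'a set \<Rightarrow> ('a \<Rightarrow> 'e::euclidean_space) \<Rightarrow> bool" where
  "is_chart T U c \<longleftrightarrow> openin T U \<and> open (c ` U) \<and>
     homeomorphic_map (subtopology T U) (top_of_set (c ` U)) c"

definition second_countable_top :: "'a topology \<Rightarrow> bool" where
  "second_countable_top T \<longleftrightarrow> (\<exists>\<B>. countable \<B> \<and> (\<forall>B\<in>\<B>. openin T B) \<and>
     (\<forall>U x. openin T U \<and> x \<in> U \<longrightarrow> (\<exists>B\<in>\<B>. x \<in> B \<and> B \<subseteq> U)))"

definition smooth_manifold :: "('a, 'e::euclidean_space) manifold \<Rightarrow> bool" where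
  "smooth_manifold M \<longleftrightarrow>
     Hausdorff_space (mfd_top M) \<and> second_countable_top (mfd_top M) \<and>
     (\<forall>(U, c)\<in>atlas M. is_chart (mfd_top M) U c) \<and>
     (\<Union>(U, c)\<in>atlas M. U) = points M \<and>
     (\<forall>(U, c)\<in>atlas M. \<forall>(V, d)\<in>atlas M. smooth_on (c ` (U \<inter> V)) (d \<circ> inv_into U c))"

definition smooth_funs :: "('a, 'e::euclidean_space) manifold \<Rightarrow> ('a \<Rightarrow> real) set" where
  "smooth_funs M = {f. \<forall>(U, c)\<in>atlas M. smooth_on (c ` U) (f \<circ> inv_into U c)}"

definition smooth_map ::
  "('a, 'e::euclidean_space) manifold \<Rightarrow> ('b, 'f::euclidean_space) manifold \<Rightarrow> ('a \<Rightarrow> 'b) \<Rightarrow> bool" where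
  "smooth_map M N h \<longleftrightarrow> continuous_map (mfd_top M) (mfd_top N) h \<and>
     (\<forall>(U, c)\<in>atlas M. \<forall>(V, d)\<in>atlas N.
        smooth_on (c ` (U \<inter> h -` V)) (d \<circ> h \<circ> inv_into U c))"

section \<open>Tangent vectors, vector fields and tensor fields\<close>

text \<open>A tangent vector at \<^term>\<open>p\<close> is a derivation at \<^term>\<open>p\<close> of the algebra of smooth functions. As HOL
  functions are total, it is given the value \<^term>\<open>0::real\<close> on non-smooth arguments, so that
  equality of tangent vectors is equality of functions. Values of a smooth function outside
  the manifold do not matter: the Leibniz rule against the indicator function of
  \<^term>\<open>points M\<close> shows that derivations ignore them.\<close>

type_synonym 'a tvec = "('a \<Rightarrow> real) \<Rightarrow> real"
type_synonym 'a vfield = "'a \<Rightarrow> 'a tvec"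
type_synonym 'a endo = "'a \<Rightarrow> 'a tvec \<Rightarrow> 'a tvec"
type_synonym 'a form1 = "'a \<Rightarrow> 'a tvec \<Rightarrow> real"
type_synonym 'a form2 = "'a \<Rightarrow> 'a tvec \<Rightarrow> 'a tvec \<Rightarrow> real"
type_synonym 'a conn = "'a vfield \<Rightarrow> 'a vfield \<Rightarrow> 'a vfield"

definition tangent_space :: "('a, 'e::euclidean_space) manifold \<Rightarrow> 'a \<Rightarrow> 'a tvec set" where
  "tangent_space M p = {v.
     (\<forall>f\<in>smooth_funs M. \<forall>h\<in>smooth_funs M. v (f + h) = v f + v h) \<and>
     (\<forall>f\<in>smooth_funs M. \<forall>c. v (c *\<^sub>R f) = c * v f) \<and>
     (\<forall>f\<in>smooth_funs M. \<forall>h\<in>smooth_funs M. v (f * h) = v f * h p + f p * v h) \<and>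
     (\<forall>f. f \<notin> smooth_funs M \<longrightarrow> v f = 0)}"

definition pushforward ::
  "('a, 'e::euclidean_space) manifold \<Rightarrow> ('b, 'f::euclidean_space) manifold \<Rightarrow> ('a \<Rightarrow> 'b) \<Rightarrow>
   'a tvec \<Rightarrow> 'b tvec" where
  "pushforward M N h v = (\<lambda>f. if f \<in> smooth_funs N then v (f \<circ> h) else 0)"

text \<open>Vector fields vanish outside the manifold, so that their equality is equality of functions.\<close>

definition vector_fields :: "('a, 'e::euclidean_space) manifold \<Rightarrow> 'a vfield set" where
  "vector_fields M = {X. (\<forall>p\<in>points M. X p \<in> tangent_space M p) \<and> (\<forall>p. p \<notin> points M \<longrightarrow> X p = 0) \<and>
     (\<forall>f\<in>smooth_funs M. (\<lambda>p. X p f) \<in> smooth_funs M)}"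

definition fun_scale :: "('a \<Rightarrow> real) \<Rightarrow> 'a vfield \<Rightarrow> 'a vfield" (infixr "\<odot>" 75) where
  "f \<odot> X = (\<lambda>p. f p *\<^sub>R X p)"

definition lie_bracket :: "'a vfield \<Rightarrow> 'a vfield \<Rightarrow> 'a vfield" where
  "lie_bracket X Y = (\<lambda>p f. X p (\<lambda>q. Y q f) - Y p (\<lambda>q. X q f))"

definition endo_apply :: "('a, 'e::euclidean_space) manifold \<Rightarrow> 'a endo \<Rightarrow> 'a vfield \<Rightarrow> 'a vfield" where
  "endo_apply M A X = (\<lambda>p. if p \<in> points M then A p (X p) else 0)"

definition form1_apply :: "'a form1 \<Rightarrow> 'a vfield \<Rightarrow> 'a \<Rightarrow> real" where
  "form1_apply w X = (\<lambda>p. w p (X p))"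

definition form2_apply :: "'a form2 \<Rightarrow> 'a vfield \<Rightarrow> 'a vfield \<Rightarrow> 'a \<Rightarrow> real" where
  "form2_apply g X Y = (\<lambda>p. g p (X p) (Y p))"

definition endo_field :: "('a, 'e::euclidean_space) manifold \<Rightarrow> 'a endo \<Rightarrow> bool" where
  "endo_field M A \<longleftrightarrow>
     (\<forall>p\<in>points M. \<forall>u\<in>tangent_space M p. A p u \<in> tangent_space M p \<and>
        (\<forall>v\<in>tangent_space M p. A p (u + v) = A p u + A p v) \<and> (\<forall>c. A p (c *\<^sub>R u) = c *\<^sub>R A p u)) \<and>
     (\<forall>X\<in>vector_fields M. endo_apply M A X \<in> vector_fields M)"

definition form1_field :: "('a, 'e::euclidean_space) manifold \<Rightarrow> 'a form1 \<Rightarrow> bool" where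
  "form1_field M w \<longleftrightarrow>
     (\<forall>p\<in>points M. \<forall>u\<in>tangent_space M p.
        (\<forall>v\<in>tangent_space M p. w p (u + v) = w p u + w p v) \<and> (\<forall>c. w p (c *\<^sub>R u) = c * w p u)) \<and>
     (\<forall>X\<in>vector_fields M. form1_apply w X \<in> smooth_funs M)"

definition riemannian_metric :: "('a, 'e::euclidean_space) manifold \<Rightarrow> 'a form2 \<Rightarrow> bool" where
  "riemannian_metric M g \<longleftrightarrow>
     (\<forall>p\<in>points M. \<forall>u\<in>tangent_space M p.
        (\<forall>v\<in>tangent_space M p. g p u v = g p v u \<and>
           (\<forall>w\<in>tangent_space M p. g p (u + v) w = g p u w + g p v w) \<and>
           (\<forall>c. g p (c *\<^sub>R u) v = c * g p u v)) \<and>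
        (u \<noteq> 0 \<longrightarrow> g p u u > 0)) \<and>
     (\<forall>X\<in>vector_fields M. \<forall>Y\<in>vector_fields M. form2_apply g X Y \<in> smooth_funs M)"

section \<open>Connections\<close>

text \<open>\<^term>\<open>D X Y\<close> is the covariant derivative of \<open>Y\<close> along \<open>X\<close>. On vector fields, \<^term>\<open>D\<close> is
  unique and exists by the fundamental theorem of Riemannian geometry; its values on
  arguments that are not smooth vector fields are unconstrained.\<close>

definition levi_civita :: "('a, 'e::euclidean_space) manifold \<Rightarrow> 'a form2 \<Rightarrow> 'a conn \<Rightarrow> bool" where
  "levi_civita M g D \<longleftrightarrow>
     (\<forall>X\<in>vector_fields M. \<forall>Y\<in>vector_fields M. D X Y \<in> vector_fields M \<and>
        D X Y - D Y X = lie_bracket X Y \<and>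
        (\<forall>f\<in>smooth_funs M. D (f \<odot> X) Y = f \<odot> D X Y \<and>
           D X (f \<odot> Y) = (\<lambda>p. X p f) \<odot> Y + f \<odot> D X Y) \<and>
        (\<forall>Z\<in>vector_fields M. D (X + Y) Z = D X Z + D Y Z \<and> D X (Y + Z) = D X Y + D X Z \<and>
           (\<forall>p\<in>points M. X p (form2_apply g Y Z) = g p (D X Y p) (Z p) + g p (Y p) (D X Z p))))"

definition cov_endo ::
  "('a, 'e::euclidean_space) manifold \<Rightarrow> 'a conn \<Rightarrow> 'a endo \<Rightarrow> 'a vfield \<Rightarrow> 'a vfield \<Rightarrow> 'a vfield" where
  "cov_endo M D A X Y = D X (endo_apply M A Y) - endo_apply M A (D X Y)"

definition cov_form1 :: "'a conn \<Rightarrow> 'a form1 \<Rightarrow> 'a vfield \<Rightarrow> 'a vfield \<Rightarrow> 'a \<Rightarrow> real" where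
  "cov_form1 D w X Y = (\<lambda>p. X p (form1_apply w Y) - w p (D X Y p))"

section \<open>Almost contact metric and almost Hermitian structures\<close>

definition acm_manifold ::
  "('a, 'e::euclidean_space) manifold \<Rightarrow> 'a endo \<Rightarrow> 'a vfield \<Rightarrow> 'a form1 \<Rightarrow> 'a form2 \<Rightarrow> bool" where
  "acm_manifold M \<phi> \<xi> \<eta> g \<longleftrightarrow> smooth_manifold M \<and> odd DIM('e) \<and>
     riemannian_metric M g \<and> endo_field M \<phi> \<and> \<xi> \<in> vector_fields M \<and> form1_field M \<eta> \<and>
     (\<forall>p\<in>points M. \<eta> p (\<xi> p) = 1 \<and>
        (\<forall>u\<in>tangent_space M p. \<phi> p (\<phi> p u) = - u + \<eta> p u *\<^sub>R \<xi> p \<and>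
           (\<forall>v\<in>tangent_space M p. g p (\<phi> p u) (\<phi> p v) = g p u v - \<eta> p u * \<eta> p v)))"

definition C12_manifold ::
  "('a, 'e::euclidean_space) manifold \<Rightarrow> 'a endo \<Rightarrow> 'a vfield \<Rightarrow> 'a form1 \<Rightarrow> 'a form2 \<Rightarrow> bool" where
  "C12_manifold M \<phi> \<xi> \<eta> g \<longleftrightarrow> acm_manifold M \<phi> \<xi> \<eta> g \<and>
     (\<exists>D. levi_civita M g D \<and> (\<forall>X\<in>vector_fields M. \<forall>Y\<in>vector_fields M.
        cov_endo M D \<phi> X Y =
          - (form1_apply \<eta> X \<odot> (cov_form1 D \<eta> \<xi> (endo_apply M \<phi> Y) \<odot> \<xi> +
               form1_apply \<eta> Y \<odot> endo_apply M \<phi> (D \<xi> \<xi>)))))"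

definition almost_hermitian ::
  "('a, 'e::euclidean_space) manifold \<Rightarrow> 'a endo \<Rightarrow> 'a form2 \<Rightarrow> bool" where
  "almost_hermitian M J g \<longleftrightarrow> smooth_manifold M \<and> riemannian_metric M g \<and> endo_field M J \<and>
     (\<forall>p\<in>points M. \<forall>u\<in>tangent_space M p. J p (J p u) = - u \<and>
        (\<forall>v\<in>tangent_space M p. g p (J p u) (J p v) = g p u v))"

definition kaehler_manifold ::
  "('a, 'e::euclidean_space) manifold \<Rightarrow> 'a endo \<Rightarrow> 'a form2 \<Rightarrow> bool" where
  "kaehler_manifold M J g \<longleftrightarrow> almost_hermitian M J g \<and>
     (\<exists>D. levi_civita M g D \<and> (\<forall>X\<in>vector_fields M. \<forall>Y\<in>vector_fields M. cov_endo M D J X Y = 0))"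

section \<open>Riemannian submersions\<close>

definition vertical_space ::
  "('a, 'e::euclidean_space) manifold \<Rightarrow> ('b, 'f::euclidean_space) manifold \<Rightarrow> ('a \<Rightarrow> 'b) \<Rightarrow>
   'a \<Rightarrow> 'a tvec set" where
  "vertical_space M M' \<pi> p = {v \<in> tangent_space M p. pushforward M M' \<pi> v = 0}"

definition horizontal_space ::
  "('a, 'e::euclidean_space) manifold \<Rightarrow> ('b, 'f::euclidean_space) manifold \<Rightarrow> ('a \<Rightarrow> 'b) \<Rightarrow>
   'a form2 \<Rightarrow> 'a \<Rightarrow> 'a tvec set" where
  "horizontal_space M M' \<pi> g p =
     {u \<in> tangent_space M p. \<forall>v\<in>vertical_space M M' \<pi> p. g p u v = 0}"

definition riemannian_submersion ::
  "('a, 'e::euclidean_space) manifold \<Rightarrow> 'a form2 \<Rightarrow> ('b, 'f::euclidean_space) manifold \<Rightarrow> 'b form2 \<Rightarrow>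
   ('a \<Rightarrow> 'b) \<Rightarrow> bool" where
  "riemannian_submersion M g M' g' \<pi> \<longleftrightarrow>
     smooth_manifold M \<and> riemannian_metric M g \<and> smooth_manifold M' \<and> riemannian_metric M' g' \<and>
     smooth_map M M' \<pi> \<and> \<pi> ` points M = points M' \<and>
     (\<forall>p\<in>points M. pushforward M M' \<pi> ` tangent_space M p = tangent_space M' (\<pi> p) \<and>
        (\<forall>u\<in>horizontal_space M M' \<pi> g p. \<forall>v\<in>horizontal_space M M' \<pi> g p.
           g' (\<pi> p) (pushforward M M' \<pi> u) (pushforward M M' \<pi> v) = g p u v))"

definition contact_complex_submersion ::
  "('a, 'e::euclidean_space) manifold \<Rightarrow> 'a endo \<Rightarrow> 'a vfield \<Rightarrow> 'a form1 \<Rightarrow> 'a form2 \<Rightarrow>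
   ('b, 'f::euclidean_space) manifold \<Rightarrow> 'b endo \<Rightarrow> 'b form2 \<Rightarrow> ('a \<Rightarrow> 'b) \<Rightarrow> bool" where
  "contact_complex_submersion M \<phi> \<xi> \<eta> g M' J g' \<pi> \<longleftrightarrow>
     acm_manifold M \<phi> \<xi> \<eta> g \<and> almost_hermitian M' J g' \<and> riemannian_submersion M g M' g' \<pi> \<and>
     (\<forall>p\<in>points M. \<forall>u\<in>tangent_space M p.
        J (\<pi> p) (pushforward M M' \<pi> u) = pushforward M M' \<pi> (\<phi> p u))"

definition vertical_fields ::
  "('a, 'e::euclidean_space) manifold \<Rightarrow> ('b, 'f::euclidean_space) manifold \<Rightarrow> ('a \<Rightarrow> 'b) \<Rightarrow>
   'a vfield set" where
  "vertical_fields M M' \<pi> = {X \<in> vector_fields M. \<forall>p\<in>points M. X p \<in> vertical_space M M' \<pi> p}"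

definition horizontal_fields ::
  "('a, 'e::euclidean_space) manifold \<Rightarrow> ('b, 'f::euclidean_space) manifold \<Rightarrow> ('a \<Rightarrow> 'b) \<Rightarrow>
   'a form2 \<Rightarrow> 'a vfield set" where
  "horizontal_fields M M' \<pi> g =
     {X \<in> vector_fields M. \<forall>p\<in>points M. X p \<in> horizontal_space M M' \<pi> g p}"

definition vproj ::
  "('a, 'e::euclidean_space) manifold \<Rightarrow> ('b, 'f::euclidean_space) manifold \<Rightarrow> ('a \<Rightarrow> 'b) \<Rightarrow>
   'a form2 \<Rightarrow> 'a vfield \<Rightarrow> 'a vfield" where
  "vproj M M' \<pi> g E = (\<lambda>p. if p \<in> points M
     then THE v. v \<in> vertical_space M M' \<pi> p \<and> E p - v \<in> horizontal_space M M' \<pi> g p else 0)"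

definition hproj ::
  "('a, 'e::euclidean_space) manifold \<Rightarrow> ('b, 'f::euclidean_space) manifold \<Rightarrow> ('a \<Rightarrow> 'b) \<Rightarrow>
   'a form2 \<Rightarrow> 'a vfield \<Rightarrow> 'a vfield" where
  "hproj M M' \<pi> g E = E - vproj M M' \<pi> g E"

definition oneill_T ::
  "('a, 'e::euclidean_space) manifold \<Rightarrow> ('b, 'f::euclidean_space) manifold \<Rightarrow> ('a \<Rightarrow> 'b) \<Rightarrow>
   'a form2 \<Rightarrow> 'a conn \<Rightarrow> 'a vfield \<Rightarrow> 'a vfield \<Rightarrow> 'a vfield" where
  "oneill_T M M' \<pi> g D E F =
     hproj M M' \<pi> g (D (vproj M M' \<pi> g E) (vproj M M' \<pi> g F)) +
     vproj M M' \<pi> g (D (vproj M M' \<pi> g E) (hproj M M' \<pi> g F))"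

definition horizontal_totally_geodesic ::
  "('a, 'e::euclidean_space) manifold \<Rightarrow> ('b, 'f::euclidean_space) manifold \<Rightarrow> ('a \<Rightarrow> 'b) \<Rightarrow>
   'a form2 \<Rightarrow> 'a conn \<Rightarrow> bool" where
  "horizontal_totally_geodesic M M' \<pi> g D \<longleftrightarrow>
     (\<forall>X\<in>horizontal_fields M M' \<pi> g. \<forall>Y\<in>horizontal_fields M M' \<pi> g.
        D X Y \<in> horizontal_fields M M' \<pi> g)"

section \<open>Embedded submanifolds and fibres\<close>

text \<open>The subset \<^term>\<open>F\<close> with the subspace topology and the charts in which the inclusion into
  \<^term>\<open>M\<close> is a smooth immersion. This is a \<^const>\<open>smooth_manifold\<close> (i.e. the charts cover \<^term>\<open>F\<close>) if and
  only if \<^term>\<open>F\<close> is an embedded submanifold whose dimension is that of the model space \<^typ>\<open>'k\<close>.\<close>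

definition submanifold ::
  "('a, 'e::euclidean_space) manifold \<Rightarrow> 'a set \<Rightarrow> ('a, 'k::euclidean_space) manifold" where
  "submanifold M F = \<lparr> mfd_top = subtopology (mfd_top M) F,
     atlas = {(W, d). is_chart (subtopology (mfd_top M) F) W d \<and>
       (\<forall>(U, c)\<in>atlas M. smooth_on (d ` (W \<inter> U)) (c \<circ> inv_into W d) \<and>
          (\<forall>x\<in>d ` (W \<inter> U). inj (frechet_derivative (c \<circ> inv_into W d) (at x))))} \<rparr>"

definition fibre :: "('a, 'e::euclidean_space) manifold \<Rightarrow> ('a \<Rightarrow> 'b) \<Rightarrow> 'b \<Rightarrow> 'a set" where
  "fibre M \<pi> q = {p \<in> points M. \<pi> p = q}"

text \<open>Restrictions to a submanifold \<^term>\<open>N\<close> of \<^term>\<open>M\<close> (meaningful when \<open>A\<close> resp. \<open>X\<close> is tangent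
  to \<open>N\<close>). The differential of the inclusion identifies tangent vectors of \<open>N\<close>, which
  differentiate functions on \<open>N\<close>, with tangent vectors of \<open>M\<close>.\<close>

definition restr_endo ::
  "('a, 'k::euclidean_space) manifold \<Rightarrow> ('a, 'e::euclidean_space) manifold \<Rightarrow> 'a endo \<Rightarrow> 'a endo" where
  "restr_endo N M A = (\<lambda>p v. inv_into (tangent_space N p) (pushforward N M id)
     (A p (pushforward N M id v)))"

definition restr_field ::
  "('a, 'k::euclidean_space) manifold \<Rightarrow> ('a, 'e::euclidean_space) manifold \<Rightarrow> 'a vfield \<Rightarrow> 'a vfield" where
  "restr_field N M X = (\<lambda>p. if p \<in> points N
     then inv_into (tangent_space N p) (pushforward N M id) (X p) else 0)"

definition restr_form1 ::
  "('a, 'k::euclidean_space) manifold \<Rightarrow> ('a, 'e::euclidean_space) manifold \<Rightarrow> 'a form1 \<Rightarrow> 'a form1" where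
  "restr_form1 N M w = (\<lambda>p v. w p (pushforward N M id v))"

definition restr_form2 ::
  "('a, 'k::euclidean_space) manifold \<Rightarrow> ('a, 'e::euclidean_space) manifold \<Rightarrow> 'a form2 \<Rightarrow> 'a form2" where
  "restr_form2 N M g = (\<lambda>p u v. g p (pushforward N M id u) (pushforward N M id v))"

end

theory Submission
  imports Defs "HOL-Computational_Algebra.Polynomial"
begin

text \<open>
  The \<open>C\<^sub>1\<^sub>2\<close>-equation is equivalent to
  \<open>\<nabla>\<^sub>X(\<phi>Y) = \<phi>(\<nabla>\<^sub>XY) - \<eta>(X)(g(\<nabla>\<^sub>\<xi>\<xi>, \<phi>Y)\<xi> + \<eta>(Y)\<phi>(\<nabla>\<^sub>\<xi>\<xi>))\<close>, because \<open>\<eta> = g(\<cdot>, \<xi>)\<close> vanishes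
  on the image of \<open>\<phi>\<close> (\<open>C12_equation\<close>). The correction term vanishes whenever \<open>\<eta>(X) = 0\<close>, in particular
  for horizontal \<open>X\<close>, since \<open>\<xi>\<close> is vertical; moreover its values are combinations of \<open>\<xi>\<close> and
  \<open>\<phi>(\<nabla>\<^sub>\<xi>\<xi>)\<close>. All five assertions are read off from this equation.

  The second assertion is the key one. The vertical part \<open>A\<^sub>XY\<close> of \<open>\<nabla>\<^sub>XY\<close> for horizontal \<open>X\<close>, \<open>Y\<close> is
  tensorial, so that \<open>X\<close> and \<open>Y\<close> may be taken to be horizontal lifts of vector fields of the base. Then \<open>A\<close> is
  skew-symmetric, and the equation in the horizontal direction \<open>X\<close> gives
  \<open>A\<^bsub>\<phi>X\<^esub>Y = A\<^sub>X(\<phi>Y)\<close>. For a vertical \<open>U\<close> with \<open>\<eta>(U) = 0\<close>, however, \<open>g(\<nabla>\<^sub>UX, Y) = - g(\<nabla>\<^sub>XY, U)\<close>,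
  as \<open>[X, U]\<close> is vertical, and the equation in the direction \<open>U\<close> gives
  \<open>g(A\<^bsub>\<phi>X\<^esub>Y, U) = - g(A\<^sub>X(\<phi>Y), U)\<close>. So \<open>A\<close> has no component along such \<open>U\<close>
  (\<open>lifts_D_vertical_0\<close>); it has none along \<open>\<xi>\<close> because \<open>\<nabla>\<^sub>X(\<phi>Y)\<close> lies in the image of \<open>\<phi>\<close>
  (\<open>eta_D_horizontal\<close>).

  For the first assertion, the Koszul formula shows that the covariant derivative of the base is the projection of
  that of horizontal lifts (\<open>push_connection\<close>); as \<open>\<phi>\<close> lifts \<open>J\<close>, the equation becomes \<open>\<nabla>'J = 0\<close>. For the third,
  it shows likewise that the covariant derivative of a fibre is the vertical part of \<open>\<nabla>\<close> along vertical fields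
  (\<open>fibre_connection\<close>), and the vertical part of the equation is the equation of the fibre (\<open>C12_F\<close>). The
  fourth consists of the horizontal part of the equation for vertical \<open>X\<close>, \<open>Y\<close> together with the symmetry of
  \<open>T\<close> on vertical fields, and the fifth of the equation itself for one vertical and one
  horizontal field.

  Both Koszul arguments presuppose the existence of Levi-Civita connections on the base and on the
  fibres, and the third assertion that the fibres are manifolds. Vector fields being derivations of the algebra of
  smooth functions, most local arguments take an algebraic form: near every point some multiple \<open>b \<odot> X\<close> of a
  vector field is a combination of finitely many fixed global fields, with coefficients that depend
  linearly on \<open>X\<close> (\<open>frame\<close>, \<open>metric_frame\<close>). This gives tensoriality, the
  isomorphism between 1-forms and vector fields, the Levi-Civita connection and horizontal lifts by
  calculations in the module of vector fields. Analysis enters only through plateau functions and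
  Hadamard's lemma, which identify derivations with coordinate vectors (\<open>cutoff_coordinates\<close>), and through
  the smooth inverse function theorem, which provides the charts of the fibres (\<open>F_charts_cover\<close>) and the local
  extension of smooth functions from a fibre (\<open>CFF_extend\<close>).\<close>

section \<open>Smooth maps between Euclidean spaces\<close>

lemma C_k_on_subset: "C_k_on k S f \<Longrightarrow> T \<subseteq> S \<Longrightarrow> C_k_on k T f"
  by (induct k arbitrary: f) (auto intro: continuous_on_subset)

lemma C_k_on_cong:
  assumes "open S" "\<And>x. x \<in> S \<Longrightarrow> f x = g x" "C_k_on k S f"
  shows "C_k_on k S g"
  using assms(2,3)
proof (induct k arbitrary: f g)
  case 0
  then show ?case by (metis C_k_on.simps(1) continuous_on_eq)
next
  case (Suc k)
  have *: "frechet_derivative f (at x) = frechet_derivative g (at x)" "g differentiable (at x)"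
    if "x \<in> S" for x
  proof -
    have "f differentiable (at x)" using Suc that by simp
    then obtain f' where f': "(f has_derivative f') (at x)" by (auto simp: differentiable_def)
    have "(g has_derivative f') (at x)"
      using has_derivative_transform_within_open[OF f' \<open>open S\<close> that] Suc(2) by metis
    then show "g differentiable (at x)" "frechet_derivative f (at x) = frechet_derivative g (at x)"
      using frechet_derivative_at[OF f'] frechet_derivative_at[of g f' x] by (auto simp: differentiable_def)
  qed
  show ?case unfolding C_k_on.simps
  proof (intro conjI ballI allI)
    fix v show "C_k_on k S (\<lambda>x. frechet_derivative g (at x) v)"
    proof (rule Suc(1)[of "\<lambda>x. frechet_derivative f (at x) v"])
      show "C_k_on k S (\<lambda>x. frechet_derivative f (at x) v)" using Suc(3) by simp
    qed (simp only: *(1))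
  qed (use * in simp)
qed

lemma C_k_on_SucI:
  assumes "open S" "\<And>x. x \<in> S \<Longrightarrow> (f has_derivative F x) (at x)" "\<And>v. C_k_on k S (\<lambda>x. F x v)"
  shows "C_k_on (Suc k) S f"
proof -
  have "F x = frechet_derivative f (at x)" if "x \<in> S" for x
    using assms(2)[OF that] frechet_derivative_at by blast
  then have "C_k_on k S (\<lambda>x. frechet_derivative f (at x) v)" for v
    by (intro C_k_on_cong[OF assms(1) _ assms(3)[of v]]) simp
  then show ?thesis using assms(2) by (auto simp: differentiable_def)
qed

lemma C_k_on_SucD:
  assumes "C_k_on (Suc k) S f"
  shows "\<And>x. x \<in> S \<Longrightarrow> (f has_derivative frechet_derivative f (at x)) (at x)"
    "\<And>v. C_k_on k S (\<lambda>x. frechet_derivative f (at x) v)"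
  using assms by (simp_all flip: frechet_derivative_works)

lemma C_k_on_Suc_imp: "C_k_on (Suc k) S f \<Longrightarrow> C_k_on k S f"
proof (induct k arbitrary: f)
  case 0
  then show ?case by (auto intro!: continuous_at_imp_continuous_on differentiable_imp_continuous_within)
next
  case (Suc k)
  then show ?case by (metis C_k_on.simps(2))
qed

lemma C_k_on_const: "C_k_on k S (\<lambda>x. c)"
  by (induct k arbitrary: c) auto

lemma C_k_on_add:
  "open S \<Longrightarrow> C_k_on k S f \<Longrightarrow> C_k_on k S g \<Longrightarrow> C_k_on k S (\<lambda>x. f x + g x)"
proof (induct k arbitrary: f g)
  case 0
  then show ?case by (auto intro!: continuous_intros)
next
  case (Suc k)
  show ?case
    by (rule C_k_on_SucI[OF Suc(2)], rule has_derivative_add[OF C_k_on_SucD(1)[OF Suc(3)] C_k_on_SucD(1)[OF Suc(4)]])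
      (use Suc C_k_on_SucD(2) in auto)
qed

lemma C_k_on_sum:
  "open S \<Longrightarrow> finite I \<Longrightarrow> (\<And>i. i \<in> I \<Longrightarrow> C_k_on k S (f i)) \<Longrightarrow> C_k_on k S (\<lambda>x. \<Sum>i\<in>I. f i x)"
proof -
  assume "finite I" and *: "open S" "\<And>i. i \<in> I \<Longrightarrow> C_k_on k S (f i)"
  show ?thesis using \<open>finite I\<close> *(2)
    by (induct I rule: finite_induct) (simp_all add: C_k_on_add C_k_on_const *(1))
qed

lemma C_k_on_bounded_linear:
  assumes "bounded_linear L" "open S"
  shows "C_k_on k S f \<Longrightarrow> C_k_on k S (\<lambda>x. L (f x))"
proof (induct k arbitrary: f)
  case 0
  then show ?case by (simp add: bounded_linear.continuous_on[OF assms(1)])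
next
  case (Suc k)
  show ?case
    by (rule C_k_on_SucI[OF assms(2)], rule bounded_linear.has_derivative[OF assms(1) C_k_on_SucD(1)[OF Suc(2)]])
      (use Suc C_k_on_SucD(2) in auto)
qed

lemma C_k_on_scaleR:
  fixes f :: "'a::real_normed_vector \<Rightarrow> real"
  shows "open S \<Longrightarrow> C_k_on k S f \<Longrightarrow> C_k_on k S g \<Longrightarrow> C_k_on k S (\<lambda>x. f x *\<^sub>R g x)"
proof (induct k arbitrary: f g)
  case 0
  then show ?case by (auto intro!: continuous_intros)
next
  case (Suc k)
  show ?case
    by (rule C_k_on_SucI[OF Suc(2)], rule has_derivative_scaleR[OF C_k_on_SucD(1)[OF Suc(3)] C_k_on_SucD(1)[OF Suc(4)]], assumption, assumption)
      (intro C_k_on_add Suc(1) C_k_on_Suc_imp[OF Suc(3)] C_k_on_Suc_imp[OF Suc(4)] C_k_on_SucD(2)[OF Suc(3)] C_k_on_SucD(2)[OF Suc(4)] Suc(2))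
qed

text \<open>In the chain rule the direction \<open>Df(x)v\<close> varies with \<open>x\<close>. Expanding it in the basis of the
  intermediate space leaves products of coordinates with partial derivatives of \<open>g\<close> in fixed directions, to
  which the induction hypothesis applies.\<close>

lemma C_k_on_compose:
  fixes f :: "'a::real_normed_vector \<Rightarrow> 'b::euclidean_space"
  assumes "open S" "open T" "f ` S \<subseteq> T"
  shows "C_k_on k S f \<Longrightarrow> C_k_on k T g \<Longrightarrow> C_k_on k S (\<lambda>x. g (f x))"
proof (induct k arbitrary: g)
  case 0
  then show ?case using assms(3) by (auto intro: continuous_on_compose2)
next
  case (Suc k)
  have d: "((\<lambda>x. g (f x)) has_derivative
      (\<lambda>v. \<Sum>i\<in>Basis. (frechet_derivative f (at x) v \<bullet> i) *\<^sub>R frechet_derivative g (at (f x)) i)) (at x)"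
    if "x \<in> S" for x
  proof -
    have fx: "f x \<in> T" using that assms(3) by auto
    note dg = C_k_on_SucD(1)[OF Suc(3) fx]
    have lin: "linear (frechet_derivative g (at (f x)))" using dg has_derivative_linear by blast
    have "((\<lambda>x. g (f x)) has_derivative
      (\<lambda>v. frechet_derivative g (at (f x)) (frechet_derivative f (at x) v))) (at x)"
      using has_derivative_compose[OF C_k_on_SucD(1)[OF Suc(2) that] dg] .
    also have "(\<lambda>v. frechet_derivative g (at (f x)) (frechet_derivative f (at x) v)) =
      (\<lambda>v. \<Sum>i\<in>Basis. (frechet_derivative f (at x) v \<bullet> i) *\<^sub>R frechet_derivative g (at (f x)) i)"
    proof
      fix v
      have "frechet_derivative g (at (f x)) (frechet_derivative f (at x) v)
        = frechet_derivative g (at (f x)) (\<Sum>i\<in>Basis. (frechet_derivative f (at x) v \<bullet> i) *\<^sub>R i)"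
        by (simp add: euclidean_representation)
      also have "\<dots> = (\<Sum>i\<in>Basis. (frechet_derivative f (at x) v \<bullet> i) *\<^sub>R frechet_derivative g (at (f x)) i)"
        by (simp only: linear_sum[OF lin] linear_cmul[OF lin])
      finally show "frechet_derivative g (at (f x)) (frechet_derivative f (at x) v) = \<dots>" .
    qed
    finally show ?thesis .
  qed
  have fk: "C_k_on k S f" using Suc(2) C_k_on_Suc_imp by blast
  show ?case
  proof (rule C_k_on_SucI[OF assms(1) d])
    fix v
    have "C_k_on k S (\<lambda>x. frechet_derivative f (at x) v \<bullet> i)" for i
      by (rule C_k_on_bounded_linear[OF bounded_linear_inner_left assms(1) C_k_on_SucD(2)[OF Suc(2)]])
    moreover have "C_k_on k S (\<lambda>x. frechet_derivative g (at (f x)) i)" for i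
      by (rule Suc(1)[OF fk C_k_on_SucD(2)[OF Suc(3)]])
    ultimately show "C_k_on k S (\<lambda>x. \<Sum>i\<in>Basis. (frechet_derivative f (at x) v \<bullet> i) *\<^sub>R
        frechet_derivative g (at (f x)) i)"
      by (intro C_k_on_sum[OF assms(1) finite_Basis] C_k_on_scaleR[OF assms(1)])
  qed
qed

lemma C_k_on_inverse:
  fixes f :: "'a::real_normed_vector \<Rightarrow> real"
  assumes "open S" "\<And>x. x \<in> S \<Longrightarrow> f x \<noteq> 0"
  shows "C_k_on k S f \<Longrightarrow> C_k_on k S (\<lambda>x. inverse (f x))"
proof (induct k)
  case 0
  then show ?case using assms by (auto intro!: continuous_intros)
next
  case (Suc k)
  have k: "C_k_on k S (\<lambda>x. inverse (f x))" using Suc C_k_on_Suc_imp by blast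
  have "C_k_on k S (\<lambda>x. (-1) *\<^sub>R (inverse (f x) *\<^sub>R frechet_derivative f (at x) v *\<^sub>R inverse (f x)))" for v
    using assms(1) k C_k_on_SucD(2)[OF Suc(2), of v]
    by (intro C_k_on_scaleR) (auto intro: C_k_on_const)
  then have c: "C_k_on k S (\<lambda>x. - (inverse (f x) * frechet_derivative f (at x) v * inverse (f x)))" for v
    by (simp add: mult.assoc)
  show ?case
    by (rule C_k_on_SucI[OF assms(1)], rule Deriv.has_derivative_inverse[OF assms(2) C_k_on_SucD(1)[OF Suc(2)]]) (use c in auto)
qed

lemma smooth_on_iff:
  "smooth_on S f \<longleftrightarrow> (\<forall>x\<in>S. f differentiable (at x)) \<and>
     (\<forall>v. smooth_on S (\<lambda>x. frechet_derivative f (at x) v))"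
proof
  assume *: "smooth_on S f"
  then have "C_k_on (Suc k) S f" for k by (simp only: smooth_on_def)
  then show "(\<forall>x\<in>S. f differentiable (at x)) \<and> (\<forall>v. smooth_on S (\<lambda>x. frechet_derivative f (at x) v))"
    by (auto simp: smooth_on_def)
next
  assume "(\<forall>x\<in>S. f differentiable (at x)) \<and> (\<forall>v. smooth_on S (\<lambda>x. frechet_derivative f (at x) v))"
  then have "C_k_on (Suc k) S f" for k by (simp add: smooth_on_def)
  then show "smooth_on S f" unfolding smooth_on_def using C_k_on_Suc_imp by blast
qed

lemma smooth_on_has_derivative:
  "smooth_on S f \<Longrightarrow> x \<in> S \<Longrightarrow> (f has_derivative frechet_derivative f (at x)) (at x)"
  by (rule iffD1[OF frechet_derivative_works conjunct1[OF iffD1[OF smooth_on_iff], rule_format]])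

lemma smooth_on_frechet_derivative:
  "smooth_on S f \<Longrightarrow> smooth_on S (\<lambda>x. frechet_derivative f (at x) v)"
  by (rule conjunct2[OF iffD1[OF smooth_on_iff], rule_format])

lemma smooth_on_imp_continuous_on: "smooth_on S f \<Longrightarrow> continuous_on S f"
  by (metis smooth_on_def C_k_on.simps(1))

lemma smooth_on_subset: "smooth_on S f \<Longrightarrow> T \<subseteq> S \<Longrightarrow> smooth_on T f"
  by (auto simp: smooth_on_def intro: C_k_on_subset)

lemma smooth_on_cong:
  "open S \<Longrightarrow> (\<And>x. x \<in> S \<Longrightarrow> f x = g x) \<Longrightarrow> smooth_on S f \<Longrightarrow> smooth_on S g"
  unfolding smooth_on_def by (intro allI) (rule C_k_on_cong[of S f g], auto)

lemma smooth_on_const: "smooth_on S (\<lambda>x. c)"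
  by (simp add: smooth_on_def C_k_on_const)

lemma smooth_on_add: "open S \<Longrightarrow> smooth_on S f \<Longrightarrow> smooth_on S g \<Longrightarrow> smooth_on S (\<lambda>x. f x + g x)"
  by (simp add: smooth_on_def C_k_on_add)

lemma smooth_on_sum:
  "open S \<Longrightarrow> finite I \<Longrightarrow> (\<And>i. i \<in> I \<Longrightarrow> smooth_on S (f i)) \<Longrightarrow> smooth_on S (\<lambda>x. \<Sum>i\<in>I. f i x)"
  by (simp add: smooth_on_def C_k_on_sum)

lemma smooth_on_bounded_linear:
  "bounded_linear L \<Longrightarrow> open S \<Longrightarrow> smooth_on S f \<Longrightarrow> smooth_on S (\<lambda>x. L (f x))"
  by (simp add: smooth_on_def C_k_on_bounded_linear)

lemma smooth_on_scaleR:
  "open S \<Longrightarrow> smooth_on S f \<Longrightarrow> smooth_on S g \<Longrightarrow> smooth_on S (\<lambda>x. f x *\<^sub>R g x)"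
  by (simp add: smooth_on_def C_k_on_scaleR)

lemma smooth_on_mult:
  fixes f :: "'a::real_normed_vector \<Rightarrow> real"
  shows "open S \<Longrightarrow> smooth_on S f \<Longrightarrow> smooth_on S g \<Longrightarrow> smooth_on S (\<lambda>x. f x * g x)"
  using smooth_on_scaleR[of S f g] by simp

lemma smooth_on_compose:
  fixes f :: "'a::real_normed_vector \<Rightarrow> 'b::euclidean_space"
  shows "open S \<Longrightarrow> open T \<Longrightarrow> f ` S \<subseteq> T \<Longrightarrow> smooth_on S f \<Longrightarrow> smooth_on T g \<Longrightarrow>
    smooth_on S (\<lambda>x. g (f x))"
  unfolding smooth_on_def using C_k_on_compose[of S T f _ g] by blast

lemma smooth_on_inverse:
  fixes f :: "'a::real_normed_vector \<Rightarrow> real"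
  shows "open S \<Longrightarrow> (\<And>x. x \<in> S \<Longrightarrow> f x \<noteq> 0) \<Longrightarrow> smooth_on S f \<Longrightarrow> smooth_on S (\<lambda>x. inverse (f x))"
  by (simp add: smooth_on_def C_k_on_inverse)

lemma smooth_on_ident: "smooth_on S (\<lambda>x. x)"
  by (subst smooth_on_iff) (auto intro: smooth_on_const)

lemma smooth_on_linear:
  fixes L :: "'a::euclidean_space \<Rightarrow> 'b::euclidean_space"
  shows "linear L \<Longrightarrow> open S \<Longrightarrow> smooth_on S L"
  by (rule smooth_on_bounded_linear[OF _ _ smooth_on_ident]) (simp_all add: linear_conv_bounded_linear)

lemma smooth_on_inner_right: "open S \<Longrightarrow> smooth_on S f \<Longrightarrow> smooth_on S (\<lambda>x. f x \<bullet> i)"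
  by (rule smooth_on_bounded_linear[OF bounded_linear_inner_left])

lemma smooth_on_local:
  assumes "open S" "\<And>x. x \<in> S \<Longrightarrow> \<exists>U. open U \<and> x \<in> U \<and> smooth_on (S \<inter> U) f"
  shows "smooth_on S f"
  unfolding smooth_on_def
proof
  fix k
  have *: "\<And>x. x \<in> S \<Longrightarrow> \<exists>U. open U \<and> x \<in> U \<and> C_k_on k (S \<inter> U) f"
    using assms(2) unfolding smooth_on_def by blast
  show "C_k_on k S f" using *
  proof (induct k arbitrary: f)
    case 0
    show ?case unfolding C_k_on.simps
    proof (rule continuous_at_imp_continuous_on, rule ballI)
      fix x assume "x \<in> S"
      then obtain U where "open U" "x \<in> U" "C_k_on 0 (S \<inter> U) f" using 0 by blast
      then show "isCont f x"
        using \<open>x \<in> S\<close> assms(1) continuous_on_eq_continuous_at[of "S \<inter> U" f] by auto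
    qed
  next
    case (Suc k)
    show ?case unfolding C_k_on.simps
    proof (intro conjI ballI allI)
      fix x assume "x \<in> S"
      then show "f differentiable at x" using Suc(2)[of x] by auto
    next
      fix v show "C_k_on k S (\<lambda>x. frechet_derivative f (at x) v)"
      proof (rule Suc(1))
        fix x assume "x \<in> S"
        then obtain U where "open U" "x \<in> U" "C_k_on (Suc k) (S \<inter> U) f" using Suc(2) by blast
        then show "\<exists>U. open U \<and> x \<in> U \<and> C_k_on k (S \<inter> U) (\<lambda>x. frechet_derivative f (at x) v)"
          by (intro exI[of _ U]) simp
      qed
    qed
  qed
qed

text \<open>A class of continuous functions closed under directional derivatives consists of smooth functions.
  This suits functions whose derivatives of all orders have a common shape.\<close>

lemma smooth_on_coinduct:
  assumes "P f" "open S"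
    "\<And>f. P f \<Longrightarrow> \<exists>F. (\<forall>x\<in>S. (f has_derivative F x) (at x)) \<and> (\<forall>v. P (\<lambda>x. F x v))"
    "\<And>f. P f \<Longrightarrow> continuous_on S f"
  shows "smooth_on S f"
  unfolding smooth_on_def
proof
  fix k show "C_k_on k S f" using assms(1)
  proof (induct k arbitrary: f)
    case (Suc k)
    obtain F where F: "\<And>x. x\<in>S \<Longrightarrow> (f has_derivative F x) (at x)" "\<And>v. P (\<lambda>x. F x v)"
      using assms(3)[OF Suc(2)] by blast
    show ?case by (rule C_k_on_SucI[OF assms(2) F(1) Suc(1)[OF F(2)]])
  next
    case 0
    then show ?case using assms(4) by (simp only: C_k_on.simps)
  qed
qed

section \<open>The smooth inverse function theorem\<close>

text \<open>A product rule in which one factor is merely continuous: its increments are multiplied by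
  the other factor, which vanishes at the point.\<close>

lemma has_derivative_mult_zero:
  fixes \<phi> :: "'a::real_normed_vector \<Rightarrow> real" and \<psi> :: "'a \<Rightarrow> 'b::real_normed_vector"
  assumes d: "(\<phi> has_derivative \<phi>') (at y0)" and z: "\<phi> y0 = 0" and c: "isCont \<psi> y0"
  shows "((\<lambda>y. \<phi> y *\<^sub>R \<psi> y) has_derivative (\<lambda>u. \<phi>' u *\<^sub>R \<psi> y0)) (at y0)"
proof -
  interpret bounded_linear \<phi>' using d by (rule has_derivative_bounded_linear)
  obtain K where K: "\<And>x. norm (\<phi>' x) \<le> norm x * K" "K > 0" using pos_bounded by blast
  define r where "r y = (\<phi> y - \<phi>' (y - y0)) / norm (y - y0)" for y
  have r0: "r \<midarrow>y0\<rightarrow> 0"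
    using d unfolding has_derivative_at_within r_def
    by (simp add: z divide_inverse mult.commute)
  have psi: "\<psi> \<midarrow>y0\<rightarrow> \<psi> y0" using c by (simp add: isCont_def)
  have t1: "(\<lambda>y. r y *\<^sub>R \<psi> y) \<midarrow>y0\<rightarrow> 0"
    using tendsto_scaleR[OF r0 psi] by simp
  have t2: "(\<lambda>y. (\<phi>' (y - y0) / norm (y - y0)) *\<^sub>R (\<psi> y - \<psi> y0)) \<midarrow>y0\<rightarrow> 0"
  proof (rule Lim_null_comparison)
    show "\<forall>\<^sub>F y in at y0. norm ((\<phi>' (y - y0) / norm (y - y0)) *\<^sub>R (\<psi> y - \<psi> y0)) \<le> K * norm (\<psi> y - \<psi> y0)"
    proof (rule always_eventually, rule allI)
      fix y
      have "\<bar>\<phi>' (y - y0)\<bar> / norm (y - y0) \<le> K"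
        using K(1)[of "y - y0"] K(2) by (cases "y = y0") (auto simp: divide_simps mult.commute)
      then show "norm ((\<phi>' (y - y0) / norm (y - y0)) *\<^sub>R (\<psi> y - \<psi> y0)) \<le> K * norm (\<psi> y - \<psi> y0)"
        using mult_right_mono[OF _ norm_ge_zero[of "\<psi> y - \<psi> y0"]] by fastforce
    qed
    show "(\<lambda>y. K * norm (\<psi> y - \<psi> y0)) \<midarrow>y0\<rightarrow> 0"
      using psi by (intro tendsto_mult_right_zero tendsto_norm_zero) (simp add: LIM_zero_iff)
  qed
  have "(\<lambda>y. ((\<phi> y *\<^sub>R \<psi> y) - (\<phi> y0 *\<^sub>R \<psi> y0) - \<phi>' (y - y0) *\<^sub>R \<psi> y0) /\<^sub>R norm (y - y0)) =
    (\<lambda>y. r y *\<^sub>R \<psi> y + (\<phi>' (y - y0) / norm (y - y0)) *\<^sub>R (\<psi> y - \<psi> y0))"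
    by (auto simp: fun_eq_iff r_def z divide_inverse algebra_simps)
  then have "(\<lambda>y. ((\<phi> y *\<^sub>R \<psi> y) - (\<phi> y0 *\<^sub>R \<psi> y0) - \<phi>' (y - y0) *\<^sub>R \<psi> y0) /\<^sub>R norm (y - y0)) \<midarrow>y0\<rightarrow> 0"
    using tendsto_add[OF t1 t2] by simp
  moreover have "bounded_linear (\<lambda>u. \<phi>' u *\<^sub>R \<psi> y0)"
    by (rule bounded_linear_scaleR_const) (rule bounded_linear_axioms)
  ultimately show ?thesis by (simp add: has_derivative_at_within)
qed

lemma continuous_on_Blinfun_frechet_derivative:
  fixes f :: "'a::euclidean_space \<Rightarrow> 'b::euclidean_space"
  assumes "smooth_on S f"
  shows "continuous_on S (\<lambda>x. Blinfun (frechet_derivative f (at x)))"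
proof (rule continuous_on_blinfun_componentwise)
  fix i :: 'a
  have "continuous_on S (\<lambda>x. frechet_derivative f (at x) i)"
    by (intro smooth_on_imp_continuous_on smooth_on_frechet_derivative assms)
  moreover have "blinfun_apply (Blinfun (frechet_derivative f (at x))) i = frechet_derivative f (at x) i"
    if "x \<in> S" for x
    using smooth_on_has_derivative[OF assms that]
    by (simp add: bounded_linear_Blinfun_apply has_derivative_bounded_linear)
  ultimately show "continuous_on S (\<lambda>x. blinfun_apply (Blinfun (frechet_derivative f (at x))) i)"
    by (subst continuous_on_cong[OF refl]) auto
qed

text \<open>The pointwise inverse \<open>B y\<close> of an invertible linear map \<open>A y\<close> depending on \<open>y\<close> satisfies
  \<open>B y v - B y\<^sub>0 v = - B y ((A y - A y\<^sub>0) (B y\<^sub>0 v))\<close>; this gives first its continuity and then, expanding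
  the argument of \<open>B y\<close> in a basis, its derivative.\<close>

lemma has_derivative_pointwise_inverse:
  fixes A B :: "'x::real_normed_vector \<Rightarrow> 'e::euclidean_space \<Rightarrow> 'e"
  assumes V: "open V" "y0 \<in> V"
    and linA: "\<And>y. y \<in> V \<Longrightarrow> linear (A y)" and linB: "\<And>y. y \<in> V \<Longrightarrow> linear (B y)"
    and AB: "\<And>y w. y \<in> V \<Longrightarrow> A y (B y w) = w" and BA: "\<And>y w. y \<in> V \<Longrightarrow> B y (A y w) = w"
    and d: "\<And>w. ((\<lambda>y. A y w) has_derivative A' w) (at y0)"
  shows "((\<lambda>y. B y v) has_derivative (\<lambda>u. - B y0 (A' (B y0 v) u))) (at y0)"
proof -
  obtain K where K: "\<And>w. norm (B y0 w) \<le> norm w * K" "K > 0"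
    using bounded_linear.pos_bounded linB[OF V(2)] linear_conv_bounded_linear by metis
  have cA: "((\<lambda>y. \<Sum>i\<in>Basis. norm (A y i - A y0 i)) \<longlongrightarrow> 0) (at y0)"
  proof (rule tendsto_eq_rhs[OF tendsto_sum])
    fix i
    have "isCont (\<lambda>y. A y i) y0" using has_derivative_continuous[OF d] .
    then show "((\<lambda>y. norm (A y i - A y0 i)) \<longlongrightarrow> 0) (at y0)"
      by (simp add: isCont_def LIM_zero tendsto_norm_zero)
  qed simp
  have evV: "\<forall>\<^sub>F y in at y0. y \<in> V" using V eventually_at_topological by blast
  have bound: "\<forall>\<^sub>F y in at y0. \<forall>w. norm (B y w) \<le> 2 * K * norm w"
  proof -
    have "\<forall>\<^sub>F y in at y0. (\<Sum>i\<in>Basis. norm (A y i - A y0 i)) < 1 / (2 * K)"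
      by (rule order_tendstoD[OF cA]) (simp add: K)
    then show ?thesis using evV
    proof eventually_elim
      case (elim y)
      show ?case
      proof
        fix w
        define z where "z = B y w"
        have lin: "linear (\<lambda>x. A y x - A y0 x)"
          by (intro linear_compose_sub linA elim V)
        have eqz: "A y z - A y0 z = (\<Sum>i\<in>Basis. (z \<bullet> i) *\<^sub>R (A y i - A y0 i))"
        proof -
          have "A y z - A y0 z = (\<lambda>x. A y x - A y0 x) (\<Sum>i\<in>Basis. (z \<bullet> i) *\<^sub>R i)"
            by (simp add: euclidean_representation)
          also have "\<dots> = (\<Sum>i\<in>Basis. (z \<bullet> i) *\<^sub>R (A y i - A y0 i))"
            by (subst linear_sum[OF lin]) (simp add: linear_cmul[OF linA[OF elim(2)]] linear_cmul[OF linA[OF V(2)]] scaleR_diff_right)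
          finally show ?thesis .
        qed
        have "norm (A y z - A y0 z) \<le> (\<Sum>i\<in>Basis. norm z * norm (A y i - A y0 i))"
          unfolding eqz by (rule sum_norm_le) (auto intro!: mult_right_mono Basis_le_norm)
        also have "\<dots> = norm z * (\<Sum>i\<in>Basis. norm (A y i - A y0 i))" by (simp add: sum_distrib_left)
        also have "\<dots> \<le> norm z * (1 / (2 * K))" using elim by (intro mult_left_mono) auto
        finally have 1: "norm (A y z - A y0 z) \<le> norm z / (2 * K)" by simp
        have "norm z = norm (B y0 (A y0 z))" by (simp add: BA V)
        also have "\<dots> \<le> norm (A y0 z) * K" by (rule K)
        also have "norm (A y0 z) \<le> norm (A y z) + norm (A y z - A y0 z)"
          by (metis norm_minus_commute norm_triangle_sub)
        finally have "norm z \<le> (norm (A y z) + norm (A y z - A y0 z)) * K" using K(2) by simp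
        also have "\<dots> \<le> (norm w + norm z / (2 * K)) * K"
          using 1 K(2) by (intro mult_right_mono add_mono) (auto simp: z_def AB elim)
        also have "\<dots> = norm w * K + norm z / 2" using K(2) by (simp add: field_simps)
        finally show "norm (B y w) \<le> 2 * K * norm w" by (simp add: z_def field_simps)
      qed
    qed
  qed
  define h where "h y v = A y (B y0 v) - v" for y v
  have dh: "((\<lambda>y. h y v) has_derivative A' (B y0 v)) (at y0)" for v
    unfolding h_def using has_derivative_diff[OF d has_derivative_const] by simp
  have h0: "h y0 v = 0" for v by (simp add: h_def AB V)
  have Bh: "B y v = B y0 v - B y (h y v)" if "y \<in> V" for y v
    using that by (simp add: h_def linear_diff[OF linB[OF that]] BA)
  have contB: "isCont (\<lambda>y. B y v) y0" for v
  proof -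
    have "((\<lambda>y. B y v - B y0 v) \<longlongrightarrow> 0) (at y0)"
    proof (rule Lim_null_comparison)
      show "\<forall>\<^sub>F y in at y0. norm (B y v - B y0 v) \<le> 2 * K * norm (h y v)"
        using bound evV
      proof eventually_elim
        case (elim y)
        have "B y v - B y0 v = - B y (h y v)" using Bh[OF elim(2), of v] by simp
        then show ?case using elim(1) by simp
      qed
      show "((\<lambda>y. 2 * K * norm (h y v)) \<longlongrightarrow> 0) (at y0)"
        using has_derivative_continuous[OF dh, of v] h0[of v]
        by (intro tendsto_mult_right_zero tendsto_norm_zero) (simp add: isCont_def continuous_within)
    qed
    then show ?thesis by (simp add: isCont_def LIM_zero_iff)
  qed
  have "((\<lambda>y. B y0 v - (\<Sum>i\<in>Basis. (h y v \<bullet> i) *\<^sub>R B y i)) has_derivative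
      (\<lambda>u. 0 - (\<Sum>i\<in>Basis. (A' (B y0 v) u \<bullet> i) *\<^sub>R B y0 i))) (at y0)"
    by (intro has_derivative_diff has_derivative_const has_derivative_sum has_derivative_mult_zero
        bounded_linear.has_derivative[OF bounded_linear_inner_left dh] contB)
      (simp_all add: h0)
  also have "(\<lambda>u. 0 - (\<Sum>i\<in>Basis. (A' (B y0 v) u \<bullet> i) *\<^sub>R B y0 i)) = (\<lambda>u. - B y0 (A' (B y0 v) u))"
  proof
    fix u
    have "B y0 (A' (B y0 v) u) = B y0 (\<Sum>i\<in>Basis. (A' (B y0 v) u \<bullet> i) *\<^sub>R i)"
      by (simp add: euclidean_representation)
    also have "\<dots> = (\<Sum>i\<in>Basis. (A' (B y0 v) u \<bullet> i) *\<^sub>R B y0 i)"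
      by (simp add: linear_sum[OF linB[OF V(2)]] linear_cmul[OF linB[OF V(2)]])
    finally show "0 - (\<Sum>i\<in>Basis. (A' (B y0 v) u \<bullet> i) *\<^sub>R B y0 i) = - B y0 (A' (B y0 v) u)" by simp
  qed
  finally have *: "((\<lambda>y. B y0 v - (\<Sum>i\<in>Basis. (h y v \<bullet> i) *\<^sub>R B y i)) has_derivative
      (\<lambda>u. - B y0 (A' (B y0 v) u))) (at y0)" .
  show ?thesis
  proof (rule has_derivative_transform_within_open[OF * V])
    fix y assume y: "y \<in> V"
    have "B y (h y v) = B y (\<Sum>i\<in>Basis. (h y v \<bullet> i) *\<^sub>R i)" by (simp add: euclidean_representation)
    also have "\<dots> = (\<Sum>i\<in>Basis. (h y v \<bullet> i) *\<^sub>R B y i)"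
      by (simp add: linear_sum[OF linB[OF y]] linear_cmul[OF linB[OF y]])
    finally show "B y0 v - (\<Sum>i\<in>Basis. (h y v \<bullet> i) *\<^sub>R B y i) = B y v" using Bh[OF y, of v] by simp
  qed
qed

lemma smooth_on_imp_C_k_on: "smooth_on S f \<Longrightarrow> C_k_on k S f"
  by (simp add: smooth_on_def)

text \<open>The derivative of \<open>y \<mapsto> Dg(y)v\<close> in the direction \<open>u\<close> is
  \<open>- Dg(y)(D\<^sup>2f(g(y))(Dg(y)v, Dg(y)u))\<close>. In coordinates this is a polynomial in the entries of \<open>Dg\<close> and in
  second derivatives of \<open>f\<close> composed with \<open>g\<close>, so that differentiability of order \<open>k\<close> of \<open>g\<close> and \<open>Dg\<close>
  together implies that of order \<open>k + 1\<close>.\<close>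

lemma smooth_on_local_inverse:
  fixes f g :: "'e::euclidean_space \<Rightarrow> 'e"
  assumes "open U" "open V" "smooth_on U f" "g ` V \<subseteq> U"
    and dg: "\<And>y. y \<in> V \<Longrightarrow> (g has_derivative g' y) (at y)"
    and inv: "\<And>y w. y \<in> V \<Longrightarrow> g' y (frechet_derivative f (at (g y)) w) = w"
  shows "smooth_on V g"
proof -
  let ?A = "\<lambda>y. frechet_derivative f (at (g y))"
  have gU: "g y \<in> U" if "y \<in> V" for y using that assms(4) by auto
  have linA: "linear (?A y)" if "y \<in> V" for y
    using smooth_on_has_derivative[OF assms(3) gU[OF that]] has_derivative_linear by blast
  have linB: "linear (g' y)" if "y \<in> V" for y
    using dg[OF that] has_derivative_linear by blast
  have AB: "?A y (g' y w) = w" if "y \<in> V" for y w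
  proof -
    have "g' y \<circ> ?A y = id" using inv[OF that] by auto
    then have "?A y \<circ> g' y = id" using linear_inverse_left[OF linA[OF that] linB[OF that]] by simp
    then show ?thesis by (metis comp_apply id_apply)
  qed
  define A2 where "A2 y w u = frechet_derivative (\<lambda>x. frechet_derivative f (at x) w) (at (g y)) (g' y u)" for y w u
  have dA: "((\<lambda>y. ?A y w) has_derivative A2 y w) (at y)" if "y \<in> V" for y w
    using has_derivative_compose[OF dg[OF that] smooth_on_has_derivative[OF smooth_on_frechet_derivative[OF assms(3), of w] gU[OF that]]]
    unfolding A2_def .
  have dB: "((\<lambda>y. g' y v) has_derivative (\<lambda>u. - g' y (A2 y (g' y v) u))) (at y)" if "y \<in> V" for y v
    by (rule has_derivative_pointwise_inverse[OF assms(2) that linA linB AB inv dA[OF that]])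
  have "C_k_on k V g \<and> (\<forall>v. C_k_on k V (\<lambda>y. g' y v))" for k
  proof (induct k)
    case 0
    have "isCont (\<lambda>y. g' y v) y" if "y \<in> V" for y v
      using has_derivative_continuous[OF dB[OF that]] .
    then show ?case
      using has_derivative_continuous[OF dg] by (auto intro!: continuous_at_imp_continuous_on)
  next
    case (Suc k)
    have c1: "C_k_on (Suc k) V g"
      by (rule C_k_on_SucI[OF assms(2) dg conjunct2[OF Suc, rule_format]])
    have "C_k_on (Suc k) V (\<lambda>y. g' y v)" for v
    proof (rule C_k_on_SucI[OF assms(2) dB], assumption+)
      fix u
      have s2: "C_k_on k U (\<lambda>x. frechet_derivative (\<lambda>x. frechet_derivative f (at x) j) (at x) l)" for j l
        by (rule smooth_on_imp_C_k_on[OF smooth_on_frechet_derivative[OF smooth_on_frechet_derivative[OF assms(3)]]])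
      define h where "h j l y = frechet_derivative (\<lambda>x. frechet_derivative f (at x) j) (at (g y)) l" for j l y
      have h: "C_k_on k V (h j l)" for j l
        unfolding h_def by (rule C_k_on_compose[where g = "\<lambda>x. frechet_derivative (\<lambda>x. frechet_derivative f (at x) j) (at x) l",
            OF assms(2,1,4) conjunct1[OF Suc] s2[of j l]])
      have comp: "C_k_on k V (\<lambda>y. g' y w \<bullet> i)" for w i
        by (rule C_k_on_bounded_linear[OF bounded_linear_inner_left assms(2) conjunct2[OF Suc, rule_format]])
      have comp2: "C_k_on k V (\<lambda>y. h j l y \<bullet> i)" for j l i
        by (rule C_k_on_bounded_linear[OF bounded_linear_inner_left assms(2) h])
      have eq: "A2 y (g' y v) u = (\<Sum>j\<in>Basis. \<Sum>l\<in>Basis. (g' y v \<bullet> j) *\<^sub>R (g' y u \<bullet> l) *\<^sub>R h j l y)"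
        if y: "y \<in> V" for y
      proof -
        have l1: "linear (A2 y w)" for w using dA[OF y] has_derivative_linear by blast
        have e1: "A2 y (g' y v) u = (\<Sum>j\<in>Basis. (g' y v \<bullet> j) *\<^sub>R A2 y j u)"
        proof -
          have 1: "((\<lambda>z. \<Sum>j\<in>Basis. (g' y v \<bullet> j) *\<^sub>R ?A z j) has_derivative
              (\<lambda>u. \<Sum>j\<in>Basis. (g' y v \<bullet> j) *\<^sub>R A2 y j u)) (at y)"
            by (intro has_derivative_sum has_derivative_scaleR_right dA y)
          have "((\<lambda>z. ?A z (g' y v)) has_derivative
              (\<lambda>u. \<Sum>j\<in>Basis. (g' y v \<bullet> j) *\<^sub>R A2 y j u)) (at y)"
          proof (rule has_derivative_transform_within_open[OF 1 assms(2) y])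
            fix z assume z: "z \<in> V"
            have "?A z (g' y v) = ?A z (\<Sum>j\<in>Basis. (g' y v \<bullet> j) *\<^sub>R j)" by (simp add: euclidean_representation)
            then show "(\<Sum>j\<in>Basis. (g' y v \<bullet> j) *\<^sub>R ?A z j) = ?A z (g' y v)"
              by (simp add: linear_sum[OF linA[OF z]] linear_cmul[OF linA[OF z]])
          qed
          then show ?thesis by (rule fun_cong[OF has_derivative_unique[OF dA[OF y]]])
        qed
        have e2: "A2 y j u = (\<Sum>l\<in>Basis. (g' y u \<bullet> l) *\<^sub>R h j l y)" for j
        proof -
          have lin: "linear (frechet_derivative (\<lambda>x. frechet_derivative f (at x) j) (at (g y)))"
            using smooth_on_has_derivative[OF smooth_on_frechet_derivative[OF assms(3)] gU[OF y]] has_derivative_linear by blast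
          have "A2 y j u = frechet_derivative (\<lambda>x. frechet_derivative f (at x) j) (at (g y)) (\<Sum>l\<in>Basis. (g' y u \<bullet> l) *\<^sub>R l)"
            by (simp add: A2_def euclidean_representation)
          then show ?thesis by (simp add: linear_sum[OF lin] linear_cmul[OF lin] h_def)
        qed
        show ?thesis unfolding e1 by (simp add: e2 scaleR_sum_right)
      qed
      define q where "q i y = (\<Sum>j\<in>Basis. \<Sum>l\<in>Basis. (g' y v \<bullet> j) *\<^sub>R (g' y u \<bullet> l) *\<^sub>R (h j l y \<bullet> i))" for i y
      have q: "C_k_on k V (q i)" for i
        unfolding q_def
        by (intro C_k_on_sum[OF assms(2) finite_Basis] C_k_on_scaleR[OF assms(2)] comp comp2)
      have "C_k_on k V (\<lambda>y. (-1) *\<^sub>R (\<Sum>i\<in>Basis. q i y *\<^sub>R g' y i))"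
        by (rule C_k_on_scaleR[OF assms(2) C_k_on_const C_k_on_sum[OF assms(2) finite_Basis
              C_k_on_scaleR[OF assms(2) q conjunct2[OF Suc, rule_format]]]])
      then show "C_k_on k V (\<lambda>y. - g' y (A2 y (g' y v) u))"
      proof (rule C_k_on_cong[OF assms(2), rotated])
        fix y assume y: "y \<in> V"
        have "g' y (A2 y (g' y v) u) = g' y (\<Sum>i\<in>Basis. (A2 y (g' y v) u \<bullet> i) *\<^sub>R i)"
          by (simp add: euclidean_representation)
        also have "\<dots> = (\<Sum>i\<in>Basis. (A2 y (g' y v) u \<bullet> i) *\<^sub>R g' y i)"
          by (simp only: linear_sum[OF linB[OF y]] linear_cmul[OF linB[OF y]])
        also have "\<dots> = (\<Sum>i\<in>Basis. q i y *\<^sub>R g' y i)"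
          unfolding eq[OF y] q_def by (simp add: inner_sum_left mult.assoc)
        finally show "(-1) *\<^sub>R (\<Sum>i\<in>Basis. q i y *\<^sub>R g' y i) = - g' y (A2 y (g' y v) u)" by simp
      qed
    qed
    with c1 show ?case by (intro conjI allI)
  qed
  then show ?thesis unfolding smooth_on_def by (rule allI[OF conjunct1])
qed

theorem smooth_inverse_function:
  fixes f :: "'e::euclidean_space \<Rightarrow> 'e"
  assumes "open U" "smooth_on U f" "x0 \<in> U" and d0: "(f has_derivative id) (at x0)"
  obtains W V g where "open W" "W \<subseteq> U" "x0 \<in> W" "open V" "homeomorphism W V f g" "smooth_on V g"
proof -
  let ?f' = "\<lambda>x. Blinfun (frechet_derivative f (at x))"
  have app: "blinfun_apply (?f' x) = frechet_derivative f (at x)" if "x \<in> U" for x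
    using smooth_on_has_derivative[OF assms(2) that]
    by (simp add: bounded_linear_Blinfun_apply has_derivative_bounded_linear)
  have f0: "frechet_derivative f (at x0) = id" using frechet_derivative_at[OF d0] by simp
  have "blinfun_apply (?f' x0) = id" by (rule trans[OF app[OF assms(3)] f0])
  then have inv: "id_blinfun o\<^sub>L ?f' x0 = id_blinfun"
    by (intro blinfun_eqI) (simp only: blinfun_apply_blinfun_compose blinfun_apply_id_blinfun id_apply)
  have der: "(f has_derivative blinfun_apply (?f' x)) (at x)" if "x \<in> U" for x
    using smooth_on_has_derivative[OF assms(2) that] app[OF that] by simp
  show thesis
  proof (rule inverse_function_theorem[OF assms(1) der continuous_on_Blinfun_frechet_derivative[OF assms(2)] assms(3) inv])
    fix W V g g'
    assume *: "open W" "W \<subseteq> U" "x0 \<in> W" "open V" "f x0 \<in> V" "homeomorphism W V f g"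
      and dg: "\<And>y. y \<in> V \<Longrightarrow> (g has_derivative (g' y)) (at y)"
      and g': "\<And>y. y \<in> V \<Longrightarrow> g' y = Hilbert_Choice.inv (blinfun_apply (?f' (g y)))"
      and bij: "\<And>y. y \<in> V \<Longrightarrow> bij (blinfun_apply (?f' (g y)))"
    have gV: "g ` V \<subseteq> U" using *(2,6) by (auto simp: homeomorphism_def)
    have "smooth_on V g"
    proof (rule smooth_on_local_inverse[OF assms(1) *(4) assms(2) gV dg])
      fix y w assume y: "y \<in> V"
      then have gy: "g y \<in> U" using gV by auto
      have "Hilbert_Choice.inv (blinfun_apply (?f' (g y))) (blinfun_apply (?f' (g y)) w) = w"
        by (rule inv_f_f[OF bij_is_inj[OF bij[OF y]]])
      then show "g' y (frechet_derivative f (at (g y)) w) = w"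
        unfolding g'[OF y] app[OF gy] .
    qed
    then show thesis by (rule that[OF *(1-4,6)])
  qed assumption
qed

section \<open>Plateau functions and the Hadamard lemma\<close>

lemma poly_inverse_exp_tendsto_0:
  "((\<lambda>t. poly p (1 / t) * exp (- 1 / t)) \<longlongrightarrow> (0::real)) (at_right 0)"
proof -
  have 1: "filterlim (\<lambda>t::real. 1 / t) at_top (at_right 0)"
    using filterlim_inverse_at_top_right by (simp add: inverse_eq_divide)
  have eq: "poly p x * exp (- x) = (\<Sum>i\<le>degree p. coeff p i * (x ^ i / exp x))" for x :: real
    by (simp add: poly_altdef exp_minus sum_distrib_right sum_distrib_left divide_inverse mult_ac)
  have "((\<lambda>x::real. \<Sum>i\<le>degree p. coeff p i * (x ^ i / exp x)) \<longlongrightarrow>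
      (\<Sum>i\<le>degree p. coeff p i * 0)) at_top"
    by (intro tendsto_sum tendsto_mult tendsto_const tendsto_power_div_exp_0)
  then have "((\<lambda>x::real. poly p x * exp (- x)) \<longlongrightarrow> 0) at_top" by (simp add: eq)
  from filterlim_compose[OF this 1] show ?thesis by simp
qed

text \<open>The functions \<open>t \<mapsto> p (1/t) exp (-1/t)\<close>, extended by \<open>0\<close> to \<open>t \<le> 0\<close>, are closed under
  differentiation, and hence smooth.\<close>

definition flat :: "real poly \<Rightarrow> real \<Rightarrow> real" where
  "flat p t = (if t \<le> 0 then 0 else poly p (1 / t) * exp (- 1 / t))"

lemma flat_has_derivative:
  "(flat p has_field_derivative flat ([:0, 0, 1:] * (p - pderiv p)) t) (at t)"
proof -
  consider "t < 0" | "t = 0" | "t > 0" by linarith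
  then show ?thesis
  proof cases
    case 1
    have "((\<lambda>_. 0) has_field_derivative 0) (at t)" by simp
    then have "(flat p has_field_derivative 0) (at t)"
      by (rule has_field_derivative_transform_within_open[where S = "{..<0}"]) (use 1 in \<open>auto simp: flat_def\<close>)
    then show ?thesis using 1 by (simp add: flat_def)
  next
    case 3
    have "((\<lambda>t. poly p (1 / t) * exp (- 1 / t)) has_field_derivative
        flat ([:0, 0, 1:] * (p - pderiv p)) t) (at t)"
      using 3 by (auto intro!: derivative_eq_intros simp: flat_def field_simps power2_eq_square)
    then show ?thesis
      by (rule has_field_derivative_transform_within_open[where S = "{0<..}"]) (use 3 in \<open>auto simp: flat_def\<close>)
  next
    case 2
    have l: "((\<lambda>h. (flat p (0 + h) - flat p 0) / h) \<longlongrightarrow> 0) (at_left 0)"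
      by (rule tendsto_eventually) (auto simp: flat_def eventually_at_filter)
    have "((\<lambda>t. poly ([:0, 1:] * p) (1 / t) * exp (- 1 / t)) \<longlongrightarrow> 0) (at_right 0)"
      by (rule poly_inverse_exp_tendsto_0)
    then have r: "((\<lambda>h. (flat p (0 + h) - flat p 0) / h) \<longlongrightarrow> 0) (at_right 0)"
      by (rule tendsto_cong[THEN iffD1, rotated]) (auto simp: flat_def eventually_at_filter)
    have "((\<lambda>h. (flat p (0 + h) - flat p 0) / h) \<longlongrightarrow> 0) (at 0)"
      using filterlim_split_at[OF l r] .
    then show ?thesis using 2 by (simp add: DERIV_def flat_def)
  qed
qed

lemma smooth_on_flat: "smooth_on UNIV (flat p)"
proof (rule smooth_on_coinduct[where P = "\<lambda>f. \<exists>p c. f = (\<lambda>t. c * flat p t)"])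
  show "\<exists>q c. flat p = (\<lambda>t. c * flat q t)" by (intro exI[of _ p] exI[of _ 1]) simp
next
  fix f :: "real \<Rightarrow> real" assume "\<exists>p c. f = (\<lambda>t. c * flat p t)"
  then obtain p c where f: "f = (\<lambda>t. c * flat p t)" by blast
  let ?q = "[:0, 0, 1:] * (p - pderiv p)"
  have d: "(f has_derivative (\<lambda>v. c * (flat ?q t * v))) (at t)" for t
    unfolding f using has_derivative_mult_right[OF flat_has_derivative[of p t, unfolded has_field_derivative_def]] .
  show "\<exists>F. (\<forall>x\<in>UNIV. (f has_derivative F x) (at x)) \<and> (\<forall>v. \<exists>p c. (\<lambda>x. F x v) = (\<lambda>t. c * flat p t))"
    by (rule exI[of _ "\<lambda>t v. c * (flat ?q t * v)"], intro conjI ballI d allI, rule_tac x = ?q in exI,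
        rule_tac x = "c * v" in exI) (simp add: mult_ac)
  show "continuous_on UNIV f"
    using has_derivative_continuous[OF d] by (simp add: continuous_at_imp_continuous_on)
qed simp

text \<open>With \<open>u(y) = 2 - \<bar>y - p\<bar>\<^sup>2 / r\<^sup>2\<close> and the flat function \<open>a\<close>, the quotient
  \<open>a(u) / (a(u) + a(1 - u))\<close> is \<open>1\<close> where \<open>u \<ge> 1\<close> and \<open>0\<close> where \<open>u \<le> 0\<close>; its denominator has no zero.\<close>

lemma smooth_plateau_exists:
  fixes p :: "'e::euclidean_space"
  assumes "r > 0"
  obtains b :: "'e \<Rightarrow> real" where "smooth_on UNIV b" "\<And>y. y \<in> ball p r \<Longrightarrow> b y = 1"
    "\<And>y. y \<notin> cball p (2 * r) \<Longrightarrow> b y = 0"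
proof -
  define u where "u y = 2 - inverse (r^2) * ((y - p) \<bullet> (y - p))" for y
  define a where "a t = flat 1 t" for t
  define b where "b y = a (u y) * inverse (a (u y) + a (1 - u y))" for y
  have sa: "smooth_on UNIV a" unfolding a_def by (rule smooth_on_flat)
  have sm: "smooth_on UNIV (\<lambda>y. y - p)"
    using smooth_on_add[OF open_UNIV smooth_on_ident smooth_on_const[of _ "- p"]] by simp
  have si: "smooth_on UNIV (\<lambda>y. (y - p) \<bullet> i)" for i by (rule smooth_on_inner_right[OF open_UNIV sm])
  have "smooth_on UNIV (\<lambda>y. \<Sum>i\<in>Basis. ((y - p) \<bullet> i) * ((y - p) \<bullet> i))"
    by (intro smooth_on_sum smooth_on_mult open_UNIV finite_Basis si)
  then have s2: "smooth_on UNIV (\<lambda>y. (y - p) \<bullet> (y - p))"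
    by (subst euclidean_inner)
  have s3: "smooth_on UNIV (\<lambda>y. 2 + (- inverse (r^2)) * ((y - p) \<bullet> (y - p)))"
    by (intro smooth_on_add smooth_on_mult smooth_on_const s2 open_UNIV)
  then have su: "smooth_on UNIV u" by (simp add: u_def[abs_def])
  have "smooth_on UNIV (\<lambda>y. 1 + (- 1) * u y)"
    by (intro smooth_on_add smooth_on_mult smooth_on_const su open_UNIV)
  then have su1: "smooth_on UNIV (\<lambda>y. 1 - u y)" by simp
  have s4: "smooth_on UNIV (\<lambda>y. a (u y))" "smooth_on UNIV (\<lambda>y. a (1 - u y))"
    using smooth_on_compose[where g = a, OF open_UNIV open_UNIV _ su sa]
      smooth_on_compose[where g = a, OF open_UNIV open_UNIV _ su1 sa] by auto
  have pos: "a t \<ge> 0" "t > 0 \<Longrightarrow> a t > 0" "t \<le> 0 \<Longrightarrow> a t = 0" for t by (auto simp: a_def flat_def)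
  have nz: "a (u y) + a (1 - u y) \<noteq> 0" for y
  proof (cases "u y > 0")
    case True then show ?thesis using pos(1)[of "1 - u y"] pos(2)[OF True] by linarith
  next
    case False then show ?thesis using pos(1)[of "u y"] pos(2)[of "1 - u y"] by auto
  qed
  have "smooth_on UNIV b" unfolding b_def[abs_def]
    by (intro smooth_on_mult smooth_on_inverse smooth_on_add s4 open_UNIV nz)
  moreover have "b y = 1" if "y \<in> ball p r" for y
  proof -
    have "(norm (y - p))\<^sup>2 \<le> r\<^sup>2" using that assms by (intro power_mono) (auto simp: dist_norm norm_minus_commute)
    then have "u y \<ge> 1" using assms unfolding u_def by (simp add: power2_norm_eq_inner[symmetric] field_simps)
    then show ?thesis using nz[of y] pos(3)[of "1 - u y"] by (simp add: b_def)
  qed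
  moreover have "b y = 0" if "y \<notin> cball p (2 * r)" for y
  proof -
    have "(2 * r)\<^sup>2 \<le> (norm (y - p))\<^sup>2" using that assms by (intro power_mono) (auto simp: dist_norm norm_minus_commute)
    moreover have "2 * r\<^sup>2 \<le> (2 * r)\<^sup>2" by (simp add: power_mult_distrib)
    ultimately have "2 * r\<^sup>2 \<le> (norm (y - p))\<^sup>2" by linarith
    then have "u y \<le> 0" using assms unfolding u_def by (simp add: power2_norm_eq_inner[symmetric] field_simps)
    then show ?thesis using pos(3) by (simp add: b_def)
  qed
  ultimately show thesis using that by blast
qed

text \<open>Differentiation under the integral sign turns \<open>\<integral> t\<^sup>m F(q + t(y - q)) dt\<close> into an integral of the same
  form, with \<open>m + 1\<close> for \<open>m\<close> and a derivative of \<open>F\<close> for \<open>F\<close>.\<close>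

lemma smooth_on_integral_segment:
  fixes F :: "'e::euclidean_space \<Rightarrow> real"
  assumes B: "open B" "convex B" "q \<in> B" and "smooth_on B F"
  shows "smooth_on B (\<lambda>y. integral {0..1} (\<lambda>t. F (q + t *\<^sub>R (y - q))))"
proof -
  have seg: "q + t *\<^sub>R (y - q) \<in> B" if "y \<in> B" "t \<in> {0..1}" for y t
  proof -
    have "(1 - t) *\<^sub>R q + t *\<^sub>R y \<in> B" using B that by (intro convexD) auto
    then show ?thesis by (simp add: algebra_simps)
  qed
  define P where "P h \<longleftrightarrow> (\<exists>m F. smooth_on B F \<and> h = (\<lambda>y. integral {0..1} (\<lambda>t. t ^ m * F (q + t *\<^sub>R (y - q)))))"
    for h :: "'e \<Rightarrow> real"
  have step: "((\<lambda>y. integral {0..1} (\<lambda>t. t ^ m * F (q + t *\<^sub>R (y - q)))) has_derivative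
      (\<lambda>v. integral {0..1} (\<lambda>t. t ^ Suc m * frechet_derivative F (at (q + t *\<^sub>R (y - q))) v))) (at y)"
    if F: "smooth_on B F" and y: "y \<in> B" for F :: "'e \<Rightarrow> real" and m y
  proof -
    let ?fx = "\<lambda>y t. t ^ Suc m *\<^sub>R Blinfun (frechet_derivative F (at (q + t *\<^sub>R (y - q))))"
    have app: "blinfun_apply (?fx y t) v = t ^ Suc m * frechet_derivative F (at (q + t *\<^sub>R (y - q))) v"
      if "y \<in> B" "t \<in> {0..1}" for y t v
      using smooth_on_has_derivative[OF F seg[OF that]]
      by (simp add: blinfun.scaleR_left bounded_linear_Blinfun_apply has_derivative_bounded_linear)
    have cont: "continuous_on (B \<times> cbox 0 1) (\<lambda>(y, t). ?fx y t)"
      unfolding case_prod_unfold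
      by (intro continuous_intros continuous_on_compose2[OF continuous_on_Blinfun_frechet_derivative[OF F]])
        (use seg in auto)
    have d: "((\<lambda>y. t ^ m * F (q + t *\<^sub>R (y - q))) has_derivative blinfun_apply (?fx y t)) (at y within B)"
      if yt: "y \<in> B" "t \<in> cbox 0 1" for y t
    proof -
      have t: "t \<in> {0..1}" using yt by simp
      have 1: "((\<lambda>y. q + t *\<^sub>R (y - q)) has_derivative (\<lambda>v. t *\<^sub>R v)) (at y)"
        by (auto intro!: derivative_eq_intros)
      have "((\<lambda>y. t ^ m * F (q + t *\<^sub>R (y - q))) has_derivative
          (\<lambda>v. t ^ m * frechet_derivative F (at (q + t *\<^sub>R (y - q))) (t *\<^sub>R v))) (at y)"
        by (intro has_derivative_mult_right has_derivative_compose[OF 1 smooth_on_has_derivative[OF F seg[OF yt(1) t]]])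
      also have "(\<lambda>v. t ^ m * frechet_derivative F (at (q + t *\<^sub>R (y - q))) (t *\<^sub>R v)) = blinfun_apply (?fx y t)"
        using has_derivative_linear[OF smooth_on_has_derivative[OF F seg[OF yt(1) t]]]
        by (simp only: fun_eq_iff app[OF yt(1) t] linear_cmul real_scaleR_def) simp
      finally show ?thesis by (rule has_derivative_at_withinI)
    qed
    have int1: "(\<lambda>t. t ^ m * F (q + t *\<^sub>R (y - q))) integrable_on cbox 0 1" if "y \<in> B" for y
      by (intro integrable_continuous continuous_intros continuous_on_compose2[OF smooth_on_imp_continuous_on[OF F]])
        (use seg that in auto)
    have int2: "?fx y integrable_on cbox 0 1"
      by (intro integrable_continuous continuous_intros continuous_on_compose2[OF continuous_on_Blinfun_frechet_derivative[OF F]])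
        (use seg y in auto)
    have "((\<lambda>y. integral (cbox 0 1) (\<lambda>t. t ^ m * F (q + t *\<^sub>R (y - q)))) has_derivative
        blinfun_apply (integral (cbox 0 1) (?fx y))) (at y within B)"
      by (rule leibniz_rule[OF d int1 cont y B(2)])
    moreover have "blinfun_apply (integral (cbox 0 1) (?fx y)) =
       (\<lambda>v. integral {0..1} (\<lambda>t. t ^ Suc m * frechet_derivative F (at (q + t *\<^sub>R (y - q))) v))"
    proof
      fix v
      have "blinfun_apply (integral (cbox 0 1) (?fx y)) v = integral (cbox 0 1) (\<lambda>t. blinfun_apply (?fx y t) v)"
        by (rule blinfun_apply_integral[OF int2])
      also have "\<dots> = integral (cbox 0 1) (\<lambda>t. t ^ Suc m * frechet_derivative F (at (q + t *\<^sub>R (y - q))) v)"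
        by (rule integral_cong) (simp only: box_real app[OF y])
      finally show "blinfun_apply (integral (cbox 0 1) (?fx y)) v =
          integral {0..1} (\<lambda>t. t ^ Suc m * frechet_derivative F (at (q + t *\<^sub>R (y - q))) v)" by simp
    qed
    ultimately show ?thesis using at_within_open[OF y B(1)] by simp
  qed
  show ?thesis
  proof (rule smooth_on_coinduct[where P = P])
    show "P (\<lambda>y. integral {0..1} (\<lambda>t. F (q + t *\<^sub>R (y - q))))"
      unfolding P_def using assms(4) by (intro exI[of _ 0] exI[of _ F]) simp
  next
    fix h assume "P h"
    then obtain m F where F: "smooth_on B F" and h: "h = (\<lambda>y. integral {0..1} (\<lambda>t. t ^ m * F (q + t *\<^sub>R (y - q))))"
      unfolding P_def by blast
    let ?F = "\<lambda>y v. integral {0..1} (\<lambda>t. t ^ Suc m * frechet_derivative F (at (q + t *\<^sub>R (y - q))) v)"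
    have "P (\<lambda>y. ?F y v)" for v
      unfolding P_def
      by (intro exI[of _ "Suc m"] exI[of _ "\<lambda>y. frechet_derivative F (at y) v"] conjI
          smooth_on_frechet_derivative[OF F] refl)
    then show "\<exists>F. (\<forall>x\<in>B. (h has_derivative F x) (at x)) \<and> (\<forall>v. P (\<lambda>x. F x v))"
      unfolding h using step[OF F, of _ m] by (intro exI[of _ ?F] conjI ballI allI)
    show "continuous_on B h" unfolding h
      using has_derivative_continuous[OF step[OF F, of _ m]] by (intro continuous_at_imp_continuous_on ballI)
  qed (use B in simp)
qed

text \<open>The fundamental theorem of calculus on the segment from \<open>q\<close> to \<open>y\<close>.\<close>

lemma Hadamard:
  fixes f :: "'e::euclidean_space \<Rightarrow> real"
  assumes B: "open B" "convex B" "q \<in> B" and f: "smooth_on B f"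
  obtains k where "\<And>i. smooth_on B (k i)" "\<And>i. k i q = frechet_derivative f (at q) i"
    "\<And>y. y \<in> B \<Longrightarrow> f y = f q + (\<Sum>i\<in>Basis. ((y - q) \<bullet> i) * k i y)"
proof
  let ?k = "\<lambda>i y. integral {0..1} (\<lambda>t. frechet_derivative f (at (q + t *\<^sub>R (y - q))) i)"
  show "smooth_on B (?k i)" for i
    by (rule smooth_on_integral_segment[OF B smooth_on_frechet_derivative[OF f]])
  show "?k i q = frechet_derivative f (at q) i" for i by simp
  fix y assume y: "y \<in> B"
  have seg: "q + t *\<^sub>R (y - q) \<in> B" if "t \<in> {0..1}" for t
  proof -
    have "(1 - t) *\<^sub>R q + t *\<^sub>R y \<in> B" using B y that by (intro convexD) auto
    then show ?thesis by (simp add: algebra_simps)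
  qed
  let ?D = "\<lambda>t. frechet_derivative f (at (q + t *\<^sub>R (y - q)))"
  have vd: "((\<lambda>t. f (q + t *\<^sub>R (y - q))) has_vector_derivative ?D t (y - q)) (at t within {0..1})" if t: "t \<in> {0..1}" for t
  proof -
    have 1: "((\<lambda>t. q + t *\<^sub>R (y - q)) has_derivative (\<lambda>s. s *\<^sub>R (y - q))) (at t)"
      by (auto intro!: derivative_eq_intros)
    have "((\<lambda>t. f (q + t *\<^sub>R (y - q))) has_derivative (\<lambda>s. ?D t (s *\<^sub>R (y - q)))) (at t)"
      by (rule has_derivative_compose[OF 1 smooth_on_has_derivative[OF f seg[OF t]]])
    then show ?thesis unfolding has_vector_derivative_def
      using has_derivative_linear[OF smooth_on_has_derivative[OF f seg[OF t]]]
      by (simp add: linear_cmul has_derivative_at_withinI)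
  qed
  have "((\<lambda>t. ?D t (y - q)) has_integral f (q + 1 *\<^sub>R (y - q)) - f (q + 0 *\<^sub>R (y - q))) {0..1}"
    by (rule fundamental_theorem_of_calculus[OF _ vd]) auto
  then have "f y - f q = integral {0..1} (\<lambda>t. ?D t (y - q))" by (simp add: integral_unique)
  also have "\<dots> = integral {0..1} (\<lambda>t. \<Sum>i\<in>Basis. ((y - q) \<bullet> i) * ?D t i)"
  proof (rule integral_cong)
    fix t :: real assume t: "t \<in> {0..1}"
    have lin: "linear (?D t)" using has_derivative_linear[OF smooth_on_has_derivative[OF f seg[OF t]]] .
    have "?D t (y - q) = ?D t (\<Sum>i\<in>Basis. ((y - q) \<bullet> i) *\<^sub>R i)" by (simp only: euclidean_representation)
    also have "\<dots> = (\<Sum>i\<in>Basis. ((y - q) \<bullet> i) * ?D t i)"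
      by (simp only: linear_sum[OF lin] linear_cmul[OF lin] real_scaleR_def)
    finally show "?D t (y - q) = \<dots>" .
  qed
  also have "\<dots> = (\<Sum>i\<in>Basis. integral {0..1} (\<lambda>t. ((y - q) \<bullet> i) * ?D t i))"
  proof (rule integral_sum)
    fix i :: 'e
    show "(\<lambda>t. ((y - q) \<bullet> i) * ?D t i) integrable_on {0..1}"
      by (intro integrable_continuous_interval continuous_on_mult continuous_on_const
          continuous_on_compose2[OF smooth_on_imp_continuous_on[OF smooth_on_frechet_derivative[OF f]]] continuous_intros)
        (use seg in auto)
  qed simp
  finally show "f y = f q + (\<Sum>i\<in>Basis. ((y - q) \<bullet> i) * ?k i y)" by simp
qed

section \<open>Smooth functions on a manifold\<close>

lemma smooth_funs_chart:
  "f \<in> smooth_funs M \<Longrightarrow> (U, c) \<in> atlas M \<Longrightarrow> smooth_on (c ` U) (f \<circ> inv_into U c)"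
  by (auto simp: smooth_funs_def)

lemma smooth_funs_chart':
  "f \<in> smooth_funs M \<Longrightarrow> (U, c) \<in> atlas M \<Longrightarrow> smooth_on (c ` U) (\<lambda>x. f (inv_into U c x))"
  using smooth_funs_chart[of f M U c] by (simp add: o_def)

lemma is_chart_image_open:
  assumes c: "is_chart T U c" and W: "openin T W"
  shows "open (c ` (U \<inter> W))"
proof -
  have U: "openin T U" using c by (simp add: is_chart_def)
  have "openin (top_of_set (c ` U)) (c ` (U \<inter> W))"
    using homeomorphic_map_openness[of "subtopology T U" "top_of_set (c ` U)" c "U \<inter> W"] c W openin_subset[OF U]
    by (auto simp: openin_subtopology is_chart_def)
  then show ?thesis using c openin_open_trans unfolding is_chart_def by blast
qed

lemma is_chart_vimage_open:
  assumes c: "is_chart T U c" and S: "open S"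
  shows "openin T {q \<in> U. c q \<in> S}"
proof -
  have U: "openin T U" using c by (simp add: is_chart_def)
  have "continuous_map (subtopology T U) (top_of_set (c ` U)) c"
    using c by (simp add: homeomorphic_eq_everything_map is_chart_def)
  moreover have "openin (top_of_set (c ` U)) (S \<inter> c ` U)" using S openin_open by blast
  ultimately have "openin (subtopology T U) {x \<in> topspace (subtopology T U). c x \<in> S \<inter> c ` U}"
    by (rule openin_continuous_map_preimage)
  moreover have "{x \<in> topspace (subtopology T U). c x \<in> S \<inter> c ` U} = {q \<in> U. c q \<in> S}"
    using openin_subset[OF U] by auto
  ultimately show ?thesis using U openin_trans_full by fastforce
qed

lemma is_chart_inj: assumes c: "is_chart T U c" shows "inj_on c U"
proof -
  have "inj_on c (topspace (subtopology T U))"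
    using c by (simp add: homeomorphic_eq_everything_map is_chart_def)
  moreover have "U \<subseteq> topspace T" using c openin_subset by (auto simp: is_chart_def)
  ultimately show ?thesis by (simp add: Int_absorb1)
qed

locale smooth_mfd =
  fixes M :: "('a, 'e::euclidean_space) manifold"
  assumes smooth_manifold: "smooth_manifold M"
begin

abbreviation "CF \<equiv> smooth_funs M"
abbreviation "TS \<equiv> tangent_space M"
abbreviation "VF \<equiv> vector_fields M"

lemma is_chart: "(U, c) \<in> atlas M \<Longrightarrow> is_chart (mfd_top M) U c"
  using smooth_manifold by (auto simp: smooth_manifold_def)

lemma chart_open: "(U, c) \<in> atlas M \<Longrightarrow> open (c ` U)"
  and chart_openin: "(U, c) \<in> atlas M \<Longrightarrow> openin (mfd_top M) U"
  and chart_homeo: "(U, c) \<in> atlas M \<Longrightarrow> homeomorphic_map (subtopology (mfd_top M) U) (top_of_set (c ` U)) c"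
  using is_chart by (auto simp: is_chart_def)

lemma chart_subset: "(U, c) \<in> atlas M \<Longrightarrow> U \<subseteq> points M"
  using chart_openin openin_subset unfolding points_def by blast

lemma chart_inj: "(U, c) \<in> atlas M \<Longrightarrow> inj_on c U"
  using is_chart_inj[OF is_chart] .

lemma inv_chart: "(U, c) \<in> atlas M \<Longrightarrow> p \<in> U \<Longrightarrow> inv_into U c (c p) = p"
  using chart_inj by (simp add: inv_into_f_f)

lemma chart_exists: assumes "p \<in> points M" obtains U c where "(U, c) \<in> atlas M" "p \<in> U"
proof -
  have "p \<in> (\<Union>(U, c)\<in>atlas M. U)" using assms smooth_manifold by (simp add: smooth_manifold_def)
  then obtain X where X: "X \<in> atlas M" "p \<in> (case X of (U, c) \<Rightarrow> U)" by (rule UN_E)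
  obtain U c where "X = (U, c)" by (cases X)
  with X show thesis using that[of U c] by simp
qed

lemma transition: "(U, c) \<in> atlas M \<Longrightarrow> (V, d) \<in> atlas M \<Longrightarrow> smooth_on (c ` (U \<inter> V)) (d \<circ> inv_into U c)"
proof -
  have "\<forall>X\<in>atlas M. \<forall>Y\<in>atlas M. smooth_on (snd X ` (fst X \<inter> fst Y)) (snd Y \<circ> inv_into (fst X) (snd X))"
    using smooth_manifold by (simp add: smooth_manifold_def split_beta)
  moreover assume "(U, c) \<in> atlas M" "(V, d) \<in> atlas M"
  ultimately show ?thesis by fastforce
qed

lemma chart_image_open: "(U, c) \<in> atlas M \<Longrightarrow> openin (mfd_top M) W \<Longrightarrow> open (c ` (U \<inter> W))"
  using is_chart_image_open[OF is_chart] .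

lemma chart_vimage_open: "(U, c) \<in> atlas M \<Longrightarrow> open S \<Longrightarrow> openin (mfd_top M) {q \<in> U. c q \<in> S}"
  using is_chart_vimage_open[OF is_chart] .

lemma chart_compact_closed:
  assumes "(U, c) \<in> atlas M" "compact K" "K \<subseteq> c ` U"
  shows "closedin (mfd_top M) {q \<in> U. c q \<in> K}"
proof -
  obtain d where d: "homeomorphic_maps (subtopology (mfd_top M) U) (top_of_set (c ` U)) c d"
    using chart_homeo[OF assms(1)] homeomorphic_map_maps by blast
  have dK: "d ` K = {q \<in> U. c q \<in> K}"
  proof -
    have sub: "topspace (subtopology (mfd_top M) U) = U"
      using chart_subset[OF assms(1)] by (auto simp: points_def)
    have 1: "d (c q) = q" if "q \<in> U" for q using d that sub by (auto simp: homeomorphic_maps_def)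
    have 2: "d y \<in> U" "c (d y) = y" if "y \<in> c ` U" for y using that 1 by auto
    show ?thesis using 1 2 assms(3) by force
  qed
  have "compactin (top_of_set (c ` U)) K" using assms(2,3) by (simp add: compactin_subtopology)
  then have "compactin (subtopology (mfd_top M) U) (d ` K)"
    using d image_compactin unfolding homeomorphic_maps_def by blast
  then have "compactin (mfd_top M) (d ` K)" by (simp add: compactin_subtopology)
  moreover have "Hausdorff_space (mfd_top M)" using smooth_manifold by (simp add: smooth_manifold_def)
  ultimately show ?thesis using compactin_imp_closedin dK by metis
qed

lemma smooth_funsI:
  assumes "\<And>U c. (U, c) \<in> atlas M \<Longrightarrow> smooth_on (c ` U) (\<lambda>x. f (inv_into U c x))"
  shows "f \<in> CF"
  using assms by (auto simp: smooth_funs_def o_def)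

text \<open>Membership in the algebra of smooth functions ignores values outside the manifold.\<close>

lemma CF_points_cong:
  assumes f: "f \<in> CF" and eq: "\<And>p. p \<in> points M \<Longrightarrow> f p = h p"
  shows "h \<in> CF"
proof (rule smooth_funsI)
  fix U c assume c: "(U, c) \<in> atlas M"
  show "smooth_on (c ` U) (\<lambda>x. h (inv_into U c x))"
    by (rule smooth_on_cong[OF chart_open[OF c] _ smooth_funs_chart'[OF f c]])
      (use chart_subset[OF c] eq in \<open>auto simp: inv_chart[OF c]\<close>)
qed

lemma CF_const: "(\<lambda>_. a) \<in> CF" by (intro smooth_funsI smooth_on_const)

lemma CF_add: "f \<in> CF \<Longrightarrow> h \<in> CF \<Longrightarrow> (\<lambda>p. f p + h p) \<in> CF"
  by (rule smooth_funsI) (rule smooth_on_add[OF chart_open smooth_funs_chart' smooth_funs_chart'])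

lemma CF_mult: "f \<in> CF \<Longrightarrow> h \<in> CF \<Longrightarrow> (\<lambda>p. f p * h p) \<in> CF"
  by (rule smooth_funsI) (rule smooth_on_mult[OF chart_open smooth_funs_chart' smooth_funs_chart'])

lemma CF_uminus: "f \<in> CF \<Longrightarrow> (\<lambda>p. - f p) \<in> CF"
  using CF_mult[OF CF_const[of "-1"]] by simp

lemma CF_diff: "f \<in> CF \<Longrightarrow> h \<in> CF \<Longrightarrow> (\<lambda>p. f p - h p) \<in> CF"
  using CF_add[OF _ CF_uminus] by simp

lemma CF_sum: "(\<And>i. i \<in> I \<Longrightarrow> f i \<in> CF) \<Longrightarrow> (\<lambda>p. \<Sum>i\<in>I. f i p) \<in> CF"
  by (induct I rule: infinite_finite_induct) (auto intro: CF_const CF_add)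

lemma CF_prod: "(\<And>i. i \<in> I \<Longrightarrow> f i \<in> CF) \<Longrightarrow> (\<lambda>p. \<Prod>i\<in>I. f i p) \<in> CF"
  by (induct I rule: infinite_finite_induct) (auto intro: CF_const CF_mult)

lemmas CF_intros = CF_const CF_add CF_mult CF_uminus CF_diff CF_sum CF_prod

text \<open>Smoothness is local, in the following purely algebraic form.\<close>

lemma CF_local:
  assumes "\<And>p. p \<in> points M \<Longrightarrow> \<exists>b\<in>CF. b p \<noteq> 0 \<and> (\<lambda>q. b q * f q) \<in> CF"
  shows "f \<in> CF"
proof (rule smooth_funsI)
  fix U c assume c: "(U, c) \<in> atlas M"
  note op = chart_open[OF c]
  show "smooth_on (c ` U) (\<lambda>x. f (inv_into U c x))"
  proof (rule smooth_on_local[OF op])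
    fix x assume x: "x \<in> c ` U"
    then have "inv_into U c x \<in> points M" using chart_subset[OF c] inv_into_into[OF x] by blast
    then obtain b where b: "b \<in> CF" "b (inv_into U c x) \<noteq> 0" "(\<lambda>q. b q * f q) \<in> CF"
      using assms by blast
    note sb = smooth_funs_chart'[OF b(1) c]
    define W where "W = {y \<in> c ` U. b (inv_into U c y) \<in> - {0}}"
    have W: "open W" unfolding W_def
      using continuous_open_preimage[OF smooth_on_imp_continuous_on[OF sb] op, of "- {0}"]
      by (simp add: vimage_def Int_def open_Compl)
    have "smooth_on W (\<lambda>y. inverse (b (inv_into U c y)) * (b (inv_into U c y) * f (inv_into U c y)))"
      by (rule smooth_on_mult[OF W smooth_on_inverse[OF W _ smooth_on_subset[OF sb]]
            smooth_on_subset[OF smooth_funs_chart'[OF b(3) c]]]) (auto simp: W_def)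
    then have "smooth_on W (\<lambda>y. f (inv_into U c y))"
      by (rule smooth_on_cong[OF W, rotated]) (simp add: W_def)
    moreover have "x \<in> W" using b x by (simp add: W_def)
    ultimately show "\<exists>V. open V \<and> x \<in> V \<and> smooth_on (c ` U \<inter> V) (\<lambda>x. f (inv_into U c x))"
      using W smooth_on_subset[OF _ Int_lower2] by blast
  qed
qed

text \<open>A function given in a chart and supported in a compact part of it extends by zero. This is where
  the Hausdorff property enters.\<close>

lemma CF_extend_zero:
  assumes c: "(U, c) \<in> atlas M" and S: "open S" "S \<subseteq> c ` U" and K: "compact K" "K \<subseteq> S"
    and h: "smooth_on S h" "\<And>y. y \<in> S - K \<Longrightarrow> h y = 0"
  shows "(\<lambda>q. if q \<in> U \<and> c q \<in> S then h (c q) else 0) \<in> CF" (is "?f \<in> CF")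
proof (rule smooth_funsI)
  fix V d assume d: "(V, d) \<in> atlas M"
  show "smooth_on (d ` V) (\<lambda>x. ?f (inv_into V d x))"
  proof (rule smooth_on_local[OF chart_open[OF d]])
    fix x assume "x \<in> d ` V"
    then obtain q where q: "q \<in> V" "x = d q" by auto
    show "\<exists>W. open W \<and> x \<in> W \<and> smooth_on (d ` V \<inter> W) (\<lambda>x. ?f (inv_into V d x))"
    proof (cases "q \<in> U \<and> c q \<in> S")
      case True
      let ?W = "d ` (V \<inter> {q \<in> U. c q \<in> S})"
      have oW: "open ?W" by (rule chart_image_open[OF d chart_vimage_open[OF c S(1)]])
      have tr: "smooth_on ?W (\<lambda>x. c (inv_into V d x))"
        using smooth_on_subset[OF transition[OF d c], of ?W] by (auto simp: o_def)
      have im: "(\<lambda>x. c (inv_into V d x)) ` ?W \<subseteq> S" using inv_chart[OF d] by auto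
      have "smooth_on ?W (\<lambda>x. h (c (inv_into V d x)))"
        by (rule smooth_on_compose[where g = h, OF oW S(1) im tr h(1)])
      then have "smooth_on ?W (\<lambda>x. ?f (inv_into V d x))"
        by (rule smooth_on_cong[OF oW, rotated]) (auto simp: inv_chart[OF d])
      moreover have "x \<in> ?W" using True q by auto
      ultimately show ?thesis using oW smooth_on_subset[OF _ Int_lower2] by blast
    next
      case False
      let ?C = "{q \<in> U. c q \<in> K}"
      let ?W = "d ` (V \<inter> (points M - ?C))"
      have "openin (mfd_top M) (points M - ?C)"
        using chart_compact_closed[OF c K(1)] K(2) S(2) by (auto simp: points_def)
      then have oW: "open ?W" by (rule chart_image_open[OF d])
      have "smooth_on ?W (\<lambda>x. ?f (inv_into V d x))"
      proof (rule smooth_on_cong[OF oW _ smooth_on_const[of _ 0]])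
        fix y assume "y \<in> ?W"
        then obtain r where r: "r \<in> V" "r \<notin> ?C" "y = d r" by blast
        then show "0 = ?f (inv_into V d y)"
          using h(2)[of "c r"] by (auto simp: inv_chart[OF d])
      qed
      moreover have "q \<in> V \<inter> (points M - ?C)" using False q K(2) chart_subset[OF d] by auto
      then have "x \<in> ?W" using q by blast
      ultimately show ?thesis using oW smooth_on_subset[OF _ Int_lower2] by blast
    qed
  qed
qed

section \<open>Tangent vectors and coordinates\<close>

lemma TS_D:
  assumes "v \<in> TS p"
  shows "\<And>f h. f \<in> CF \<Longrightarrow> h \<in> CF \<Longrightarrow> v (\<lambda>q. f q + h q) = v f + v h"
    "\<And>f a. f \<in> CF \<Longrightarrow> v (\<lambda>q. a * f q) = a * v f"
    "\<And>f h. f \<in> CF \<Longrightarrow> h \<in> CF \<Longrightarrow> v (\<lambda>q. f q * h q) = v f * h p + f p * v h"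
    "\<And>f. f \<notin> CF \<Longrightarrow> v f = 0"
  using assms by (auto simp: tangent_space_def plus_fun_def times_fun_def scaleR_fun_def)

lemma TS_I:
  assumes "\<And>f h. f \<in> CF \<Longrightarrow> h \<in> CF \<Longrightarrow> v (\<lambda>q. f q + h q) = v f + v h"
    "\<And>f a. f \<in> CF \<Longrightarrow> v (\<lambda>q. a * f q) = a * v f"
    "\<And>f h. f \<in> CF \<Longrightarrow> h \<in> CF \<Longrightarrow> v (\<lambda>q. f q * h q) = v f * h p + f p * v h"
    "\<And>f. f \<notin> CF \<Longrightarrow> v f = 0"
  shows "v \<in> TS p"
  using assms by (auto simp: tangent_space_def plus_fun_def times_fun_def scaleR_fun_def)

lemma TS_const: assumes "v \<in> TS p" shows "v (\<lambda>q. a) = 0"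
proof -
  have "v (\<lambda>q. 1 * 1) = v (\<lambda>q. 1) * 1 + 1 * v (\<lambda>q. 1)" by (rule TS_D(3)[OF assms CF_const CF_const])
  then have "v (\<lambda>q. 1) = 0" by simp
  then show ?thesis using TS_D(2)[OF assms CF_const, of a 1] by simp
qed

lemma TS_diff: "v \<in> TS p \<Longrightarrow> f \<in> CF \<Longrightarrow> h \<in> CF \<Longrightarrow> v (\<lambda>q. f q - h q) = v f - v h"
  using TS_D(1)[of v p f "\<lambda>q. (-1) * h q"] TS_D(2)[of v p h "-1"] CF_uminus by simp

lemma TS_sum:
  assumes "v \<in> TS p" "\<And>i. i \<in> I \<Longrightarrow> f i \<in> CF"
  shows "v (\<lambda>q. \<Sum>i\<in>I. f i q) = (\<Sum>i\<in>I. v (f i))"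
  using assms(2)
proof (induct I rule: infinite_finite_induct)
  case (insert i I)
  then show ?case using TS_D(1)[OF assms(1), of "f i" "\<lambda>q. \<Sum>i\<in>I. f i q"] by (simp add: CF_sum)
qed (use TS_const[OF assms(1)] in simp_all)

lemma subspace_TS: "subspace (TS p)"
  unfolding subspace_def
proof (intro conjI ballI allI)
  show "0 \<in> TS p" by (rule TS_I) simp_all
  fix u v a assume *: "u \<in> TS p" "v \<in> TS p"
  show "u + v \<in> TS p" by (rule TS_I) (simp_all add: TS_D[OF *(1)] TS_D[OF *(2)] algebra_simps)
next
  fix u and a :: real assume *: "u \<in> TS p"
  show "a *\<^sub>R u \<in> TS p" by (rule TS_I) (simp_all add: TS_D[OF *(1)] algebra_simps)
qed

lemmas TS_0 = subspace_0[OF subspace_TS]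
  and TS_add = subspace_add[OF subspace_TS]
  and TS_minus = subspace_diff[OF subspace_TS]
  and TS_scale = subspace_scale[OF subspace_TS]
  and TS_neg = subspace_neg[OF subspace_TS]
  and TS_vsum = subspace_sum[OF subspace_TS]

text \<open>The coordinate vector at \<open>p\<close> in the direction \<open>w\<close>: the derivative in this direction of the coordinate
  expression of a function.\<close>

definition chart_vec :: "'a set \<Rightarrow> ('a \<Rightarrow> 'e) \<Rightarrow> 'a \<Rightarrow> 'e \<Rightarrow> 'a tvec" where
  "chart_vec U c p w = (\<lambda>f. if f \<in> CF then frechet_derivative (\<lambda>x. f (inv_into U c x)) (at (c p)) w else 0)"

lemma chart_fun_derivative:
  assumes "(U, c) \<in> atlas M" "p \<in> U" "f \<in> CF"
  shows "((\<lambda>x. f (inv_into U c x)) has_derivative (\<lambda>w. chart_vec U c p w f)) (at (c p))"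
  using smooth_on_has_derivative[OF smooth_funs_chart'[OF assms(3,1)], of "c p"] assms
  by (simp add: chart_vec_def)

lemma chart_vec_eqI:
  assumes "((\<lambda>x. f (inv_into U c x)) has_derivative F) (at (c p))" "f \<in> CF"
  shows "chart_vec U c p w f = F w"
  using frechet_derivative_at[OF assms(1)] assms(2) by (simp add: chart_vec_def)

lemma chart_vec_TS: assumes c: "(U, c) \<in> atlas M" "p \<in> U" shows "chart_vec U c p w \<in> TS p"
proof (rule TS_I)
  note d = chart_fun_derivative[OF c]
  fix f h assume f: "f \<in> CF" and h: "h \<in> CF"
  show "chart_vec U c p w (\<lambda>q. f q + h q) = chart_vec U c p w f + chart_vec U c p w h"
    by (rule chart_vec_eqI[OF has_derivative_add[OF d[OF f] d[OF h]] CF_add[OF f h]])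
  show "chart_vec U c p w (\<lambda>q. f q * h q) = chart_vec U c p w f * h p + f p * chart_vec U c p w h"
    using chart_vec_eqI[OF has_derivative_mult[OF d[OF f] d[OF h]] CF_mult[OF f h], of w]
    by (simp add: inv_chart[OF c] algebra_simps)
next
  note d = chart_fun_derivative[OF c]
  fix f a assume f: "f \<in> CF"
  show "chart_vec U c p w (\<lambda>q. a * f q) = a * chart_vec U c p w f"
    by (rule chart_vec_eqI[OF has_derivative_mult_right[OF d[OF f]] CF_mult[OF CF_const f]])
qed (simp add: chart_vec_def)

lemma linear_chart_vec: assumes c: "(U, c) \<in> atlas M" "p \<in> U" shows "linear (chart_vec U c p)"
proof (rule linearI)
  note d = has_derivative_linear[OF chart_fun_derivative[OF c]]
  fix u v and a :: real
  show "chart_vec U c p (u + v) = chart_vec U c p u + chart_vec U c p v"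
  proof
    fix f show "chart_vec U c p (u + v) f = (chart_vec U c p u + chart_vec U c p v) f"
      using linear_add[OF d, of f u v] by (cases "f \<in> CF") (simp_all add: chart_vec_def)
  qed
  show "chart_vec U c p (a *\<^sub>R u) = a *\<^sub>R chart_vec U c p u"
  proof
    fix f show "chart_vec U c p (a *\<^sub>R u) f = (a *\<^sub>R chart_vec U c p u) f"
      using linear_cmul[OF d, of f a u] by (cases "f \<in> CF") (simp_all add: chart_vec_def)
  qed
qed

lemma fun_sum_apply: "(\<Sum>i\<in>I. F i) f = (\<Sum>i\<in>I. F i f)"
  for F :: "'i \<Rightarrow> 'b \<Rightarrow> real"
  by (induct I rule: infinite_finite_induct) auto

text \<open>Cut-off coordinate functions: by the Hadamard lemma, a derivation is determined by its values on
  the coordinates.\<close>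

lemma cutoff_coordinates:
  assumes c: "(U, c) \<in> atlas M" and p: "p \<in> U"
  obtains b x where "b \<in> CF" "b p = 1" "\<And>i. x i \<in> CF"
    "\<And>q. b q \<noteq> 0 \<Longrightarrow> q \<in> U"
    "\<And>q w i. b q \<noteq> 0 \<Longrightarrow> chart_vec U c q w (x i) = w \<bullet> i"
    "\<And>q v. b q \<noteq> 0 \<Longrightarrow> v \<in> TS q \<Longrightarrow> v = chart_vec U c q (\<Sum>i\<in>Basis. v (x i) *\<^sub>R i)"
    "\<And>f w. f \<in> CF \<Longrightarrow> (\<lambda>q. b q * chart_vec U c q w f) \<in> CF"
proof -
  have "c p \<in> c ` U" using p by simp
  then obtain R' where R': "R' > 0" "cball (c p) R' \<subseteq> c ` U"
    using chart_open[OF c] open_contains_cball by blast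
  \<comment> \<open>Nested balls: the factor \<open>\<beta>\<close> of the coordinates is \<open>1\<close> on the ball of radius \<open>2R\<close>, which contains
    the support of \<open>b\<close>; hence the \<open>x i\<close> agree with the coordinates near every point where \<open>b\<close> is not \<open>0\<close>.\<close>
  define R where "R = R' / 4"
  have R: "R > 0" "cball (c p) (4 * R) \<subseteq> c ` U" using R' by (auto simp: R_def)
  let ?B = "ball (c p) (2 * R)"
  have BU: "?B \<subseteq> c ` U" using R(2) R(1) ball_subset_cball[of "c p" "2 * R"] subset_cball[of "2 * R" "4 * R" "c p"] by auto
  obtain \<beta> where \<beta>: "smooth_on UNIV \<beta>" "\<And>y. y \<in> ?B \<Longrightarrow> \<beta> y = 1"
    "\<And>y. y \<notin> cball (c p) (4 * R) \<Longrightarrow> \<beta> y = (0::real)"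
    using smooth_plateau_exists[of "2 * R" "c p"] R(1) by (auto simp: mult.assoc)
  obtain \<chi>' where chi: "smooth_on UNIV \<chi>'" "\<And>y. y \<in> ball (c p) (R/2) \<Longrightarrow> \<chi>' y = 1"
    "\<And>y. y \<notin> cball (c p) R \<Longrightarrow> \<chi>' y = (0::real)"
    using smooth_plateau_exists[of "R / 2" "c p"] R(1) by auto
  define x where "x i = (\<lambda>q. if q \<in> U \<and> c q \<in> c ` U then \<beta> (c q) * (c q \<bullet> i) else 0)" for i
  have x: "x i \<in> CF" for i
    unfolding x_def
    by (rule CF_extend_zero[OF c chart_open[OF c] subset_refl compact_cball R(2)])
      (auto intro!: smooth_on_mult smooth_on_inner_right smooth_on_ident chart_open[OF c]
        intro: smooth_on_subset[OF \<beta>(1)] simp: \<beta>(3))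
  have KB: "cball (c p) R \<subseteq> ?B" using R(1) by auto
  have ext: "(\<lambda>q. if q \<in> U \<and> c q \<in> ?B then \<chi>' (c q) * k (c q) else 0) \<in> CF" if k: "smooth_on ?B k" for k
    by (rule CF_extend_zero[OF c open_ball BU compact_cball KB])
      (auto intro!: smooth_on_mult k intro: smooth_on_subset[OF chi(1)] simp: chi(3))
  define b where "b = (\<lambda>q. if q \<in> U \<and> c q \<in> ?B then \<chi>' (c q) * 1 else 0)"
  have b: "b \<in> CF" unfolding b_def by (rule ext[OF smooth_on_const])
  have bp: "b p = 1" using p R(1) chi(2) by (simp add: b_def)
  have bU: "q \<in> U \<and> c q \<in> ?B" if "b q \<noteq> 0" for q using that unfolding b_def by (simp split: if_splits)
  have xB: "x i q = c q \<bullet> i" if "q \<in> U" "c q \<in> ?B" for q i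
    using that \<beta>(2) by (simp add: x_def)
  have cvx: "chart_vec U c q w (x i) = w \<bullet> i" if q: "b q \<noteq> 0" for q w i
  proof (rule chart_vec_eqI[OF _ x])
    have "((\<lambda>y. y \<bullet> i) has_derivative (\<lambda>w. w \<bullet> i)) (at (c q))"
      by (rule bounded_linear_imp_has_derivative[OF bounded_linear_inner_left])
    then show "((\<lambda>y. x i (inv_into U c y)) has_derivative (\<lambda>w. w \<bullet> i)) (at (c q))"
    proof (rule has_derivative_transform_within_open[OF _ open_ball conjunct2[OF bU[OF q]]])
      fix y assume y: "y \<in> ?B"
      then have "y \<in> c ` U" using BU by auto
      then have "inv_into U c y \<in> U" "c (inv_into U c y) = y" by (auto intro: inv_into_into f_inv_into_f)
      then show "y \<bullet> i = x i (inv_into U c y)" using xB y by simp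
    qed
  qed
  have main: "v f = (\<Sum>i\<in>Basis. v (x i) * chart_vec U c q i f)" if q: "b q \<noteq> 0" and v: "v \<in> TS q" and f: "f \<in> CF" for q v f
  proof -
    have qU: "q \<in> U" "c q \<in> ?B" using bU[OF q] by auto
    have sf: "smooth_on ?B (\<lambda>y. f (inv_into U c y))"
      by (rule smooth_on_subset[OF smooth_funs_chart'[OF f c] BU])
    obtain k where k: "\<And>i. smooth_on ?B (k i)"
      "\<And>i. k i (c q) = frechet_derivative (\<lambda>y. f (inv_into U c y)) (at (c q)) i"
      "\<And>y. y \<in> ?B \<Longrightarrow> f (inv_into U c y) = f (inv_into U c (c q)) + (\<Sum>i\<in>Basis. ((y - c q) \<bullet> i) * k i y)"
      using Hadamard[OF open_ball convex_ball qU(2) sf] by blast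
    define K where "K i = (\<lambda>q. if q \<in> U \<and> c q \<in> ?B then \<chi>' (c q) * k i (c q) else 0)" for i
    have K: "K i \<in> CF" for i unfolding K_def by (rule ext[OF k(1)])
    have Kq: "K i q = b q * chart_vec U c q i f" for i
      using qU k(2) f by (simp add: K_def b_def chart_vec_def)
    have id: "b r * b r * (f r - f q) = (\<Sum>i\<in>Basis. (b r * (x i r - x i q)) * K i r)" for r
    proof (cases "b r = 0")
      case False
      then have r: "r \<in> U" "c r \<in> ?B" using bU by auto
      have "f r - f q = (\<Sum>i\<in>Basis. ((c r - c q) \<bullet> i) * k i (c r))"
        using k(3)[OF r(2)] by (simp add: inv_chart[OF c] r qU)
      also have "b r * b r * \<dots> = (\<Sum>i\<in>Basis. (b r * (x i r - x i q)) * K i r)"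
        using r qU by (simp add: sum_distrib_left xB K_def b_def inner_diff_left mult_ac)
      finally show ?thesis by simp
    qed simp
    have "v (\<lambda>r. b r * b r * (f r - f q)) = b q * b q * v f"
      by (subst TS_D(3)[OF v]) (auto intro!: CF_intros b f simp: TS_diff[OF v] TS_const[OF v] f CF_const)
    moreover have "v (\<lambda>r. \<Sum>i\<in>Basis. (b r * (x i r - x i q)) * K i r) = (\<Sum>i\<in>Basis. b q * v (x i) * K i q)"
      by (subst TS_sum[OF v]) (auto intro!: CF_intros b x K sum.cong
          simp: TS_D(3)[OF v] TS_diff[OF v] TS_const[OF v] b x K CF_diff CF_const CF_mult)
    ultimately have "b q * b q * v f = (\<Sum>i\<in>Basis. b q * v (x i) * K i q)"
      unfolding id by simp
    also have "\<dots> = b q * b q * (\<Sum>i\<in>Basis. v (x i) * chart_vec U c q i f)"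
      by (simp add: Kq sum_distrib_left mult_ac)
    finally show ?thesis using q by simp
  qed
  have cv: "v = chart_vec U c q (\<Sum>i\<in>Basis. v (x i) *\<^sub>R i)" if q: "b q \<noteq> 0" and v: "v \<in> TS q" for q v
  proof
    fix f
    note lin = linear_chart_vec[OF c conjunct1[OF bU[OF q]]]
    show "v f = chart_vec U c q (\<Sum>i\<in>Basis. v (x i) *\<^sub>R i) f"
    proof (cases "f \<in> CF")
      case True
      then show ?thesis using main[OF q v True]
        by (simp add: linear_sum[OF lin] linear_cmul[OF lin] fun_sum_apply)
    next
      case False
      then show ?thesis using TS_D(4)[OF v] by (simp add: chart_vec_def)
    qed
  qed
  have sm: "(\<lambda>q. b q * chart_vec U c q w f) \<in> CF" if f: "f \<in> CF" for f w
  proof -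
    have "(\<lambda>q. if q \<in> U \<and> c q \<in> ?B then \<chi>' (c q) * frechet_derivative (\<lambda>y. f (inv_into U c y)) (at (c q)) w else 0) \<in> CF"
      by (rule ext) (rule smooth_on_subset[OF smooth_on_frechet_derivative[OF smooth_funs_chart'[OF f c]] BU])
    moreover have "(\<lambda>q. if q \<in> U \<and> c q \<in> ?B then \<chi>' (c q) * frechet_derivative (\<lambda>y. f (inv_into U c y)) (at (c q)) w else 0)
       = (\<lambda>q. b q * chart_vec U c q w f)"
      using f by (auto simp: b_def chart_vec_def)
    ultimately show ?thesis by simp
  qed
  show thesis by (rule that[OF b bp x conjunct1[OF bU] cvx cv sm])
qed

lemma chart_vec_inj: assumes c: "(U, c) \<in> atlas M" "p \<in> U" shows "inj (chart_vec U c p)"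
proof (rule injI)
  fix u w assume eq: "chart_vec U c p u = chart_vec U c p w"
  obtain b x where b: "b \<in> CF" "b p = 1" and x: "\<And>i. x i \<in> CF" and
    bU: "\<And>q. b q \<noteq> 0 \<Longrightarrow> q \<in> U" and
    cvx: "\<And>q w i. b q \<noteq> 0 \<Longrightarrow> chart_vec U c q w (x i) = w \<bullet> i" and
    cv: "\<And>q v. b q \<noteq> 0 \<Longrightarrow> v \<in> TS q \<Longrightarrow> v = chart_vec U c q (\<Sum>i\<in>Basis. v (x i) *\<^sub>R i)" and
    sm: "\<And>f w. f \<in> CF \<Longrightarrow> (\<lambda>q. b q * chart_vec U c q w f) \<in> CF"
    by (rule cutoff_coordinates[OF c]) blast
  have "u \<bullet> i = w \<bullet> i" for i using eq b(2) cvx[of p u i] cvx[of p w i] by (metis zero_neq_one)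
  then show "u = w" using euclidean_eqI by blast
qed

lemma TS_eq_chart_vec: assumes c: "(U, c) \<in> atlas M" "p \<in> U" shows "TS p = range (chart_vec U c p)"
proof -
  obtain b x where b: "b \<in> CF" "b p = 1" and x: "\<And>i. x i \<in> CF" and
    bU: "\<And>q. b q \<noteq> 0 \<Longrightarrow> q \<in> U" and
    cvx: "\<And>q w i. b q \<noteq> 0 \<Longrightarrow> chart_vec U c q w (x i) = w \<bullet> i" and
    cv: "\<And>q v. b q \<noteq> 0 \<Longrightarrow> v \<in> TS q \<Longrightarrow> v = chart_vec U c q (\<Sum>i\<in>Basis. v (x i) *\<^sub>R i)" and
    sm: "\<And>f w. f \<in> CF \<Longrightarrow> (\<lambda>q. b q * chart_vec U c q w f) \<in> CF"
    by (rule cutoff_coordinates[OF c]) blast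
  have "v \<in> range (chart_vec U c p)" if v: "v \<in> TS p" for v
    by (subst cv[OF _ v]) (simp_all add: b)
  then show ?thesis using chart_vec_TS[OF c] by auto
qed

section \<open>Vector fields\<close>

lemma VF_I:
  "(\<And>p. p \<in> points M \<Longrightarrow> X p \<in> TS p) \<Longrightarrow> (\<And>p. p \<notin> points M \<Longrightarrow> X p = 0) \<Longrightarrow>
    (\<And>f. f \<in> CF \<Longrightarrow> (\<lambda>p. X p f) \<in> CF) \<Longrightarrow> X \<in> VF"
  by (simp add: vector_fields_def)

lemma VF_D:
  assumes "X \<in> VF"
  shows VF_TS: "\<And>p. p \<in> points M \<Longrightarrow> X p \<in> TS p" and VF_outside: "\<And>p. p \<notin> points M \<Longrightarrow> X p = 0"
    and VF_CF: "\<And>f. f \<in> CF \<Longrightarrow> (\<lambda>p. X p f) \<in> CF"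
  using assms by (auto simp: vector_fields_def)

lemma VF_eqI: "X \<in> VF \<Longrightarrow> Y \<in> VF \<Longrightarrow> (\<And>p. p \<in> points M \<Longrightarrow> X p = Y p) \<Longrightarrow> X = Y"
  using VF_outside by (metis ext)

lemma VF_add: "X \<in> VF \<Longrightarrow> Y \<in> VF \<Longrightarrow> X + Y \<in> VF"
  by (rule VF_I) (auto simp: VF_D intro: TS_add CF_add)

lemma VF_scale: "f \<in> CF \<Longrightarrow> X \<in> VF \<Longrightarrow> f \<odot> X \<in> VF"
  by (rule VF_I) (auto simp: VF_D fun_scale_def intro: TS_scale CF_mult)

lemma VF_0: "0 \<in> VF"
  by (rule VF_I) (auto simp: TS_0 CF_const)

lemma fun_scale_const: "(\<lambda>_. a) \<odot> X = a *\<^sub>R X" by (auto simp: fun_scale_def)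

lemma VF_cscale: "X \<in> VF \<Longrightarrow> a *\<^sub>R X \<in> VF"
  using VF_scale[OF CF_const] by (simp add: fun_scale_const)

lemma VF_uminus: "X \<in> VF \<Longrightarrow> - X \<in> VF"
  using VF_cscale[of X "-1"] by simp

lemma VF_diff: "X \<in> VF \<Longrightarrow> Y \<in> VF \<Longrightarrow> X - Y \<in> VF"
  using VF_add[OF _ VF_uminus] by simp

lemma VF_sum: "(\<And>i. i \<in> I \<Longrightarrow> X i \<in> VF) \<Longrightarrow> (\<Sum>i\<in>I. X i) \<in> VF"
  by (induct I rule: infinite_finite_induct) (auto intro: VF_0 VF_add)

lemma VF_zero_fun: "X \<in> VF \<Longrightarrow> f \<notin> CF \<Longrightarrow> X p f = 0"
  using TS_D(4)[OF VF_TS] VF_outside by (metis zero_fun_apply)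

text \<open>Smoothness of a vector field may be checked after multiplication by a function that does not vanish at
  the point.\<close>

lemma VF_local:
  assumes "\<And>p. p \<in> points M \<Longrightarrow> X p \<in> TS p" "\<And>p. p \<notin> points M \<Longrightarrow> X p = 0"
    "\<And>p. p \<in> points M \<Longrightarrow> \<exists>b\<in>CF. b p \<noteq> 0 \<and> (\<forall>f\<in>CF. (\<lambda>q. b q * X q f) \<in> CF)"
  shows "X \<in> VF"
proof (rule VF_I[OF assms(1,2)])
  fix f assume "f \<in> CF"
  then show "(\<lambda>p. X p f) \<in> CF" using assms(3) by (intro CF_local) blast
qed

lemma VF_lie_bracket: assumes X: "X \<in> VF" and Y: "Y \<in> VF" shows "lie_bracket X Y \<in> VF"
proof (rule VF_I)
  fix p assume p: "p \<in> points M"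
  note x = TS_D[OF VF_TS[OF X p]] and y = TS_D[OF VF_TS[OF Y p]]
  show "lie_bracket X Y p \<in> TS p"
  proof (rule TS_I)
    fix f h assume f: "f \<in> CF" and h: "h \<in> CF"
    have eq: "Z \<in> VF \<Longrightarrow> q \<in> points M \<Longrightarrow> Z q (\<lambda>q. f q + h q) = Z q f + Z q h"
      "Z \<in> VF \<Longrightarrow> q \<in> points M \<Longrightarrow> Z q (\<lambda>q. f q * h q) = Z q f * h q + f q * Z q h" for Z q
      using TS_D[OF VF_TS] f h by blast+
    have out: "Z \<in> VF \<Longrightarrow> q \<notin> points M \<Longrightarrow> Z q k = 0" for Z q k using VF_outside by simp
    have e1: "(\<lambda>q. Z q (\<lambda>q. f q + h q)) = (\<lambda>q. Z q f + Z q h)" if "Z \<in> VF" for Z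
    proof
      fix q show "Z q (\<lambda>q. f q + h q) = Z q f + Z q h"
        by (cases "q \<in> points M") (simp_all add: eq out that)
    qed
    have e2: "(\<lambda>q. Z q (\<lambda>q. f q * h q)) = (\<lambda>q. Z q f * h q + f q * Z q h)" if "Z \<in> VF" for Z
    proof
      fix q show "Z q (\<lambda>q. f q * h q) = Z q f * h q + f q * Z q h"
        by (cases "q \<in> points M") (simp_all add: eq out that)
    qed
    note c = VF_CF[OF X f] VF_CF[OF Y f] VF_CF[OF X h] VF_CF[OF Y h] f h
    show "lie_bracket X Y p (\<lambda>q. f q + h q) = lie_bracket X Y p f + lie_bracket X Y p h"
      by (simp add: lie_bracket_def e1 X Y x y c)
    show "lie_bracket X Y p (\<lambda>q. f q * h q) = lie_bracket X Y p f * h p + f p * lie_bracket X Y p h"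
      by (simp add: lie_bracket_def e2 X Y x y c CF_mult algebra_simps)
  next
    fix f a assume f: "f \<in> CF"
    have eq: "Z \<in> VF \<Longrightarrow> (\<lambda>q. Z q (\<lambda>q. a * f q)) = (\<lambda>q. a * Z q f)" for Z
      using TS_D(2)[OF VF_TS f] VF_outside by (metis mult_zero_right zero_fun_apply)
    note c = VF_CF[OF X f] VF_CF[OF Y f]
    show "lie_bracket X Y p (\<lambda>q. a * f q) = a * lie_bracket X Y p f"
      by (simp add: lie_bracket_def eq X Y x y c algebra_simps)
  next
    fix f assume "f \<notin> CF"
    then show "lie_bracket X Y p f = 0"
      using TS_const[OF VF_TS[OF X p]] TS_const[OF VF_TS[OF Y p]]
      by (simp add: lie_bracket_def VF_zero_fun X Y)
  qed
next
  fix p assume "p \<notin> points M"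
  then show "lie_bracket X Y p = 0"
    using VF_outside[OF X] VF_outside[OF Y] by (auto simp: lie_bracket_def)
next
  fix f assume "f \<in> CF"
  then show "(\<lambda>p. lie_bracket X Y p f) \<in> CF"
    unfolding lie_bracket_def using VF_CF X Y by (intro CF_diff) blast+
qed

text \<open>Locally, vector fields are linear combinations of finitely many global ones, in the algebraic
  form that a multiple \<open>b \<odot> X\<close> is; arguments with bump functions are thereby replaced by
  calculations in the module of vector fields.\<close>

lemma frame:
  assumes p: "p \<in> points M"
  obtains b x E where "b \<in> CF" "b p = 1" "\<And>i. x i \<in> CF" "\<And>i. E i \<in> VF"
    "\<And>q v. q \<in> points M \<Longrightarrow> v \<in> TS q \<Longrightarrow> b q *\<^sub>R v = (\<Sum>i\<in>Basis. v (x i) *\<^sub>R E i q)"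
    "\<And>(i::'e) j. E i p (x j) = i \<bullet> j"
proof -
  obtain U c where c: "(U, c) \<in> atlas M" "p \<in> U" using chart_exists[OF p] .
  obtain b x where b: "b \<in> CF" "b p = 1" and x: "\<And>i. x i \<in> CF" and
    bU: "\<And>q. b q \<noteq> 0 \<Longrightarrow> q \<in> U" and
    cvx: "\<And>q w i. b q \<noteq> 0 \<Longrightarrow> chart_vec U c q w (x i) = w \<bullet> i" and
    cv: "\<And>q v. b q \<noteq> 0 \<Longrightarrow> v \<in> TS q \<Longrightarrow> v = chart_vec U c q (\<Sum>i\<in>Basis. v (x i) *\<^sub>R i)" and
    sm: "\<And>f w. f \<in> CF \<Longrightarrow> (\<lambda>q. b q * chart_vec U c q w f) \<in> CF"
    by (rule cutoff_coordinates[OF c]) blast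
  define E where "E i q = b q *\<^sub>R chart_vec U c q i" for i q
  have E: "E i \<in> VF" for i
  proof (rule VF_I)
    fix q show "E i q \<in> TS q"
      using chart_vec_TS[OF c(1) bU] TS_scale TS_0 by (cases "b q = 0") (auto simp: E_def)
    show "q \<notin> points M \<Longrightarrow> E i q = 0"
      using bU[of q] chart_subset[OF c(1)] by (cases "b q = 0") (auto simp: E_def)
  next
    fix f assume "f \<in> CF" then show "(\<lambda>q. E i q f) \<in> CF" using sm by (simp add: E_def)
  qed
  have "b q *\<^sub>R v = (\<Sum>i\<in>Basis. v (x i) *\<^sub>R E i q)" if v: "v \<in> TS q" for q v
  proof (cases "b q = 0")
    case False
    note lin = linear_chart_vec[OF c(1) bU[OF False]]
    have "v = (\<Sum>i\<in>Basis. v (x i) *\<^sub>R chart_vec U c q i)"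
      using cv[OF False v] by (simp add: linear_sum[OF lin] linear_cmul[OF lin])
    then have "b q *\<^sub>R v = b q *\<^sub>R (\<Sum>i\<in>Basis. v (x i) *\<^sub>R chart_vec U c q i)" by simp
    then show ?thesis by (simp add: E_def scaleR_sum_right mult.commute)
  qed (simp add: E_def)
  moreover have "E i p (x j) = i \<bullet> j" for i j using cvx[of p i j] b by (simp add: E_def)
  ultimately show thesis using that b x E by blast
qed

lemma VF_extend: assumes p: "p \<in> points M" and u: "u \<in> TS p" shows "\<exists>X\<in>VF. X p = u"
proof -
  obtain b x E where b: "b \<in> CF" "b p = 1" and x: "\<And>i. x i \<in> CF" and E: "\<And>i. E i \<in> VF" and
    *: "\<And>q v. q \<in> points M \<Longrightarrow> v \<in> TS q \<Longrightarrow> b q *\<^sub>R v = (\<Sum>i\<in>Basis. v (x i) *\<^sub>R E i q)" and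
    "\<And>(i::'e) j. E i p (x j) = i \<bullet> j"
    by (rule frame[OF p]) blast
  let ?X = "\<Sum>i\<in>(Basis::'e set). u (x i) *\<^sub>R E i"
  have "?X \<in> VF" by (intro VF_sum VF_cscale E)
  moreover have "?X p = u"
  proof -
    have "(\<Sum>i\<in>I. u (x i) *\<^sub>R E i) p = (\<Sum>i\<in>I. u (x i) *\<^sub>R E i p)" for I
      by (induct I rule: infinite_finite_induct) simp_all
    then show ?thesis using *[OF p u] b by simp
  qed
  ultimately show ?thesis by blast
qed

text \<open>Apply \<open>F\<close> to \<open>b \<odot> X = \<Sum> X(x\<^sub>i) \<odot> E\<^sub>i\<close>: at \<open>p\<close> the coefficients vanish and \<open>b\<close> is \<open>1\<close>.\<close>

lemma tensorial_0:
  fixes F :: "'a vfield \<Rightarrow> 'x::real_vector"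
  assumes p: "p \<in> points M"
    and add: "\<And>X Y. X \<in> VF \<Longrightarrow> Y \<in> VF \<Longrightarrow> F (X + Y) = F X + F Y"
    and scale: "\<And>f X. f \<in> CF \<Longrightarrow> X \<in> VF \<Longrightarrow> F (f \<odot> X) = f p *\<^sub>R F X"
    and X: "X \<in> VF" "X p = 0"
  shows "F X = 0"
proof -
  obtain b x E where b: "b \<in> CF" "b p = 1" and x: "\<And>i. x i \<in> CF" and E: "\<And>i. E i \<in> VF" and
    *: "\<And>q v. q \<in> points M \<Longrightarrow> v \<in> TS q \<Longrightarrow> b q *\<^sub>R v = (\<Sum>i\<in>Basis. v (x i) *\<^sub>R E i q)" and
    "\<And>(i::'e) j. E i p (x j) = i \<bullet> j"
    by (rule frame[OF p]) blast
  have F0: "F 0 = 0" using scale[OF CF_const[of 0] VF_0] by (simp add: fun_scale_const)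
  have sumF: "F (\<Sum>i\<in>I. Y i) = (\<Sum>i\<in>I. F (Y i))" if "\<And>i. Y i \<in> VF" for I and Y :: "'e \<Rightarrow> _"
  proof (induct I rule: infinite_finite_induct)
    case (insert i I)
    then show ?case by (simp add: add[OF that VF_sum[OF that]] del: plus_fun_apply)
  qed (simp_all add: F0 del: zero_fun_apply)
  have vs: "(\<Sum>i\<in>I. Y i) q = (\<Sum>i\<in>I. Y i q)" for I q and Y :: "'e \<Rightarrow> 'a vfield"
    by (induct I rule: infinite_finite_induct) auto
  have "b \<odot> X = (\<Sum>i\<in>Basis. (\<lambda>q. X q (x i)) \<odot> E i)"
  proof
    fix q show "(b \<odot> X) q = (\<Sum>i\<in>Basis. (\<lambda>q. X q (x i)) \<odot> E i) q"
      using *[OF _ VF_TS[OF X(1)], of q] VF_outside[OF X(1), of q]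
      by (cases "q \<in> points M") (auto simp: vs fun_scale_def)
  qed
  then have "F (b \<odot> X) = (\<Sum>i\<in>Basis. F ((\<lambda>q. X q (x i)) \<odot> E i))"
    using sumF VF_scale[OF VF_CF[OF X(1) x] E] by simp
  also have "\<dots> = 0"
    by (rule sum.neutral) (simp add: scale[OF VF_CF[OF X(1) x] E] X)
  finally show ?thesis using scale[OF b(1) X(1)] b by simp
qed

lemma tensorial:
  fixes F :: "'a vfield \<Rightarrow> 'x::real_vector"
  assumes p: "p \<in> points M"
    and add: "\<And>X Y. X \<in> VF \<Longrightarrow> Y \<in> VF \<Longrightarrow> F (X + Y) = F X + F Y"
    and scale: "\<And>f X. f \<in> CF \<Longrightarrow> X \<in> VF \<Longrightarrow> F (f \<odot> X) = f p *\<^sub>R F X"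
    and X: "X \<in> VF" and Y: "Y \<in> VF" and eq: "X p = Y p"
  shows "F X = F Y"
proof -
  have "F (X - Y) = 0" by (rule tensorial_0[OF p add scale VF_diff[OF X Y]]) (simp_all add: eq)
  moreover have "F ((X - Y) + Y) = F (X - Y) + F Y" by (rule add[OF VF_diff[OF X Y] Y])
  ultimately show ?thesis by simp
qed

end

section \<open>Smooth maps and their differentials\<close>

locale smooth_mfd_map = M: smooth_mfd M + N: smooth_mfd N
  for M :: "('a, 'e::euclidean_space) manifold" and N :: "('b, 'f::euclidean_space) manifold" +
  fixes h :: "'a \<Rightarrow> 'b"
  assumes smooth_map: "smooth_map M N h"
begin

abbreviation "push \<equiv> pushforward M N h"

lemma maps_points: "p \<in> points M \<Longrightarrow> h p \<in> points N"
  using smooth_map by (auto simp: smooth_map_def continuous_map_def points_def)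

lemma vimage_chart_open:
  assumes d: "(V, d) \<in> atlas N" shows "openin (mfd_top M) {p \<in> points M. h p \<in> V}"
  using openin_continuous_map_preimage[of "mfd_top M" "mfd_top N" h V] smooth_map N.chart_openin[OF d]
  by (simp add: smooth_map_def points_def)

lemma chart_domain_open:
  assumes c: "(U, c) \<in> atlas M" and d: "(V, d) \<in> atlas N" shows "open (c ` (U \<inter> h -` V))"
proof -
  have "U \<inter> {p \<in> points M. h p \<in> V} = U \<inter> h -` V" using M.chart_subset[OF c] by auto
  then show ?thesis using M.chart_image_open[OF c vimage_chart_open[OF d]] by simp
qed

lemma chart_map_smooth:
  "(U, c) \<in> atlas M \<Longrightarrow> (V, d) \<in> atlas N \<Longrightarrow> smooth_on (c ` (U \<inter> h -` V)) (\<lambda>x. d (h (inv_into U c x)))"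
  using smooth_map by (auto simp: smooth_map_def o_def)

lemma pullback: assumes f: "f \<in> smooth_funs N" shows "(\<lambda>p. f (h p)) \<in> smooth_funs M"
proof (rule M.smooth_funsI)
  fix U c assume c: "(U, c) \<in> atlas M"
  show "smooth_on (c ` U) (\<lambda>x. f (h (inv_into U c x)))"
  proof (rule smooth_on_local[OF M.chart_open[OF c]])
    fix x assume "x \<in> c ` U"
    then obtain p where p: "p \<in> U" "x = c p" by auto
    then obtain V d where d: "(V, d) \<in> atlas N" "h p \<in> V"
      using N.chart_exists[OF maps_points] M.chart_subset[OF c] by blast
    let ?W = "c ` (U \<inter> h -` V)"
    have im: "(\<lambda>x. d (h (inv_into U c x))) ` ?W \<subseteq> d ` V" using M.inv_chart[OF c] by auto
    have "smooth_on ?W (\<lambda>x. f (inv_into V d (d (h (inv_into U c x)))))"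
      by (rule smooth_on_compose[where g = "\<lambda>y. f (inv_into V d y)", OF chart_domain_open[OF c d(1)] N.chart_open[OF d(1)] im
            chart_map_smooth[OF c d(1)] smooth_funs_chart'[OF f d(1)]])
    then have "smooth_on ?W (\<lambda>x. f (h (inv_into U c x)))"
      by (rule smooth_on_cong[OF chart_domain_open[OF c d(1)], rotated]) (auto simp: M.inv_chart[OF c] N.inv_chart[OF d(1)])
    then have "smooth_on (c ` U \<inter> ?W) (\<lambda>x. f (h (inv_into U c x)))" by (rule smooth_on_subset) auto
    then show "\<exists>W. open W \<and> x \<in> W \<and> smooth_on (c ` U \<inter> W) (\<lambda>x. f (h (inv_into U c x)))"
      using chart_domain_open[OF c d(1)] p d(2) by (intro exI[of _ ?W]) auto
  qed
qed

lemma push_apply: "f \<in> smooth_funs N \<Longrightarrow> push v f = v (\<lambda>p. f (h p))"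
  by (simp add: pushforward_def o_def)

lemma push_add: "push (u + v) = push u + push v"
  and push_scale: "push (a *\<^sub>R v) = a *\<^sub>R push v"
  by (auto simp: pushforward_def)

lemma linear_push: "linear push"
  by (rule linearI) (simp_all add: push_add push_scale)

lemma push_TS: assumes v: "v \<in> tangent_space M p" shows "push v \<in> tangent_space N (h p)"
  by (rule N.TS_I) (simp_all add: push_apply N.CF_add N.CF_mult N.CF_const pullback M.TS_D[OF v] pushforward_def o_def)

text \<open>In charts, the differential is the derivative of the coordinate expression of the map.\<close>

lemma push_chart_vec:
  assumes c: "(U, c) \<in> atlas M" "p \<in> U" and d: "(V, d) \<in> atlas N" "h p \<in> V"
  shows "push (M.chart_vec U c p w) =
    N.chart_vec V d (h p) (frechet_derivative (\<lambda>x. d (h (inv_into U c x))) (at (c p)) w)"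
proof
  fix f
  show "push (M.chart_vec U c p w) f =
    N.chart_vec V d (h p) (frechet_derivative (\<lambda>x. d (h (inv_into U c x))) (at (c p)) w) f"
  proof (cases "f \<in> smooth_funs N")
    case True
    let ?W = "c ` (U \<inter> h -` V)"
    have pW: "c p \<in> ?W" using c d by auto
    have 1: "((\<lambda>y. f (inv_into V d y)) has_derivative (\<lambda>w. N.chart_vec V d (h p) w f)) (at (d (h (inv_into U c (c p)))))"
      using N.chart_fun_derivative[OF d True] by (simp add: M.inv_chart[OF c])
    note 2 = smooth_on_has_derivative[OF chart_map_smooth[OF c(1) d(1)] pW]
    have "((\<lambda>x. f (inv_into V d (d (h (inv_into U c x))))) has_derivative
        (\<lambda>w. N.chart_vec V d (h p) (frechet_derivative (\<lambda>x. d (h (inv_into U c x))) (at (c p)) w) f)) (at (c p))"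
      by (rule has_derivative_compose[OF 2 1])
    then have "((\<lambda>x. f (h (inv_into U c x))) has_derivative
        (\<lambda>w. N.chart_vec V d (h p) (frechet_derivative (\<lambda>x. d (h (inv_into U c x))) (at (c p)) w) f)) (at (c p))"
      by (rule has_derivative_transform_within_open[OF _ chart_domain_open[OF c(1) d(1)] pW])
        (auto simp: M.inv_chart[OF c(1)] N.inv_chart[OF d(1)])
    from M.chart_vec_eqI[OF this pullback[OF True]] show ?thesis by (simp add: push_apply[OF True])
  next
    case False
    then show ?thesis by (simp add: pushforward_def N.chart_vec_def)
  qed
qed

end

section \<open>Riemannian metrics\<close>

lemma fun_scale_apply: "(f \<odot> X) p = f p *\<^sub>R X p"
  by (simp add: fun_scale_def)

context smooth_mfd begin

text \<open>Derivations do not see the values of a function outside the manifold.\<close>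

lemma TS_cong:
  assumes p: "p \<in> points M" and v: "v \<in> TS p" and f: "f \<in> CF" and h: "h \<in> CF"
    and eq: "\<And>q. q \<in> points M \<Longrightarrow> f q = h q"
  shows "v f = v h"
proof -
  define i where "i q = (if q \<in> points M then 0 else 1 :: real)" for q
  have i: "i \<in> CF" by (rule CF_points_cong[OF CF_const[of 0]]) (simp add: i_def)
  have "(\<lambda>q. f q - h q) = (\<lambda>q. i q * (f q - h q))" using eq by (auto simp: i_def)
  then have "v (\<lambda>q. f q - h q) = v (\<lambda>q. i q * (f q - h q))" by simp
  also have "\<dots> = v i * (f p - h p) + i p * v (\<lambda>q. f q - h q)" by (rule TS_D(3)[OF v i CF_diff[OF f h]])
  also have "\<dots> = 0" using p eq[OF p] by (simp add: i_def)
  finally show ?thesis by (simp add: TS_diff[OF v f h])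
qed

lemma lie_bracket_commute: "lie_bracket Y X p = - lie_bracket X Y p"
  by (auto simp: lie_bracket_def)

lemma lie_bracket_add:
  assumes "X \<in> VF" "Y \<in> VF" "Z \<in> VF" "p \<in> points M"
  shows "lie_bracket (X + Y) Z p = lie_bracket X Z p + lie_bracket Y Z p"
    "lie_bracket Z (X + Y) p = lie_bracket Z X p + lie_bracket Z Y p"
proof -
  show 1: "lie_bracket (X + Y) Z p = lie_bracket X Z p + lie_bracket Y Z p"
  proof
    fix f
    note z = TS_D(1)[OF VF_TS[OF assms(3,4)] VF_CF[OF assms(1)] VF_CF[OF assms(2)]]
    show "lie_bracket (X + Y) Z p f = (lie_bracket X Z p + lie_bracket Y Z p) f"
      using assms by (cases "f \<in> CF")
        (simp_all add: lie_bracket_def VF_zero_fun z TS_const[OF VF_TS[OF assms(3,4)]])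
  qed
  show "lie_bracket Z (X + Y) p = lie_bracket Z X p + lie_bracket Z Y p"
    using 1 by (subst (1 2 3) lie_bracket_commute) simp
qed

lemma lie_bracket_scale:
  assumes X: "X \<in> VF" and Y: "Y \<in> VF" and h: "h \<in> CF" and p: "p \<in> points M"
  shows "lie_bracket (h \<odot> X) Y p = h p *\<^sub>R lie_bracket X Y p - Y p h *\<^sub>R X p"
    "lie_bracket X (h \<odot> Y) p = h p *\<^sub>R lie_bracket X Y p + X p h *\<^sub>R Y p"
proof -
  have 1: "lie_bracket (h \<odot> X) Y p = h p *\<^sub>R lie_bracket X Y p - Y p h *\<^sub>R X p" if X: "X \<in> VF" and Y: "Y \<in> VF" for X Y
  proof
    fix f
    note y = TS_D(3)[OF VF_TS[OF Y p] h VF_CF[OF X]]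
    show "lie_bracket (h \<odot> X) Y p f = (h p *\<^sub>R lie_bracket X Y p - Y p h *\<^sub>R X p) f"
      by (cases "f \<in> CF")
        (simp_all add: lie_bracket_def fun_scale_def VF_zero_fun[OF X] VF_zero_fun[OF Y] y
          TS_const[OF VF_TS[OF X p]] TS_const[OF VF_TS[OF Y p]] algebra_simps)
  qed
  then show "lie_bracket (h \<odot> X) Y p = h p *\<^sub>R lie_bracket X Y p - Y p h *\<^sub>R X p" using X Y .
  show "lie_bracket X (h \<odot> Y) p = h p *\<^sub>R lie_bracket X Y p + X p h *\<^sub>R Y p"
    using 1[OF Y X] by (subst (1 2) lie_bracket_commute) simp
qed

end

locale riemannian = smooth_mfd M for M :: "('a, 'e::euclidean_space) manifold" +
  fixes g :: "'a form2"
  assumes metric: "riemannian_metric M g"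
begin

lemma g_sym: "p \<in> points M \<Longrightarrow> u \<in> TS p \<Longrightarrow> v \<in> TS p \<Longrightarrow> g p u v = g p v u"
  and g_add: "p \<in> points M \<Longrightarrow> u \<in> TS p \<Longrightarrow> v \<in> TS p \<Longrightarrow> w \<in> TS p \<Longrightarrow> g p (u + v) w = g p u w + g p v w"
  and g_scale: "p \<in> points M \<Longrightarrow> u \<in> TS p \<Longrightarrow> v \<in> TS p \<Longrightarrow> g p (a *\<^sub>R u) v = a * g p u v"
  and g_pos: "p \<in> points M \<Longrightarrow> u \<in> TS p \<Longrightarrow> u \<noteq> 0 \<Longrightarrow> g p u u > 0"
  and g_CF: "X \<in> VF \<Longrightarrow> Y \<in> VF \<Longrightarrow> (\<lambda>p. g p (X p) (Y p)) \<in> CF"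
  using metric by (auto simp: riemannian_metric_def form2_apply_def)

lemma g_add2: "p \<in> points M \<Longrightarrow> u \<in> TS p \<Longrightarrow> v \<in> TS p \<Longrightarrow> w \<in> TS p \<Longrightarrow> g p w (u + v) = g p w u + g p w v"
  using g_sym g_add TS_add by metis

lemma g_scale2: "p \<in> points M \<Longrightarrow> u \<in> TS p \<Longrightarrow> v \<in> TS p \<Longrightarrow> g p v (a *\<^sub>R u) = a * g p v u"
  using g_sym g_scale TS_scale by metis

lemma g_0: "p \<in> points M \<Longrightarrow> u \<in> TS p \<Longrightarrow> g p 0 u = 0"
  and g_02: "p \<in> points M \<Longrightarrow> u \<in> TS p \<Longrightarrow> g p u 0 = 0"
  using g_scale[of p 0 u 0] g_scale2[of p 0 u 0] by (simp_all add: TS_0)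

lemma g_neg: "p \<in> points M \<Longrightarrow> u \<in> TS p \<Longrightarrow> v \<in> TS p \<Longrightarrow> g p (- u) v = - g p u v"
  and g_neg2: "p \<in> points M \<Longrightarrow> u \<in> TS p \<Longrightarrow> v \<in> TS p \<Longrightarrow> g p v (- u) = - g p v u"
  using g_scale[of p u v "-1"] g_scale2[of p u v "-1"] by simp_all

lemma g_diff: "p \<in> points M \<Longrightarrow> u \<in> TS p \<Longrightarrow> v \<in> TS p \<Longrightarrow> w \<in> TS p \<Longrightarrow> g p (u - v) w = g p u w - g p v w"
  and g_diff2: "p \<in> points M \<Longrightarrow> u \<in> TS p \<Longrightarrow> v \<in> TS p \<Longrightarrow> w \<in> TS p \<Longrightarrow> g p w (u - v) = g p w u - g p w v"
  using g_add[of p u "- v" w] g_add2[of p u "- v" w] by (simp_all add: g_neg g_neg2 TS_neg)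

lemma g_sum: "p \<in> points M \<Longrightarrow> (\<And>i. i \<in> I \<Longrightarrow> u i \<in> TS p) \<Longrightarrow> w \<in> TS p \<Longrightarrow>
    g p (\<Sum>i\<in>I. u i) w = (\<Sum>i\<in>I. g p (u i) w)"
  by (induct I rule: infinite_finite_induct) (simp_all add: g_0 g_add TS_vsum)

lemma g_eqI:
  assumes "p \<in> points M" "u \<in> TS p" "v \<in> TS p" "\<And>w. w \<in> TS p \<Longrightarrow> g p u w = g p v w"
  shows "u = v"
proof (rule ccontr)
  assume "u \<noteq> v"
  then have "g p (u - v) (u - v) > 0" using assms by (intro g_pos TS_minus) auto
  then show False using assms(4)[of "u - v"] assms(1-3) by (simp add: g_diff TS_minus)
qed

lemma g_eqI_VF:
  assumes "p \<in> points M" "u \<in> TS p" "v \<in> TS p" "\<And>Z. Z \<in> VF \<Longrightarrow> g p u (Z p) = g p v (Z p)"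
  shows "u = v"
  using assms VF_extend by (metis g_eqI)

text \<open>Only as many orthogonal vectors as the dimension are given, so that their spanning the tangent space
  is a dimension count: the linear map \<open>w \<mapsto> (g(w, G\<^sub>i))\<^sub>i\<close> of the model space to itself is
  surjective by orthogonality, hence injective, and it kills the remainder.\<close>

lemma orthogonal_expansion:
  fixes G :: "'e \<Rightarrow> 'a tvec"
  assumes q: "q \<in> points M" and v: "v \<in> TS q" and G: "\<And>i. i \<in> Basis \<Longrightarrow> G i \<in> TS q"
    "\<And>i. i \<in> Basis \<Longrightarrow> G i \<noteq> 0"
    and orth: "\<And>i j. i \<in> Basis \<Longrightarrow> j \<in> Basis \<Longrightarrow> i \<noteq> j \<Longrightarrow> g q (G i) (G j) = 0"
  shows "v = (\<Sum>i\<in>Basis. (g q v (G i) / g q (G i) (G i)) *\<^sub>R G i)"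
proof -
  obtain U c where c: "(U, c) \<in> atlas M" "q \<in> U" using chart_exists[OF q] .
  note lin = linear_chart_vec[OF c] and cT = chart_vec_TS[OF c]
  define K where "K w = (\<Sum>i\<in>Basis. g q (chart_vec U c q w) (G i) *\<^sub>R i)" for w
  have linK: "linear K"
    by (rule linearI) (simp_all add: K_def linear_add[OF lin] linear_cmul[OF lin] g_add g_scale q G cT
        scaleR_add_left sum.distrib scaleR_sum_right)
  have KG: "K w = g q (G j) (G j) *\<^sub>R j" if j: "j \<in> Basis" and w: "chart_vec U c q w = G j" for w j
  proof -
    have "K w = (\<Sum>i\<in>Basis. if i = j then g q (G j) (G j) *\<^sub>R j else 0)"
      unfolding K_def w using orth[OF j] by (intro sum.cong) auto
    then show ?thesis using j by simp
  qed
  have "surj K"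
  proof -
    have "j \<in> range K" if j: "j \<in> Basis" for j
    proof -
      obtain w where w: "G j = chart_vec U c q w" using G(1)[OF j] TS_eq_chart_vec[OF c] by blast
      have "K ((1 / g q (G j) (G j)) *\<^sub>R w) = j"
        using KG[OF j w[symmetric]] g_pos[OF q G(1)[OF j] G(2)[OF j]] by (simp add: linear_cmul[OF linK])
      then show ?thesis by (metis rangeI)
    qed
    then have "span Basis \<subseteq> range K"
      by (intro span_minimal linear_subspace_image[OF linK subspace_UNIV]) auto
    then show ?thesis by auto
  qed
  then have "inj K" by (rule linear_surjective_imp_injective[OF linK]) simp
  define r where "r = v - (\<Sum>i\<in>Basis. (g q v (G i) / g q (G i) (G i)) *\<^sub>R G i)"
  have r: "r \<in> TS q" unfolding r_def by (intro TS_minus TS_vsum TS_scale v G)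
  have rG: "g q r (G j) = 0" if j: "j \<in> Basis" for j
  proof -
    have "g q r (G j) = g q v (G j) - (\<Sum>i\<in>Basis. (g q v (G i) / g q (G i) (G i)) * g q (G i) (G j))"
      unfolding r_def using q v G j by (simp add: g_diff g_sum g_scale TS_vsum TS_scale)
    also have "(\<Sum>i\<in>Basis. (g q v (G i) / g q (G i) (G i)) * g q (G i) (G j)) =
        (\<Sum>i\<in>Basis. if i = j then g q v (G j) else 0)"
      using orth j g_pos[OF q G(1)[OF j] G(2)[OF j]] by (intro sum.cong) auto
    finally show ?thesis using j by simp
  qed
  obtain w where w: "r = chart_vec U c q w" using r TS_eq_chart_vec[OF c] by blast
  have "K w = 0" unfolding K_def w[symmetric] using rG by simp
  then have "w = 0" using \<open>inj K\<close> linear_0[OF linK] by (metis injD)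
  then have "r = 0" using w linear_0[OF lin] by simp
  then show ?thesis by (simp add: r_def)
qed

text \<open>A Gram-Schmidt process without division: it produces global vector fields that are orthogonal
  everywhere, though they may vanish away from \<open>p\<close>.\<close>

lemma orthogonal_fields:
  assumes p: "p \<in> points M"
  shows "\<exists>G. (\<forall>i\<in>(Basis::'e set). G i \<in> VF \<and> G i p \<noteq> 0) \<and>
    (\<forall>i\<in>Basis. \<forall>j\<in>Basis. i \<noteq> j \<longrightarrow> (\<forall>q\<in>points M. g q (G i q) (G j q) = 0))"
proof -
  obtain b x E where "b \<in> CF" "b p = 1" and x: "\<And>i. x i \<in> CF" and E: "\<And>i. E i \<in> VF" and
    "\<And>q v. q \<in> points M \<Longrightarrow> v \<in> TS q \<Longrightarrow> b q *\<^sub>R v = (\<Sum>i\<in>Basis. v (x i) *\<^sub>R E i q)" and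
    dual: "\<And>(i::'e) j. E i p (x j) = i \<bullet> j"
    by (rule frame[OF p]) blast
  have "\<exists>G. (\<forall>i\<in>B. G i \<in> VF \<and> G i p \<noteq> 0 \<and> (\<forall>k\<in>Basis - B. G i p (x k) = 0)) \<and>
      (\<forall>i\<in>B. \<forall>j\<in>B. i \<noteq> j \<longrightarrow> (\<forall>q\<in>points M. g q (G i q) (G j q) = 0))"
    if "finite B" "B \<subseteq> Basis" for B :: "'e set"
    using that
  proof (induct B rule: finite_induct)
    case (insert k B)
    have "\<exists>G. (\<forall>i\<in>B. G i \<in> VF \<and> G i p \<noteq> 0 \<and> (\<forall>k\<in>Basis - B. G i p (x k) = 0)) \<and>
      (\<forall>i\<in>B. \<forall>j\<in>B. i \<noteq> j \<longrightarrow> (\<forall>q\<in>points M. g q (G i q) (G j q) = 0))"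
      by (rule insert.hyps(3)) (use insert.prems in simp)
    then obtain G where G0: "\<forall>i\<in>B. G i \<in> VF \<and> G i p \<noteq> 0 \<and> (\<forall>k\<in>Basis - B. G i p (x k) = 0)"
      "\<forall>i\<in>B. \<forall>j\<in>B. i \<noteq> j \<longrightarrow> (\<forall>q\<in>points M. g q (G i q) (G j q) = 0)" by (elim exE conjE)
    have G1: "G i \<in> VF \<and> G i p \<noteq> 0 \<and> (\<forall>k\<in>Basis - B. G i p (x k) = 0)" if "i \<in> B" for i
      using bspec[OF G0(1) that] .
    note G = conjunct1[OF G1] conjunct1[OF conjunct2[OF G1]] bspec[OF conjunct2[OF conjunct2[OF G1]]]
    have G4: "g q (G i q) (G j q) = 0" if "i \<in> B" "j \<in> B" "i \<noteq> j" "q \<in> points M" for i j q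
      using bspec[OF bspec[OF G0(2) that(1)] that(2)] that(3,4) by blast
    \<comment> \<open>\<open>H\<close> is the usual orthogonalisation of \<open>E k\<close> multiplied by the product \<open>a\<close> of all squared lengths, so that
      the coefficient of \<open>G j\<close> loses its denominator \<open>N j\<close>.\<close>
    define N where "N i q = g q (G i q) (G i q)" for i q
    define a where "a q = (\<Prod>l\<in>B. N l q)" for q
    define h where "h j q = (\<Prod>l\<in>B - {j}. N l q) * g q (E k q) (G j q)" for j q
    have N: "N i \<in> CF" if "i \<in> B" for i unfolding N_def using g_CF G(1)[OF that] by blast
    have a: "a \<in> CF" unfolding a_def using N by (intro CF_prod)
    have h: "h j \<in> CF" if "j \<in> B" for j
      unfolding h_def using N g_CF[OF E G(1)[OF that]] by (intro CF_mult CF_prod) auto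
    define H where "H = a \<odot> E k - (\<Sum>j\<in>B. h j \<odot> G j)"
    have H: "H \<in> VF" unfolding H_def using a h E G(1) by (intro VF_diff VF_scale VF_sum) auto
    have vs: "(\<Sum>i\<in>I. Y i) q = (\<Sum>i\<in>I. Y i q)" for I q and Y :: "'e \<Rightarrow> 'a vfield"
      by (induct I rule: infinite_finite_induct) simp_all
    have Hq: "H q = a q *\<^sub>R E k q - (\<Sum>j\<in>B. h j q *\<^sub>R G j q)" for q
      by (simp add: H_def vs fun_scale_def)
    have Hp: "H p (x l) = a p * (k \<bullet> l)" if "l \<in> Basis - B" for l
      using G(3) that by (simp add: Hq fun_sum_apply dual)
    have ap: "a p \<noteq> 0"
      unfolding a_def N_def using insert(1) G(1,2) g_pos[OF p VF_TS[OF _ p]] by (simp add: less_imp_neq[THEN not_sym])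
    have orthH: "g q (H q) (G i q) = 0" if i: "i \<in> B" and q: "q \<in> points M" for i q
    proof -
      note T = VF_TS[OF E q] VF_TS[OF G(1) q]
      have "g q (H q) (G i q) = a q * g q (E k q) (G i q) - (\<Sum>j\<in>B. h j q * g q (G j q) (G i q))"
        unfolding Hq using q i T by (simp add: g_diff g_sum g_scale TS_vsum TS_scale)
      also have "(\<Sum>j\<in>B. h j q * g q (G j q) (G i q)) = (\<Sum>j\<in>B. if j = i then h i q * N i q else 0)"
        using G4 i q by (intro sum.cong) (auto simp: N_def)
      also have "\<dots> = h i q * N i q" using i insert(1) by simp
      also have "\<dots> = a q * g q (E k q) (G i q)"
        unfolding h_def a_def using prod.remove[OF insert(1) i, of "\<lambda>l. N l q"] by simp
      finally show ?thesis by simp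
    qed
    let ?G = "G(k := H)"
    have kB: "k \<in> Basis - B" using insert by auto
    have "H p \<noteq> 0" using Hp[OF kB] ap kB by (auto simp: inner_Basis)
    moreover have "H p (x l) = 0" if "l \<in> Basis - insert k B" for l
      using Hp[of l] that kB by (auto simp: inner_Basis)
    ultimately have 1: "\<forall>i\<in>insert k B. ?G i \<in> VF \<and> ?G i p \<noteq> 0 \<and> (\<forall>l\<in>Basis - insert k B. ?G i p (x l) = 0)"
      using H G(1,2,3) insert(2) by auto
    have 2: "g q (?G i q) (?G j q) = 0" if ij: "i \<in> insert k B" "j \<in> insert k B" "i \<noteq> j" and q: "q \<in> points M" for i j q
    proof -
      have s: "g q (G i q) (H q) = 0" if "i \<in> B" for i
        using orthH[OF that q] g_sym[OF q VF_TS[OF H q] VF_TS[OF G(1)[OF that] q]] by simp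
      show ?thesis using ij q orthH G4 s insert(2) by auto
    qed
    show ?case using 1 2 by (intro exI[of _ ?G]) blast
  qed simp
  from this[OF finite_Basis subset_refl] show ?thesis by blast
qed

text \<open>Clearing denominators in the expansion along orthogonal fields \<open>G\<^sub>i\<close>, with \<open>b\<close> the product of all
  \<open>g(G\<^sub>i, G\<^sub>i)\<close>. The resulting identity holds everywhere: where one of the fields vanishes, so do \<open>b\<close> and all terms.\<close>

lemma metric_frame:
  assumes p: "p \<in> points M"
  obtains b a G where "b \<in> CF" "b p \<noteq> 0" "\<And>i. i \<in> (Basis::'e set) \<Longrightarrow> a i \<in> CF" "\<And>i. i \<in> Basis \<Longrightarrow> G i \<in> VF"
    "\<And>q v. q \<in> points M \<Longrightarrow> v \<in> TS q \<Longrightarrow> b q *\<^sub>R v = (\<Sum>i\<in>Basis. (a i q * g q v (G i q)) *\<^sub>R G i q)"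
proof -
  from orthogonal_fields[OF p] obtain G where G0: "\<forall>i\<in>(Basis::'e set). G i \<in> VF \<and> G i p \<noteq> 0"
    "\<forall>i\<in>Basis. \<forall>j\<in>Basis. i \<noteq> j \<longrightarrow> (\<forall>q\<in>points M. g q (G i q) (G j q) = 0)" by (elim exE conjE)
  have G1: "G i \<in> VF \<and> G i p \<noteq> 0" if "i \<in> Basis" for i
    using bspec[OF G0(1) that] .
  note G = conjunct1[OF G1] conjunct2[OF G1]
  have G3: "g q (G i q) (G j q) = 0" if "i \<in> Basis" "j \<in> Basis" "i \<noteq> j" "q \<in> points M" for i j q
    using bspec[OF bspec[OF G0(2) that(1)] that(2)] that(3,4) by blast
  define N where "N i q = g q (G i q) (G i q)" for i q
  define b where "b q = (\<Prod>l\<in>Basis. N l q)" for q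
  define a where "a i q = (\<Prod>l\<in>Basis - {i}. N l q)" for i q
  have N: "N i \<in> CF" if "i \<in> Basis" for i unfolding N_def using g_CF G(1)[OF that] by blast
  have b: "b \<in> CF" unfolding b_def using N by (intro CF_prod)
  have a: "a i \<in> CF" for i unfolding a_def using N by (intro CF_prod) auto
  have bp: "b p \<noteq> 0"
    unfolding b_def N_def using G(1,2) g_pos[OF p VF_TS[OF _ p]] by (simp add: less_imp_neq[THEN not_sym])
  have ba: "b q = N i q * a i q" if "i \<in> Basis" for i q
    unfolding a_def b_def by (rule prod.remove[OF finite_Basis that])
  have fin: "b q *\<^sub>R v = (\<Sum>i\<in>Basis. (a i q * g q v (G i q)) *\<^sub>R G i q)" if q: "q \<in> points M" and v: "v \<in> TS q" for q v
  proof (cases "\<exists>j\<in>Basis. G j q = 0")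
    case True
    then obtain j where j: "j \<in> Basis" "G j q = 0" by blast
    then have Nj: "N j q = 0" by (simp add: N_def g_0 q TS_0)
    have "(a i q * g q v (G i q)) *\<^sub>R G i q = 0" if "i \<in> Basis" for i
    proof (cases "i = j")
      case False
      then have "a i q = 0" unfolding a_def using j(1) Nj by (auto intro!: prod_zero)
      then show ?thesis by simp
    qed (simp add: j)
    moreover have "b q = 0" using ba[OF j(1)] Nj by simp
    ultimately show ?thesis by (simp del: scaleR_eq_0_iff)
  next
    case False
    then have nz: "G i q \<noteq> 0" if "i \<in> Basis" for i using that by blast
    have Nnz: "N i q \<noteq> 0" if "i \<in> Basis" for i
      unfolding N_def using g_pos[OF q VF_TS[OF G(1)[OF that] q] nz[OF that]] by simp
    have "v = (\<Sum>i\<in>Basis. (g q v (G i q) / g q (G i q) (G i q)) *\<^sub>R G i q)"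
      by (rule orthogonal_expansion[OF q v]) (use G(1) G3 nz q VF_TS in auto)
    then have "b q *\<^sub>R v = b q *\<^sub>R (\<Sum>i\<in>Basis. (g q v (G i q) / N i q) *\<^sub>R G i q)" unfolding N_def by simp
    also have "\<dots> = (\<Sum>i\<in>Basis. (a i q * g q v (G i q)) *\<^sub>R G i q)"
      unfolding scaleR_sum_right by (rule sum.cong) (simp_all add: ba Nnz)
    finally show ?thesis .
  qed
  show thesis by (rule that[OF b bp a G(1) fin])
qed

lemma form1_field_D:
  assumes "form1_field M w"
  shows "\<And>p u v. p \<in> points M \<Longrightarrow> u \<in> TS p \<Longrightarrow> v \<in> TS p \<Longrightarrow> w p (u + v) = w p u + w p v"
    "\<And>p u a. p \<in> points M \<Longrightarrow> u \<in> TS p \<Longrightarrow> w p (a *\<^sub>R u) = a * w p u"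
    "\<And>X. X \<in> VF \<Longrightarrow> (\<lambda>p. w p (X p)) \<in> CF"
  using assms by (auto simp: form1_field_def form1_apply_def)

text \<open>The isomorphism from 1-forms to vector fields. A metric frame gives the value of the field
  at each point, and expresses \<open>b \<odot> X\<close> near the point by the smooth functions \<open>w(G\<^sub>i)\<close>.\<close>

lemma sharp:
  assumes w: "form1_field M w"
  obtains X where "X \<in> VF" "\<And>p v. p \<in> points M \<Longrightarrow> v \<in> TS p \<Longrightarrow> g p (X p) v = w p v"
proof -
  note wD = form1_field_D[OF w]
  have w0: "w p 0 = 0" if "p \<in> points M" for p using wD(2)[OF that TS_0, of 0] by simp
  have wsum: "w p (\<Sum>i\<in>I. u i) = (\<Sum>i\<in>I. w p (u i))" if "p \<in> points M" "\<And>i. i \<in> I \<Longrightarrow> u i \<in> TS p" for p u and I :: "'e set"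
    using that(2) by (induct I rule: infinite_finite_induct) (simp_all add: w0 wD(1) that(1) TS_vsum)
  have ex: "\<exists>u\<in>TS p. \<forall>v\<in>TS p. g p u v = w p v" if p: "p \<in> points M" for p
  proof -
    obtain b a G where b: "b \<in> CF" "b p \<noteq> 0" and a: "\<And>i. i \<in> (Basis::'e set) \<Longrightarrow> a i \<in> CF"
      and G: "\<And>i. i \<in> Basis \<Longrightarrow> G i \<in> VF" and
      *: "\<And>q v. q \<in> points M \<Longrightarrow> v \<in> TS q \<Longrightarrow> b q *\<^sub>R v = (\<Sum>i\<in>Basis. (a i q * g q v (G i q)) *\<^sub>R G i q)"
      by (rule metric_frame[OF p]) blast
    note GT = VF_TS[OF G p]
    define u where "u = (1 / b p) *\<^sub>R (\<Sum>i\<in>Basis. (a i p * w p (G i p)) *\<^sub>R G i p)"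
    have u: "u \<in> TS p" unfolding u_def by (intro TS_scale TS_vsum GT)
    have "g p u v = w p v" if v: "v \<in> TS p" for v
    proof -
      have "b p * w p v = w p (b p *\<^sub>R v)" by (simp add: wD(2) p v)
      also have "\<dots> = (\<Sum>i\<in>Basis. a i p * g p v (G i p) * w p (G i p))"
        unfolding *[OF p v] using p GT by (simp add: wsum wD(2) TS_scale)
      also have "\<dots> = (\<Sum>i\<in>Basis. a i p * w p (G i p) * g p (G i p) v)"
        using g_sym[OF p v GT] by (intro sum.cong) auto
      also have "\<dots> = g p (b p *\<^sub>R u) v"
        unfolding u_def using b p v GT by (simp add: g_sum g_scale TS_scale)
      finally show ?thesis using b p u v by (simp add: g_scale)
    qed
    then show ?thesis using u by blast
  qed
  define X where "X p = (if p \<in> points M then SOME u. u \<in> TS p \<and> (\<forall>v\<in>TS p. g p u v = w p v) else 0)" for p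
  have X: "X p \<in> TS p \<and> (\<forall>v\<in>TS p. g p (X p) v = w p v)" if "p \<in> points M" for p
    using someI_ex[of "\<lambda>u. u \<in> TS p \<and> (\<forall>v\<in>TS p. g p u v = w p v)"] ex[OF that] that by (simp add: X_def Bex_def)
  have "X \<in> VF"
  proof (rule VF_local)
    fix p assume p: "p \<in> points M"
    obtain b a G where b: "b \<in> CF" "b p \<noteq> 0" and a: "\<And>i. i \<in> (Basis::'e set) \<Longrightarrow> a i \<in> CF"
      and G: "\<And>i. i \<in> Basis \<Longrightarrow> G i \<in> VF" and
      *: "\<And>q v. q \<in> points M \<Longrightarrow> v \<in> TS q \<Longrightarrow> b q *\<^sub>R v = (\<Sum>i\<in>Basis. (a i q * g q v (G i q)) *\<^sub>R G i q)"
      by (rule metric_frame[OF p]) blast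
    have "(\<lambda>q. b q * X q f) \<in> CF" if f: "f \<in> CF" for f
    proof -
      have "b q * X q f = (\<Sum>i\<in>Basis. a i q * w q (G i q) * G i q f)" for q
      proof (cases "q \<in> points M")
        case True
        have "b q *\<^sub>R X q = (\<Sum>i\<in>Basis. (a i q * w q (G i q)) *\<^sub>R G i q)"
          using *[OF True, of "X q"] X[OF True] VF_TS[OF G True] by simp
        then have "(b q *\<^sub>R X q) f = (\<Sum>i\<in>Basis. (a i q * w q (G i q)) *\<^sub>R G i q) f" by simp
        then show ?thesis by (simp add: fun_sum_apply)
      next
        case False
        then show ?thesis using VF_outside[OF G False] by (simp add: X_def)
      qed
      moreover have "(\<lambda>q. \<Sum>i\<in>Basis. a i q * w q (G i q) * G i q f) \<in> CF"
        by (rule CF_sum) (rule CF_mult[OF CF_mult[OF a wD(3)[OF G]] VF_CF[OF G f]])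
      ultimately show ?thesis by simp
    qed
    then show "\<exists>b\<in>CF. b p \<noteq> 0 \<and> (\<forall>f\<in>CF. (\<lambda>q. b q * X q f) \<in> CF)" using b by blast
  qed (use X in \<open>simp_all add: X_def\<close>)
  then show thesis using that X by blast
qed

section \<open>The Levi-Civita connection\<close>

text \<open>Twice the scalar product of the covariant derivative of \<open>Y\<close> along \<open>X\<close> with \<open>Z\<close>, for the Levi-Civita connection.\<close>

definition koszul :: "'a vfield \<Rightarrow> 'a vfield \<Rightarrow> 'a vfield \<Rightarrow> 'a \<Rightarrow> real" where
  "koszul X Y Z p = X p (\<lambda>q. g q (Y q) (Z q)) + Y p (\<lambda>q. g q (X q) (Z q)) - Z p (\<lambda>q. g q (X q) (Y q))
    + g p (lie_bracket X Y p) (Z p) - g p (lie_bracket X Z p) (Y p) - g p (lie_bracket Y Z p) (X p)"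

lemma koszul_CF:
  assumes X: "X \<in> VF" and Y: "Y \<in> VF" and Z: "Z \<in> VF"
  shows "koszul X Y Z \<in> CF"
  unfolding koszul_def[abs_def]
  by (rule CF_diff[OF CF_diff[OF CF_add[OF CF_diff[OF CF_add[OF
        VF_CF[OF X g_CF[OF Y Z]] VF_CF[OF Y g_CF[OF X Z]]] VF_CF[OF Z g_CF[OF X Y]]]
        g_CF[OF VF_lie_bracket[OF X Y] Z]] g_CF[OF VF_lie_bracket[OF X Z] Y]] g_CF[OF VF_lie_bracket[OF Y Z] X]])

lemma D_g_add:
  assumes p: "p \<in> points M" and v: "v \<in> TS p" and X: "X \<in> VF" and Y: "Y \<in> VF" and Z: "Z \<in> VF"
  shows "v (\<lambda>q. g q (X q + Y q) (Z q)) = v (\<lambda>q. g q (X q) (Z q)) + v (\<lambda>q. g q (Y q) (Z q))"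
    "v (\<lambda>q. g q (Z q) (X q + Y q)) = v (\<lambda>q. g q (Z q) (X q)) + v (\<lambda>q. g q (Z q) (Y q))"
proof -
  have "v (\<lambda>q. g q (X q + Y q) (Z q)) = v (\<lambda>q. g q (X q) (Z q) + g q (Y q) (Z q))"
    by (rule TS_cong[OF p v _ CF_add[OF g_CF[OF X Z] g_CF[OF Y Z]]], use g_CF[OF VF_add[OF X Y] Z] in simp)
      (rule g_add[OF _ VF_TS[OF X] VF_TS[OF Y] VF_TS[OF Z]])
  then show "v (\<lambda>q. g q (X q + Y q) (Z q)) = v (\<lambda>q. g q (X q) (Z q)) + v (\<lambda>q. g q (Y q) (Z q))"
    by (simp only: TS_D(1)[OF v g_CF[OF X Z] g_CF[OF Y Z]] TS_D(1)[OF v g_CF[OF Z X] g_CF[OF Z Y]])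
  have "v (\<lambda>q. g q (Z q) (X q + Y q)) = v (\<lambda>q. g q (Z q) (X q) + g q (Z q) (Y q))"
    by (rule TS_cong[OF p v _ CF_add[OF g_CF[OF Z X] g_CF[OF Z Y]]], use g_CF[OF Z VF_add[OF X Y]] in simp)
      (rule g_add2[OF _ VF_TS[OF X] VF_TS[OF Y] VF_TS[OF Z]])
  then show "v (\<lambda>q. g q (Z q) (X q + Y q)) = v (\<lambda>q. g q (Z q) (X q)) + v (\<lambda>q. g q (Z q) (Y q))"
    by (simp only: TS_D(1)[OF v g_CF[OF X Z] g_CF[OF Y Z]] TS_D(1)[OF v g_CF[OF Z X] g_CF[OF Z Y]])
qed

lemma D_g_scale:
  assumes p: "p \<in> points M" and v: "v \<in> TS p" and h: "h \<in> CF" and X: "X \<in> VF" and Z: "Z \<in> VF"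
  shows "v (\<lambda>q. g q (h q *\<^sub>R X q) (Z q)) = v h * g p (X p) (Z p) + h p * v (\<lambda>q. g q (X q) (Z q))"
    "v (\<lambda>q. g q (Z q) (h q *\<^sub>R X q)) = v h * g p (Z p) (X p) + h p * v (\<lambda>q. g q (Z q) (X q))"
proof -
  note hX = VF_scale[OF h X, unfolded fun_scale_def]
  have "v (\<lambda>q. g q (h q *\<^sub>R X q) (Z q)) = v (\<lambda>q. h q * g q (X q) (Z q))"
    by (rule TS_cong[OF p v g_CF[OF hX Z] CF_mult[OF h g_CF[OF X Z]]]) (rule g_scale[OF _ VF_TS[OF X] VF_TS[OF Z]])
  then show "v (\<lambda>q. g q (h q *\<^sub>R X q) (Z q)) = v h * g p (X p) (Z p) + h p * v (\<lambda>q. g q (X q) (Z q))"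
    by (simp only: TS_D(3)[OF v h g_CF[OF X Z]] TS_D(3)[OF v h g_CF[OF Z X]])
  have "v (\<lambda>q. g q (Z q) (h q *\<^sub>R X q)) = v (\<lambda>q. h q * g q (Z q) (X q))"
    by (rule TS_cong[OF p v g_CF[OF Z hX] CF_mult[OF h g_CF[OF Z X]]]) (rule g_scale2[OF _ VF_TS[OF X] VF_TS[OF Z]])
  then show "v (\<lambda>q. g q (Z q) (h q *\<^sub>R X q)) = v h * g p (Z p) (X p) + h p * v (\<lambda>q. g q (Z q) (X q))"
    by (simp only: TS_D(3)[OF v h g_CF[OF X Z]] TS_D(3)[OF v h g_CF[OF Z X]])
qed

lemma D_g_sym:
  assumes p: "p \<in> points M" and v: "v \<in> TS p" and X: "X \<in> VF" and Z: "Z \<in> VF"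
  shows "v (\<lambda>q. g q (X q) (Z q)) = v (\<lambda>q. g q (Z q) (X q))"
  by (rule TS_cong[OF p v g_CF[OF X Z] g_CF[OF Z X]]) (rule g_sym[OF _ VF_TS[OF X] VF_TS[OF Z]])

lemmas koszul_simps = koszul_def lie_bracket_add lie_bracket_scale VF_TS VF_add VF_scale VF_lie_bracket
  D_g_add D_g_scale g_add g_add2 g_scale g_scale2 g_diff g_diff2 TS_add TS_scale TS_minus VF_CF TS_D(4)

lemma koszul_add3:
  assumes "X \<in> VF" "Y \<in> VF" "Z \<in> VF" "Z' \<in> VF" "p \<in> points M"
  shows "koszul X Y (Z + Z') p = koszul X Y Z p + koszul X Y Z' p"
    "koszul (Z + Z') X Y p = koszul Z X Y p + koszul Z' X Y p"
    "koszul X (Z + Z') Y p = koszul X Z Y p + koszul X Z' Y p"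
  using assms by (simp_all add: koszul_simps)

lemma koszul_scale:
  assumes "X \<in> VF" "Y \<in> VF" "Z \<in> VF" "h \<in> CF" "p \<in> points M"
  shows "koszul X Y (h \<odot> Z) p = h p * koszul X Y Z p"
    "koszul (h \<odot> X) Y Z p = h p * koszul X Y Z p"
    "koszul X (h \<odot> Y) Z p = h p * koszul X Y Z p + 2 * X p h * g p (Y p) (Z p)"
proof -
  have e: "(h \<odot> W) q = h q *\<^sub>R W q" for W q by (simp add: fun_scale_def)
  note s = D_g_sym[OF assms(5) VF_TS[OF assms(1,5)] assms(2,3)]
    g_sym[OF assms(5) VF_TS[OF assms(1,5)] VF_TS[OF assms(2,5)]]
    g_sym[OF assms(5) VF_TS[OF assms(1,5)] VF_TS[OF assms(3,5)]]
    g_sym[OF assms(5) VF_TS[OF assms(2,5)] VF_TS[OF assms(3,5)]]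
  show "koszul X Y (h \<odot> Z) p = h p * koszul X Y Z p"
    "koszul (h \<odot> X) Y Z p = h p * koszul X Y Z p"
    "koszul X (h \<odot> Y) Z p = h p * koszul X Y Z p + 2 * X p h * g p (Y p) (Z p)"
    using assms s by (simp_all add: koszul_simps e algebra_simps)
qed

text \<open>Torsion-freeness and compatibility with the metric cancel all but one of the covariant derivatives
  in the Koszul expression.\<close>

lemma koszul_formula:
  assumes D: "levi_civita M g D" and X: "X \<in> VF" and Y: "Y \<in> VF" and Z: "Z \<in> VF" and p: "p \<in> points M"
  shows "2 * g p (D X Y p) (Z p) = koszul X Y Z p"
proof -
  have DVF: "D A B \<in> VF" and tor: "D A B - D B A = lie_bracket A B" if "A \<in> VF" "B \<in> VF" for A B
    using D that by (auto simp: levi_civita_def)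
  have met: "A p (\<lambda>q. g q (B q) (C q)) = g p (D A B p) (C p) + g p (B p) (D A C p)"
    if "A \<in> VF" "B \<in> VF" "C \<in> VF" for A B C
    using D that p by (simp add: levi_civita_def form2_apply_def)
  have tor': "lie_bracket A B p = D A B p - D B A p" if "A \<in> VF" "B \<in> VF" for A B
    using fun_cong[OF tor[OF that], of p] by simp
  have T: "A p \<in> TS p" if "A \<in> VF" for A using VF_TS[OF that p] .
  have s: "g p (A p) (B p) = g p (B p) (A p)" if "A \<in> VF" "B \<in> VF" for A B
    using g_sym[OF p T[OF that(1)] T[OF that(2)]] .
  show ?thesis
    unfolding koszul_def
    using s[OF DVF[OF X Y] Z] s[OF DVF[OF X Z] Y] s[OF DVF[OF Y Z] X] s[OF DVF[OF Y X] Z] s[OF DVF[OF Z X] Y] s[OF DVF[OF Z Y] X]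
    by (simp add: met tor' X Y Z g_diff p T DVF)
qed

lemma levi_civita_unique:
  assumes "levi_civita M g D" "levi_civita M g D'" "X \<in> VF" "Y \<in> VF"
  shows "D X Y = D' X Y"
proof (rule VF_eqI)
  show 1: "D X Y \<in> VF" "D' X Y \<in> VF" using assms by (auto simp: levi_civita_def)
  fix p assume p: "p \<in> points M"
  show "D X Y p = D' X Y p"
  proof (rule g_eqI_VF[OF p VF_TS[OF 1(1) p] VF_TS[OF 1(2) p]])
    fix Z assume "Z \<in> VF"
    then show "g p (D X Y p) (Z p) = g p (D' X Y p) (Z p)"
      using koszul_formula[OF assms(1,3,4) _ p] koszul_formula[OF assms(2,3,4) _ p] by (metis mult_cancel_left zero_neq_numeral)
  qed
qed

text \<open>The Koszul expression is linear over the smooth functions in \<open>Z\<close>, so it is a 1-form in \<open>Z\<close>,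
  and \<open>D X Y\<close> is half the vector field dual to it. Each axiom is an identity between Koszul expressions.\<close>

lemma levi_civita_exists: obtains D where "levi_civita M g D"
proof -
  have "\<exists>W\<in>VF. \<forall>p\<in>points M. \<forall>Z\<in>VF. 2 * g p (W p) (Z p) = koszul X Y Z p" if X: "X \<in> VF" and Y: "Y \<in> VF" for X Y
  proof -
    define w where "w p v = koszul X Y (SOME Z. Z \<in> VF \<and> Z p = v) p / 2" for p v
    have w: "w p (Z p) = koszul X Y Z p / 2" if p: "p \<in> points M" and Z: "Z \<in> VF" for p Z
    proof -
      let ?Z = "SOME Z'. Z' \<in> VF \<and> Z' p = Z p"
      have Z': "?Z \<in> VF \<and> ?Z p = Z p" by (rule someI[of "\<lambda>Z'. Z' \<in> VF \<and> Z' p = Z p" Z]) (simp add: Z)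
      have "koszul X Y ?Z p = koszul X Y Z p"
        by (rule tensorial[OF p, of "\<lambda>Z. koszul X Y Z p"]) (simp_all add: koszul_add3(1) koszul_scale(1) X Y Z p Z')
      then show ?thesis by (simp add: w_def)
    qed
    have "form1_field M w"
      unfolding form1_field_def
    proof (intro conjI ballI allI)
      fix p u v and a :: real assume p: "p \<in> points M" and u: "u \<in> TS p"
      obtain U where U: "U \<in> VF" "U p = u" using VF_extend[OF p u] by blast
      have "w p (a *\<^sub>R u) = koszul X Y ((\<lambda>_. a) \<odot> U) p / 2" "w p u = koszul X Y U p / 2"
        using w[OF p VF_scale[OF CF_const[of a] U(1)]] w[OF p U(1)] by (simp_all only: fun_scale_apply U(2))
      then show "w p (a *\<^sub>R u) = a * w p u"
        by (simp only: koszul_scale(1)[OF X Y U(1) CF_const p, of a])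
      assume v: "v \<in> TS p"
      obtain V where V: "V \<in> VF" "V p = v" using VF_extend[OF p v] by blast
      show "w p (u + v) = w p u + w p v"
        using w[OF p VF_add[OF U(1) V(1)]] w[OF p U(1)] w[OF p V(1)] koszul_add3(1)[OF X Y U(1) V(1) p]
        by (simp add: U(2) V(2) add_divide_distrib)
    next
      fix Z assume Z: "Z \<in> VF"
      have "(\<lambda>q. (1/2) * koszul X Y Z q) \<in> CF" by (intro CF_mult CF_const koszul_CF X Y Z)
      then show "form1_apply w Z \<in> CF" by (rule CF_points_cong) (simp add: form1_apply_def w Z)
    qed
    then obtain W where W: "W \<in> VF" "\<And>p v. p \<in> points M \<Longrightarrow> v \<in> TS p \<Longrightarrow> g p (W p) v = w p v" by (rule sharp) (rule that)
    have "2 * g p (W p) (Z p) = koszul X Y Z p" if "p \<in> points M" "Z \<in> VF" for p Z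
      using W(2)[OF that(1) VF_TS[OF that(2,1)]] w[OF that] by simp
    then show ?thesis using W(1) by blast
  qed
  then obtain D where D: "\<And>X Y. X \<in> VF \<Longrightarrow> Y \<in> VF \<Longrightarrow> D X Y \<in> VF"
    "\<And>X Y p Z. X \<in> VF \<Longrightarrow> Y \<in> VF \<Longrightarrow> p \<in> points M \<Longrightarrow> Z \<in> VF \<Longrightarrow> 2 * g p (D X Y p) (Z p) = koszul X Y Z p"
    by metis
  have D': "g p (D X Y p) (Z p) = koszul X Y Z p / 2" if "X \<in> VF" "Y \<in> VF" "p \<in> points M" "Z \<in> VF" for X Y p Z
    using D(2)[OF that] by simp
  have eqI: "A = B" if A: "A \<in> VF" and B: "B \<in> VF" and e: "\<And>p Z. p \<in> points M \<Longrightarrow> Z \<in> VF \<Longrightarrow> g p (A p) (Z p) = g p (B p) (Z p)" for A B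
  proof (rule VF_eqI[OF A B])
    fix p assume p: "p \<in> points M"
    show "A p = B p" by (rule g_eqI_VF[OF p VF_TS[OF A p] VF_TS[OF B p]], rule e[OF p])
  qed
  have "levi_civita M g D"
    unfolding levi_civita_def
  proof (intro ballI conjI)
    fix X Y assume X: "X \<in> VF" and Y: "Y \<in> VF"
    show "D X Y \<in> VF" by (rule D[OF X Y])
    show "D X Y - D Y X = lie_bracket X Y"
    proof (rule eqI)
      fix p Z assume p: "p \<in> points M" and Z: "Z \<in> VF"
      note T = VF_TS[OF _ p]
      have "g p (lie_bracket Y X p) (Z p) = - g p (lie_bracket X Y p) (Z p)"
        by (subst lie_bracket_commute) (simp add: g_neg p T VF_lie_bracket X Y Z)
      then show "g p ((D X Y - D Y X) p) (Z p) = g p (lie_bracket X Y p) (Z p)"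
        using D_g_sym[OF p T[OF Z] X Y]
        by (simp add: g_diff p T D(1) X Y Z D' koszul_def field_simps)
    qed (rule VF_diff[OF D(1)[OF X Y] D(1)[OF Y X]], rule VF_lie_bracket[OF X Y])
    fix f assume f: "f \<in> CF"
    show "D (f \<odot> X) Y = f \<odot> D X Y"
      by (rule eqI) (simp_all add: D VF_scale f X Y fun_scale_apply g_scale VF_TS D' koszul_scale)
    show "D X (f \<odot> Y) = (\<lambda>p. X p f) \<odot> Y + f \<odot> D X Y"
    proof (rule eqI)
      fix p Z assume p: "p \<in> points M" and Z: "Z \<in> VF"
      show "g p (D X (f \<odot> Y) p) (Z p) = g p (((\<lambda>p. X p f) \<odot> Y + f \<odot> D X Y) p) (Z p)"
        using p Z f X Y by (simp add: D D' VF_scale koszul_scale fun_scale_apply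
            g_add g_scale VF_TS TS_scale add_divide_distrib)
    qed (rule D(1)[OF X VF_scale[OF f Y]],
        rule VF_add[OF VF_scale[OF VF_CF[OF X f] Y] VF_scale[OF f D(1)[OF X Y]]])
  next
    fix X Y Z assume X: "X \<in> VF" and Y: "Y \<in> VF" and Z: "Z \<in> VF"
    show "D (X + Y) Z = D X Z + D Y Z"
      by (rule eqI) (simp_all add: D VF_add X Y Z g_add VF_TS D' koszul_add3 add_divide_distrib)
    show "D X (Y + Z) = D X Y + D X Z"
      by (rule eqI) (simp_all add: D VF_add X Y Z g_add VF_TS D' koszul_add3 add_divide_distrib)
    fix p assume p: "p \<in> points M"
    note T = VF_TS[OF _ p]
    have b: "g p (lie_bracket Z Y p) (X p) = - g p (lie_bracket Y Z p) (X p)"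
      by (subst lie_bracket_commute) (simp add: g_neg p T VF_lie_bracket X Y Z)
    have s: "g p (Y p) (D X Z p) = g p (D X Z p) (Y p)" by (intro g_sym p T Y D X Z)
    show "X p (form2_apply g Y Z) = g p (D X Y p) (Z p) + g p (Y p) (D X Z p)"
      unfolding s form2_apply_def using D_g_sym[OF p T[OF X] Y Z] b
      by (simp add: D' X Y Z p koszul_def field_simps)
  qed
  then show thesis using that by blast
qed

end

locale riemannian_connection = riemannian M g for M :: "('a, 'e::euclidean_space) manifold" and g +
  fixes D :: "'a conn"
  assumes levi_civita: "levi_civita M g D"
begin

lemma D_VF: "X \<in> VF \<Longrightarrow> Y \<in> VF \<Longrightarrow> D X Y \<in> VF"
  and D_add1: "X \<in> VF \<Longrightarrow> Y \<in> VF \<Longrightarrow> Z \<in> VF \<Longrightarrow> D (X + Y) Z = D X Z + D Y Z"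
  and D_add2: "X \<in> VF \<Longrightarrow> Y \<in> VF \<Longrightarrow> Z \<in> VF \<Longrightarrow> D X (Y + Z) = D X Y + D X Z"
  and D_scale1: "X \<in> VF \<Longrightarrow> Y \<in> VF \<Longrightarrow> f \<in> CF \<Longrightarrow> D (f \<odot> X) Y = f \<odot> D X Y"
  and D_scale2: "X \<in> VF \<Longrightarrow> Y \<in> VF \<Longrightarrow> f \<in> CF \<Longrightarrow> D X (f \<odot> Y) = (\<lambda>p. X p f) \<odot> Y + f \<odot> D X Y"
  and D_torsion: "X \<in> VF \<Longrightarrow> Y \<in> VF \<Longrightarrow> D X Y - D Y X = lie_bracket X Y"
  and D_metric: "X \<in> VF \<Longrightarrow> Y \<in> VF \<Longrightarrow> Z \<in> VF \<Longrightarrow> p \<in> points M \<Longrightarrow>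
    X p (\<lambda>q. g q (Y q) (Z q)) = g p (D X Y p) (Z p) + g p (Y p) (D X Z p)"
  using levi_civita by (simp_all add: levi_civita_def form2_apply_def)

lemma D_TS: "X \<in> VF \<Longrightarrow> Y \<in> VF \<Longrightarrow> p \<in> points M \<Longrightarrow> D X Y p \<in> TS p"
  using D_VF VF_TS by blast

text \<open>The value of \<open>\<nabla>\<^sub>XY\<close> at a point depends on \<open>X\<close> only through its value there.\<close>

lemma D_tensorial:
  assumes "X \<in> VF" "X' \<in> VF" "Y \<in> VF" "p \<in> points M" "X p = X' p"
  shows "D X Y p = D X' Y p"
  by (rule tensorial[OF assms(4), of "\<lambda>X. D X Y p"]) (simp_all add: D_add1 D_scale1 fun_scale_apply assms)

lemma D_0: assumes "X \<in> VF" shows "D X 0 = 0"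
  using D_add2[OF assms VF_0 VF_0] by simp

end

section \<open>Riemannian submersions\<close>

context smooth_mfd begin

text \<open>Finite-dimensionality of the tangent spaces, transported from the model space by a chart.\<close>

lemma TS_injective_imp_surjective:
  assumes q: "q \<in> points M" and F: "\<And>u. u \<in> TS q \<Longrightarrow> F u \<in> TS q"
    and add: "\<And>u v. u \<in> TS q \<Longrightarrow> v \<in> TS q \<Longrightarrow> F (u + v) = F u + F v"
    and scale: "\<And>u a. u \<in> TS q \<Longrightarrow> F (a *\<^sub>R u) = a *\<^sub>R F u"
    and inj: "\<And>u. u \<in> TS q \<Longrightarrow> F u = 0 \<Longrightarrow> u = 0" and v: "v \<in> TS q"
  shows "\<exists>u\<in>TS q. F u = v"
proof -
  obtain U c where c: "(U, c) \<in> atlas M" "q \<in> U" using chart_exists[OF q] .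
  note lin = linear_chart_vec[OF c] and cT = chart_vec_TS[OF c] and ij = chart_vec_inj[OF c]
  define k where "k w = inv (chart_vec U c q) (F (chart_vec U c q w))" for w
  have ck: "chart_vec U c q (k w) = F (chart_vec U c q w)" for w
    using F[OF cT] TS_eq_chart_vec[OF c] unfolding k_def by (intro f_inv_into_f) blast
  have "linear k"
  proof (rule linearI)
    show "k (u + w) = k u + k w" for u w
      by (rule injD[OF ij]) (simp only: ck linear_add[OF lin] add[OF cT cT])
    show "k (a *\<^sub>R u) = a *\<^sub>R k u" for a u
      by (rule injD[OF ij]) (simp only: ck linear_cmul[OF lin] scale[OF cT])
  qed
  moreover have "inj k"
  proof (subst linear_injective_0[OF \<open>linear k\<close>], intro allI impI)
    fix w assume "k w = 0"
    then have "F (chart_vec U c q w) = 0" using ck[of w] linear_0[OF lin] by metis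
    then have "chart_vec U c q w = chart_vec U c q 0" using inj[OF cT] linear_0[OF lin] by simp
    then show "w = 0" by (rule injD[OF ij])
  qed
  ultimately have "surj k" by (rule linear_injective_imp_surjective) simp
  moreover obtain w where w: "v = chart_vec U c q w" using v TS_eq_chart_vec[OF c] by blast
  ultimately obtain w' where "w = k w'" by blast
  then have "F (chart_vec U c q w') = v" using ck w by simp
  then show ?thesis using cT by blast
qed

end

locale metric_map = smooth_mfd_map M N h + N: riemannian N g'
  for M :: "('a, 'e::euclidean_space) manifold" and N :: "('b, 'f::euclidean_space) manifold" and h g'
begin

text \<open>Vector fields along \<open>h\<close>, that is, sections of the pullback of the tangent bundle of the base.\<close>

definition along :: "('a \<Rightarrow> 'b tvec) \<Rightarrow> bool" where
  "along S \<longleftrightarrow> (\<forall>p\<in>points M. S p \<in> (tangent_space N) (h p)) \<and> (\<forall>f\<in>smooth_funs N. (\<lambda>p. S p f) \<in> smooth_funs M)"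

lemma along_push: assumes X: "X \<in> vector_fields M" shows "along (\<lambda>p. push (X p))"
  unfolding along_def using push_TS[OF M.VF_TS[OF X]] M.VF_CF[OF X pullback] by (simp add: push_apply)

lemma along_base: assumes X: "X \<in> vector_fields N" shows "along (\<lambda>p. X (h p))"
  unfolding along_def using N.VF_TS[OF X maps_points] pullback[OF N.VF_CF[OF X]] by simp

text \<open>A frame of the target near \<open>h p\<^sub>0\<close> expands both sections with coefficients \<open>S(x\<^sub>i)\<close> and
  \<open>R(x\<^sub>j)\<close>, which are smooth on the source.\<close>

lemma along_metric:
  assumes S: "along S" and R: "along R"
  shows "(\<lambda>p. g' (h p) (S p) (R p)) \<in> smooth_funs M"
proof (rule M.CF_local)
  fix p0 assume p0: "p0 \<in> points M"
  obtain b x E where b: "b \<in> smooth_funs N" "b (h p0) = 1" and x: "\<And>i. x i \<in> smooth_funs N" and E: "\<And>i. E i \<in> vector_fields N" and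
    *: "\<And>q v. q \<in> points N \<Longrightarrow> v \<in> (tangent_space N) q \<Longrightarrow> b q *\<^sub>R v = (\<Sum>i\<in>Basis. v (x i) *\<^sub>R E i q)" and
    "\<And>(i::'f) j. E i (h p0) (x j) = i \<bullet> j"
    by (rule N.frame[OF maps_points[OF p0]]) blast
  define G where "G i j p = S p (x i) * R p (x j) * g' (h p) (E i (h p)) (E j (h p))" for i j p
  have G: "G i j \<in> smooth_funs M" for i j
    unfolding G_def using S R x pullback[OF N.g_CF[OF E E]] by (intro M.CF_mult) (auto simp: along_def)
  have eq: "b (h p) * b (h p) * g' (h p) (S p) (R p) = (\<Sum>i\<in>Basis. \<Sum>j\<in>Basis. G i j p)" if p: "p \<in> points M" for p
  proof -
    note q = maps_points[OF p]
    have SR: "S p \<in> (tangent_space N) (h p)" "R p \<in> (tangent_space N) (h p)" using S R p by (auto simp: along_def)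
    note E' = N.VF_TS[OF E q]
    have gsum2: "g' (h p) v (\<Sum>j\<in>I. u j) = (\<Sum>j\<in>I. g' (h p) v (u j))"
      if "v \<in> (tangent_space N) (h p)" "\<And>j. u j \<in> (tangent_space N) (h p)" for v u and I :: "'f set"
      using that by (induct I rule: infinite_finite_induct) (simp_all add: N.g_02 N.g_add2 q N.TS_vsum)
    have "b (h p) * b (h p) * g' (h p) (S p) (R p) = g' (h p) (b (h p) *\<^sub>R S p) (b (h p) *\<^sub>R R p)"
      using SR q by (simp add: N.g_scale N.g_scale2 N.TS_scale)
    also have "\<dots> = (\<Sum>i\<in>Basis. \<Sum>j\<in>Basis. g' (h p) (S p (x i) *\<^sub>R E i (h p)) (R p (x j) *\<^sub>R E j (h p)))"
      unfolding *[OF q SR(1)] *[OF q SR(2)]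
      using q E' by (simp add: N.g_sum gsum2 N.TS_scale N.TS_vsum)
    also have "\<dots> = (\<Sum>i\<in>Basis. \<Sum>j\<in>Basis. G i j p)"
      using q E' by (simp add: G_def N.g_scale N.g_scale2 N.TS_scale mult_ac)
    finally show ?thesis .
  qed
  define H where "H p = (\<Sum>i\<in>Basis. \<Sum>j\<in>Basis. G i j p)" for p
  have H: "H \<in> smooth_funs M" unfolding H_def by (rule M.CF_sum, rule M.CF_sum, rule G)
  have b2: "(\<lambda>p. b (h p) * b (h p)) \<in> smooth_funs M" by (rule M.CF_mult[OF pullback[OF b(1)] pullback[OF b(1)]])
  have "(\<lambda>p. b (h p) * b (h p) * g' (h p) (S p) (R p)) \<in> smooth_funs M"
    by (rule M.CF_points_cong[OF H]) (simp add: eq H_def)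
  then show "\<exists>b\<in>smooth_funs M. b p0 \<noteq> 0 \<and> (\<lambda>q. b q * g' (h q) (S q) (R q)) \<in> smooth_funs M"
    using b2 b(2) by (intro bexI[of _ "\<lambda>p. b (h p) * b (h p)"]) auto
qed

end

locale submersion = M: riemannian_connection M g D + metric_map M M' \<pi> g'
  for M :: "('a, 'e::euclidean_space) manifold" and g D
    and M' :: "('b, 'f::euclidean_space) manifold" and g' \<pi> +
  assumes submersion: "riemannian_submersion M g M' g' \<pi>"
begin

abbreviation "CF \<equiv> smooth_funs M"
abbreviation "TS \<equiv> tangent_space M"
abbreviation "VF \<equiv> vector_fields M"
abbreviation "CF' \<equiv> smooth_funs M'"
abbreviation "TS' \<equiv> tangent_space M'"
abbreviation "VF' \<equiv> vector_fields M'"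
abbreviation "VS \<equiv> vertical_space M M' \<pi>"
abbreviation "HS \<equiv> horizontal_space M M' \<pi> g"
abbreviation "VV \<equiv> vertical_fields M M' \<pi>"
abbreviation "HV \<equiv> horizontal_fields M M' \<pi> g"

lemma push_0: "push 0 = 0" and push_diff: "push (u - v) = push u - push v" and push_neg: "push (- u) = - push u"
  using linear_0[OF linear_push] linear_diff[OF linear_push] linear_neg[OF linear_push] by auto

lemma push_surj: "p \<in> points M \<Longrightarrow> s \<in> TS' (\<pi> p) \<Longrightarrow> \<exists>u\<in>TS p. push u = s"
proof -
  assume "p \<in> points M" "s \<in> TS' (\<pi> p)"
  then have "s \<in> push ` TS p" using submersion by (simp add: riemannian_submersion_def)
  then show ?thesis by (elim imageE) blast
qed

text \<open>The differential of a submersion is surjective by definition as a map of derivations; charts translate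
  this into the surjectivity of the ordinary derivative.\<close>

lemma push_chart_surj:
  assumes c: "(U, c) \<in> atlas M" "p \<in> U" and c': "(V, c') \<in> atlas M'" "\<pi> p \<in> V"
  shows "surj (frechet_derivative (\<lambda>x. c' (\<pi> (inv_into U c x))) (at (c p)))" (is "surj ?B")
proof -
  have p: "p \<in> points M" using M.chart_subset[OF c(1)] c(2) by blast
  have "y \<in> range ?B" for y
  proof -
    obtain u where u: "u \<in> TS p" "push u = N.chart_vec V c' (\<pi> p) y"
      using push_surj[OF p N.chart_vec_TS[OF c']] by blast
    obtain w where w: "u = M.chart_vec U c p w" using u(1) M.TS_eq_chart_vec[OF c] by blast
    have "?B w = y"
      by (rule injD[OF N.chart_vec_inj[OF c']]) (simp only: push_chart_vec[OF c c', symmetric] w[symmetric] u(2))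
    then show ?thesis by blast
  qed
  then show ?thesis by blast
qed

lemma push_isometry: "p \<in> points M \<Longrightarrow> u \<in> HS p \<Longrightarrow> v \<in> HS p \<Longrightarrow> g' (\<pi> p) (push u) (push v) = g p u v"
  using submersion unfolding riemannian_submersion_def by blast

lemma base_point: assumes "q \<in> points M'" obtains p where "p \<in> points M" "\<pi> p = q"
proof -
  have "q \<in> \<pi> ` points M" using submersion assms by (simp add: riemannian_submersion_def)
  then show thesis by (elim imageE) (rule that, simp_all)
qed

lemma VS_D: "v \<in> VS p \<Longrightarrow> v \<in> TS p" "v \<in> VS p \<Longrightarrow> push v = 0"
  and VS_I: "v \<in> TS p \<Longrightarrow> push v = 0 \<Longrightarrow> v \<in> VS p"
  by (auto simp: vertical_space_def)

lemma HS_D: "u \<in> HS p \<Longrightarrow> u \<in> TS p" "u \<in> HS p \<Longrightarrow> v \<in> VS p \<Longrightarrow> g p u v = 0"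
  and HS_I: "u \<in> TS p \<Longrightarrow> (\<And>v. v \<in> VS p \<Longrightarrow> g p u v = 0) \<Longrightarrow> u \<in> HS p"
  by (auto simp: horizontal_space_def)

lemma HS_D2: "p \<in> points M \<Longrightarrow> u \<in> HS p \<Longrightarrow> v \<in> VS p \<Longrightarrow> g p v u = 0"
  using HS_D VS_D M.g_sym by metis

lemma subspace_VS: "subspace (VS p)"
  by (rule subspaceI) (auto intro!: VS_I simp: push_0 push_add push_scale VS_D M.TS_0 M.TS_add M.TS_scale)

lemma subspace_HS: assumes "p \<in> points M" shows "subspace (HS p)"
  by (rule subspaceI) (auto intro!: HS_I simp: HS_D VS_D M.TS_0 M.TS_add M.TS_scale M.g_0 M.g_add M.g_scale assms)

lemma VS_HS_0: assumes "p \<in> points M" "u \<in> VS p" "u \<in> HS p" shows "u = 0"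
  using M.g_pos[OF assms(1) VS_D(1)[OF assms(2)]] HS_D(2)[OF assms(3,2)] by fastforce

text \<open>The pointwise adjoint of the differential. It is the horizontal lift, since the differential is
  isometric on horizontal vectors.\<close>

lemma adjoint_exists:
  assumes S: "along S"
  obtains X where "X \<in> VF" "\<And>p v. p \<in> points M \<Longrightarrow> v \<in> TS p \<Longrightarrow> g p (X p) v = g' (\<pi> p) (S p) (push v)"
proof -
  have Sp: "S p \<in> TS' (\<pi> p)" if "p \<in> points M" for p using S that by (auto simp: along_def)
  have "form1_field M (\<lambda>p v. g' (\<pi> p) (S p) (push v))"
    unfolding form1_field_def form1_apply_def
    using along_metric[OF S along_push] Sp
    by (auto simp: push_add push_scale N.g_add2 N.g_scale2 maps_points push_TS)
  then show thesis by (rule M.sharp) (rule that)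
qed

text \<open>Let \<open>A\<close> be the adjoint of the differential at \<open>p\<close>. Its values are orthogonal to the kernel of the
  differential, and it is injective as the differential is surjective. So the composite of \<open>A\<close> with the
  differential is an injective endomorphism of the tangent space of the base, hence bijective. Thus
  horizontal vectors attain all values, and the isometry condition identifies the composite with the
  identity.\<close>

lemma adjoint_pointwise:
  assumes p: "p \<in> points M" and s: "s \<in> TS' (\<pi> p)"
  shows "\<exists>u\<in>HS p. push u = s \<and> (\<forall>v\<in>TS p. g p u v = g' (\<pi> p) s (push v))"
proof -
  note q = maps_points[OF p]
  have ex: "\<exists>u\<in>TS p. \<forall>v\<in>TS p. g p u v = g' (\<pi> p) s (push v)" if s: "s \<in> TS' (\<pi> p)" for s
  proof -
    obtain Z where Z: "Z \<in> VF'" "Z (\<pi> p) = s" using N.VF_extend[OF q s] by blast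
    obtain X where X: "X \<in> VF" "\<And>p v. p \<in> points M \<Longrightarrow> v \<in> TS p \<Longrightarrow> g p (X p) v = g' (\<pi> p) (Z (\<pi> p)) (push v)"
      by (rule adjoint_exists[OF along_base[OF Z(1)]]) (rule that)
    show ?thesis using X(2)[OF p] M.VF_TS[OF X(1) p] Z(2) by (intro bexI[of _ "X p"]) auto
  qed
  then obtain A where A: "\<And>s. s \<in> TS' (\<pi> p) \<Longrightarrow> A s \<in> TS p"
    "\<And>s v. s \<in> TS' (\<pi> p) \<Longrightarrow> v \<in> TS p \<Longrightarrow> g p (A s) v = g' (\<pi> p) s (push v)"
    by metis
  have AH: "A s \<in> HS p" if "s \<in> TS' (\<pi> p)" for s
    using A that by (intro HS_I) (auto simp: VS_D N.g_02 q)
  have add: "A (s + t) = A s + A t" if "s \<in> TS' (\<pi> p)" "t \<in> TS' (\<pi> p)" for s t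
    by (rule M.g_eqI[OF p]) (simp_all add: A that N.TS_add M.TS_add M.g_add p N.g_add q push_TS)
  have scale: "A (a *\<^sub>R s) = a *\<^sub>R A s" if "s \<in> TS' (\<pi> p)" for s a
    by (rule M.g_eqI[OF p]) (simp_all add: A that N.TS_scale M.TS_scale M.g_scale p N.g_scale q push_TS)
  have inj: "s = 0" if s: "s \<in> TS' (\<pi> p)" and 0: "push (A s) = 0" for s
  proof -
    have A0: "A s = 0" by (rule VS_HS_0[OF p VS_I[OF A(1)[OF s] 0] AH[OF s]])
    show ?thesis
    proof (rule N.g_eqI[OF q s N.TS_0])
      fix w assume w: "w \<in> TS' (\<pi> p)"
      then obtain v where "v \<in> TS p" "push v = w" using push_surj[OF p] by blast
      then show "g' (\<pi> p) s w = g' (\<pi> p) 0 w" using A(2)[OF s, of v] A0 w by (simp add: M.g_0 p N.g_0 q)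
    qed
  qed
  have surj: "\<exists>u\<in>HS p. push u = t" if t: "t \<in> TS' (\<pi> p)" for t
  proof -
    have "\<exists>s\<in>TS' (\<pi> p). push (A s) = t"
      by (rule N.TS_injective_imp_surjective[OF q _ _ _ inj t])
        (simp_all add: push_TS A add scale push_add push_scale)
    then show ?thesis using AH by blast
  qed
  have "push (A s) = s"
  proof (rule N.g_eqI[OF q push_TS[OF A(1)[OF s]] s])
    fix w assume "w \<in> TS' (\<pi> p)"
    then obtain v where v: "v \<in> HS p" "push v = w" using surj by blast
    show "g' (\<pi> p) (push (A s)) w = g' (\<pi> p) s w"
      using push_isometry[OF p AH[OF s] v(1)] A(2)[OF s HS_D(1)[OF v(1)]] v(2) by simp
  qed
  then show ?thesis using AH[OF s] A(2)[OF s] by blast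
qed

lemma adjoint_lift:
  assumes p: "p \<in> points M" and s: "s \<in> TS' (\<pi> p)" and u: "u \<in> TS p"
    and a: "\<And>v. v \<in> TS p \<Longrightarrow> g p u v = g' (\<pi> p) s (push v)"
  shows "u \<in> HS p" "push u = s"
proof -
  obtain w where w: "w \<in> HS p" "push w = s" "\<forall>v\<in>TS p. g p w v = g' (\<pi> p) s (push v)"
    using adjoint_pointwise[OF p s] by blast
  have "u = w" by (rule M.g_eqI[OF p u HS_D(1)[OF w(1)]]) (use a w(3) in auto)
  then show "u \<in> HS p" "push u = s" using w by auto
qed

text \<open>The vertical part of \<open>u\<close> contributes to neither side.\<close>

lemma metric_horizontal:
  assumes p: "p \<in> points M" and u: "u \<in> TS p" and w: "w \<in> HS p"
  shows "g p u w = g' (\<pi> p) (push u) (push w)"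
proof -
  obtain h where h: "h \<in> HS p" "push h = push u" using adjoint_pointwise[OF p push_TS[OF u]] by blast
  have v: "u - h \<in> VS p" using h by (intro VS_I M.TS_minus u HS_D) (simp_all add: push_diff)
  have "g p u w = g p ((u - h) + h) w" by simp
  also have "\<dots> = g p h w"
    using HS_D2[OF p w v] VS_D(1)[OF v] HS_D(1)[OF h(1)] HS_D(1)[OF w] by (simp only: M.g_add[OF p] add_0)
  finally show ?thesis using push_isometry[OF p h(1) w] h(2) by simp
qed

lemma HS_eqI:
  assumes p: "p \<in> points M" and "u \<in> HS p" "w \<in> HS p" "push u = push w"
  shows "u = w"
proof -
  have "u - w \<in> HS p" using subspace_diff[OF subspace_HS[OF p]] assms by blast
  moreover have "u - w \<in> VS p" using assms HS_D(1) by (intro VS_I M.TS_minus) (auto simp: push_diff)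
  ultimately show ?thesis using VS_HS_0[OF p] by fastforce
qed

text \<open>\<open>X\<close> is the horizontal lift of \<open>X'\<close>; such fields are called basic.\<close>

definition lifts :: "'a vfield \<Rightarrow> 'b vfield \<Rightarrow> bool" where
  "lifts X X' \<longleftrightarrow> X \<in> VF \<and> X' \<in> VF' \<and> (\<forall>p\<in>points M. X p \<in> HS p \<and> push (X p) = X' (\<pi> p))"

lemma lifts_D:
  assumes "lifts X X'"
  shows "X \<in> VF" "X' \<in> VF'" "\<And>p. p \<in> points M \<Longrightarrow> X p \<in> HS p" "\<And>p. p \<in> points M \<Longrightarrow> push (X p) = X' (\<pi> p)"
  using assms by (auto simp: lifts_def)

lemma lift_exists: assumes X': "X' \<in> VF'" shows "\<exists>X. lifts X X'"
proof -
  obtain X where X: "X \<in> VF" "\<And>p v. p \<in> points M \<Longrightarrow> v \<in> TS p \<Longrightarrow> g p (X p) v = g' (\<pi> p) (X' (\<pi> p)) (push v)"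
    by (rule adjoint_exists[OF along_base[OF X']]) (rule that)
  have "X p \<in> HS p" "push (X p) = X' (\<pi> p)" if p: "p \<in> points M" for p
    using adjoint_lift[OF p N.VF_TS[OF X' maps_points[OF p]] M.VF_TS[OF X(1) p] X(2)[OF p]] by auto
  then show ?thesis using X(1) X' by (auto simp: lifts_def)
qed

text \<open>Every horizontal vector belongs to a basic field.\<close>

lemma lift_through:
  assumes p: "p \<in> points M" and u: "u \<in> HS p"
  shows "\<exists>X X'. lifts X X' \<and> X p = u"
proof -
  obtain X' where X': "X' \<in> VF'" "X' (\<pi> p) = push u"
    using N.VF_extend[OF maps_points[OF p] push_TS[OF HS_D(1)[OF u]]] by blast
  obtain X where X: "lifts X X'" using lift_exists[OF X'(1)] by blast
  have "X p = u" by (rule HS_eqI[OF p lifts_D(3)[OF X p] u]) (simp add: lifts_D(4)[OF X p] X')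
  then show ?thesis using X by blast
qed

lemma hproj_field:
  assumes E: "E \<in> VF"
  obtains X where "X \<in> VF" "\<And>p. p \<in> points M \<Longrightarrow> X p \<in> HS p" "\<And>p. p \<in> points M \<Longrightarrow> E p - X p \<in> VS p"
proof -
  obtain X where X: "X \<in> VF" "\<And>p v. p \<in> points M \<Longrightarrow> v \<in> TS p \<Longrightarrow> g p (X p) v = g' (\<pi> p) (push (E p)) (push v)"
    by (rule adjoint_exists[OF along_push[OF E]]) (rule that)
  have *: "X p \<in> HS p" "push (X p) = push (E p)" if p: "p \<in> points M" for p
    using adjoint_lift[OF p push_TS[OF M.VF_TS[OF E p]] M.VF_TS[OF X(1) p] X(2)[OF p]] by auto
  have "E p - X p \<in> VS p" if p: "p \<in> points M" for p
    using * p M.VF_TS[OF E p] M.VF_TS[OF X(1) p] by (intro VS_I M.TS_minus) (auto simp: push_diff)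
  then show thesis using that[OF X(1)] * by blast
qed

lemma vproj_eqI:
  assumes p: "p \<in> points M" and v: "v \<in> VS p" "E p - v \<in> HS p"
  shows "vproj M M' \<pi> g E p = v"
proof -
  have "(THE v. v \<in> VS p \<and> E p - v \<in> HS p) = v"
  proof (rule the_equality)
    fix w assume w: "w \<in> VS p \<and> E p - w \<in> HS p"
    have "w - v \<in> VS p" using subspace_diff[OF subspace_VS] w v by blast
    moreover have "(E p - v) - (E p - w) \<in> HS p" using subspace_diff[OF subspace_HS[OF p]] w v by blast
    then have "w - v \<in> HS p" by simp
    ultimately show "w = v" using VS_HS_0[OF p] by fastforce
  qed (use v in simp)
  then show ?thesis using p by (simp add: vproj_def)
qed

text \<open>The orthogonal projections preserve smoothness: the horizontal part of \<open>E\<close> is the adjoint of the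
  differential applied to the projected field.\<close>

lemma vproj_VF:
  assumes E: "E \<in> VF"
  shows "vproj M M' \<pi> g E \<in> VF" "hproj M M' \<pi> g E \<in> VF"
    "\<And>p. p \<in> points M \<Longrightarrow> vproj M M' \<pi> g E p \<in> VS p" "\<And>p. p \<in> points M \<Longrightarrow> hproj M M' \<pi> g E p \<in> HS p"
proof -
  obtain X where X: "X \<in> VF" "\<And>p. p \<in> points M \<Longrightarrow> X p \<in> HS p" "\<And>p. p \<in> points M \<Longrightarrow> E p - X p \<in> VS p"
    by (rule hproj_field[OF E]) (rule that)
  have "vproj M M' \<pi> g E = E - X"
  proof
    fix p show "vproj M M' \<pi> g E p = (E - X) p"
    proof (cases "p \<in> points M")
      case True
      then show ?thesis using X by (simp add: vproj_eqI[of p "E p - X p"])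
    next
      case False
      then show ?thesis using M.VF_outside[OF E False] M.VF_outside[OF X(1) False] by (simp add: vproj_def)
    qed
  qed
  then have *: "vproj M M' \<pi> g E = E - X" "hproj M M' \<pi> g E = X" by (auto simp: hproj_def)
  show "vproj M M' \<pi> g E \<in> VF" "hproj M M' \<pi> g E \<in> VF"
    unfolding * by (rule M.VF_diff[OF E X(1)], rule X(1))
  show "vproj M M' \<pi> g E p \<in> VS p" "hproj M M' \<pi> g E p \<in> HS p" if "p \<in> points M" for p
    unfolding * using X(2,3)[OF that] by auto
qed

lemma hproj_eqI:
  assumes p: "p \<in> points M" and u: "u \<in> HS p" "E p - u \<in> VS p"
  shows "hproj M M' \<pi> g E p = u"
  using vproj_eqI[OF p u(2), where E = E] u(1) by (simp add: hproj_def)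

lemma vertical_fields_D:
  assumes "U \<in> vertical_fields M M' \<pi>"
  shows "U \<in> VF" "\<And>p. p \<in> points M \<Longrightarrow> U p \<in> VS p"
  using assms by (auto simp: vertical_fields_def)

lemma horizontal_fields_D:
  assumes "X \<in> horizontal_fields M M' \<pi> g"
  shows "X \<in> VF" "\<And>p. p \<in> points M \<Longrightarrow> X p \<in> HS p"
  using assms by (auto simp: horizontal_fields_def)

lemma vproj_vertical: assumes U: "U \<in> vertical_fields M M' \<pi>"
  shows "vproj M M' \<pi> g U = U" "hproj M M' \<pi> g U = 0"
proof -
  show *: "vproj M M' \<pi> g U = U"
  proof (rule M.VF_eqI[OF vproj_VF(1)])
    fix p assume p: "p \<in> points M"
    show "vproj M M' \<pi> g U p = U p"
      by (rule vproj_eqI[OF p vertical_fields_D(2)[OF U p]]) (simp add: subspace_0[OF subspace_HS[OF p]])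
  qed (use vertical_fields_D[OF U] in auto)
  show "hproj M M' \<pi> g U = 0" by (simp add: hproj_def *)
qed

text \<open>The second summand in the definition of \<open>T\<close> differentiates the horizontal part of \<open>V\<close>, which is \<open>0\<close>.\<close>

lemma oneill_T_vertical:
  assumes U: "U \<in> vertical_fields M M' \<pi>" and V: "V \<in> vertical_fields M M' \<pi>"
  shows "oneill_T M M' \<pi> g D U V = hproj M M' \<pi> g (D U V)"
proof -
  have 0: "0 \<in> vertical_fields M M' \<pi>"
    by (auto simp: vertical_fields_def M.VF_0 subspace_0[OF subspace_VS])
  show ?thesis
    unfolding oneill_T_def vproj_vertical[OF U] vproj_vertical[OF V] M.D_0[OF vertical_fields_D(1)[OF U]]
      vproj_vertical(1)[OF 0] by simp
qed


lemma lifts_apply: "lifts X X' \<Longrightarrow> p \<in> points M \<Longrightarrow> f \<in> CF' \<Longrightarrow> X p (\<lambda>q. f (\<pi> q)) = X' (\<pi> p) f"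
  using lifts_D(4) push_apply by metis

lemma vertical_apply: "v \<in> VS p \<Longrightarrow> f \<in> CF' \<Longrightarrow> v (\<lambda>q. f (\<pi> q)) = 0"
  using VS_D(2) push_apply by (metis zero_fun_apply)

lemma lifts_bracket:
  assumes X: "lifts X X'" and Y: "lifts Y Y'" and p: "p \<in> points M"
  shows "push (lie_bracket X Y p) = lie_bracket X' Y' (\<pi> p)"
proof
  fix f
  show "push (lie_bracket X Y p) f = lie_bracket X' Y' (\<pi> p) f"
  proof (cases "f \<in> CF'")
    case True
    have 1: "Z p (\<lambda>q. W q (\<lambda>q. f (\<pi> q))) = Z' (\<pi> p) (\<lambda>r. W' r f)" if Z: "lifts Z Z'" and W: "lifts W W'" for Z Z' W W'
    proof -
      have "Z p (\<lambda>q. W q (\<lambda>q. f (\<pi> q))) = Z p (\<lambda>q. W' (\<pi> q) f)"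
        by (rule M.TS_cong[OF p M.VF_TS[OF lifts_D(1)[OF Z] p] M.VF_CF[OF lifts_D(1)[OF W] pullback[OF True]]
              pullback[OF N.VF_CF[OF lifts_D(2)[OF W] True]]]) (rule lifts_apply[OF W _ True])
      also have "\<dots> = Z' (\<pi> p) (\<lambda>r. W' r f)" by (rule lifts_apply[OF Z p N.VF_CF[OF lifts_D(2)[OF W] True]])
      finally show ?thesis .
    qed
    show ?thesis using 1[OF X Y] 1[OF Y X] by (simp add: push_apply True lie_bracket_def)
  next
    case False
    then show ?thesis
      using N.VF_zero_fun[OF N.VF_lie_bracket[OF lifts_D(2)[OF X] lifts_D(2)[OF Y]] False]
      by (simp add: pushforward_def)
  qed
qed

lemma lifts_vertical_bracket:
  assumes X: "lifts X X'" and U: "U \<in> vertical_fields M M' \<pi>" and p: "p \<in> points M"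
  shows "lie_bracket X U p \<in> VS p"
proof (rule VS_I)
  note XV = lifts_D(1)[OF X] and UV = vertical_fields_D(1)[OF U]
  show "lie_bracket X U p \<in> TS p" using M.VF_TS[OF M.VF_lie_bracket[OF XV UV] p] .
  show "push (lie_bracket X U p) = 0"
  proof
    fix f
    show "push (lie_bracket X U p) f = 0 f"
    proof (cases "f \<in> CF'")
      case True
      have "X p (\<lambda>q. U q (\<lambda>q. f (\<pi> q))) = X p (\<lambda>q. 0)"
        by (rule M.TS_cong[OF p M.VF_TS[OF XV p] M.VF_CF[OF UV pullback[OF True]] M.CF_const])
          (rule vertical_apply[OF vertical_fields_D(2)[OF U] True])
      also have "\<dots> = 0" by (rule M.TS_const[OF M.VF_TS[OF XV p]])
      finally have 1: "X p (\<lambda>q. U q (\<lambda>q. f (\<pi> q))) = 0" .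
      have "U p (\<lambda>q. X q (\<lambda>q. f (\<pi> q))) = U p (\<lambda>q. X' (\<pi> q) f)"
        by (rule M.TS_cong[OF p M.VF_TS[OF UV p] M.VF_CF[OF XV pullback[OF True]] pullback[OF N.VF_CF[OF lifts_D(2)[OF X] True]]])
          (rule lifts_apply[OF X _ True])
      also have "\<dots> = 0" by (rule vertical_apply[OF vertical_fields_D(2)[OF U p] N.VF_CF[OF lifts_D(2)[OF X] True]])
      finally show ?thesis using 1 by (simp add: push_apply True lie_bracket_def)
    qed (simp add: pushforward_def)
  qed
qed

lemma metric_lifts:
  assumes X: "lifts X X'" and Y: "lifts Y Y'" and p: "p \<in> points M"
  shows "g p (X p) (Y p) = g' (\<pi> p) (X' (\<pi> p)) (Y' (\<pi> p))"
  using metric_horizontal[OF p HS_D(1)[OF lifts_D(3)[OF X p]] lifts_D(3)[OF Y p]] lifts_D(4)[OF X p] lifts_D(4)[OF Y p] by simp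

lemma koszul_lifts:
  assumes X: "lifts X X'" and Y: "lifts Y Y'" and Z: "lifts Z Z'" and p: "p \<in> points M"
  shows "M.koszul X Y Z p = N.koszul X' Y' Z' (\<pi> p)"
proof -
  have 1: "A p (\<lambda>q. g q (B q) (C q)) = A' (\<pi> p) (\<lambda>r. g' r (B' r) (C' r))"
    if A: "lifts A A'" and B: "lifts B B'" and C: "lifts C C'" for A A' B B' C C'
  proof -
    note cf = N.g_CF[OF lifts_D(2)[OF B] lifts_D(2)[OF C]]
    have "A p (\<lambda>q. g q (B q) (C q)) = A p (\<lambda>q. g' (\<pi> q) (B' (\<pi> q)) (C' (\<pi> q)))"
      by (rule M.TS_cong[OF p M.VF_TS[OF lifts_D(1)[OF A] p] M.g_CF[OF lifts_D(1)[OF B] lifts_D(1)[OF C]] pullback[OF cf]])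
        (rule metric_lifts[OF B C])
    also have "\<dots> = A' (\<pi> p) (\<lambda>r. g' r (B' r) (C' r))" by (rule lifts_apply[OF A p cf])
    finally show ?thesis .
  qed
  have 2: "g p (lie_bracket A B p) (C p) = g' (\<pi> p) (lie_bracket A' B' (\<pi> p)) (C' (\<pi> p))"
    if A: "lifts A A'" and B: "lifts B B'" and C: "lifts C C'" for A A' B B' C C'
    using metric_horizontal[OF p M.VF_TS[OF M.VF_lie_bracket[OF lifts_D(1)[OF A] lifts_D(1)[OF B]] p] lifts_D(3)[OF C p]]
    by (simp only: lifts_bracket[OF A B p] lifts_D(4)[OF C p])
  show ?thesis
    unfolding M.koszul_def N.koszul_def
    by (simp only: 1[OF X Y Z] 1[OF Y X Z] 1[OF Z X Y] 2[OF X Y Z] 2[OF X Z Y] 2[OF Y Z X])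
qed

text \<open>All six terms of the Koszul expression of three horizontal lifts are pulled back from the base.\<close>

lemma push_connection:
  assumes D': "levi_civita M' g' D'" and X: "lifts X X'" and Y: "lifts Y Y'" and p: "p \<in> points M"
  shows "push (D X Y p) = D' X' Y' (\<pi> p)"
proof (rule N.g_eqI_VF[OF maps_points[OF p]])
  interpret N': riemannian_connection M' g' D' by unfold_locales (rule D')
  note DT = M.D_TS[OF lifts_D(1)[OF X] lifts_D(1)[OF Y] p]
  show "push (D X Y p) \<in> TS' (\<pi> p)" by (rule push_TS[OF DT])
  show "D' X' Y' (\<pi> p) \<in> TS' (\<pi> p)" by (rule N'.D_TS[OF lifts_D(2)[OF X] lifts_D(2)[OF Y] maps_points[OF p]])
  fix Z' assume Z': "Z' \<in> VF'"
  obtain Z where Z: "lifts Z Z'" using lift_exists[OF Z'] by blast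
  have "2 * g' (\<pi> p) (push (D X Y p)) (Z' (\<pi> p)) = 2 * g p (D X Y p) (Z p)"
    using metric_horizontal[OF p DT lifts_D(3)[OF Z p]] lifts_D(4)[OF Z p] by simp
  also have "\<dots> = 2 * g' (\<pi> p) (D' X' Y' (\<pi> p)) (Z' (\<pi> p))"
    unfolding M.koszul_formula[OF M.levi_civita lifts_D(1)[OF X] lifts_D(1)[OF Y] lifts_D(1)[OF Z] p]
      N.koszul_formula[OF D' lifts_D(2)[OF X] lifts_D(2)[OF Y] Z' maps_points[OF p]]
    by (rule koszul_lifts[OF X Y Z p])
  finally show "g' (\<pi> p) (push (D X Y p)) (Z' (\<pi> p)) = g' (\<pi> p) (D' X' Y' (\<pi> p)) (Z' (\<pi> p))" by simp
qed


text \<open>As \<open>g(Y, U) = 0\<close>, the vertical component of \<open>\<nabla>\<^sub>XY\<close> along \<open>U\<close> involves no derivative of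
  \<open>Y\<close>, and therefore depends only on the values of \<open>X\<close> and \<open>Y\<close> at the point.\<close>

lemma horizontal_component_tensorial:
  assumes X: "X \<in> horizontal_fields M M' \<pi> g" and Y: "Y \<in> horizontal_fields M M' \<pi> g"
    and U: "U \<in> vertical_fields M M' \<pi>" and p: "p \<in> points M"
  shows "g p (D X Y p) (U p) = - g p (Y p) (D X U p)"
proof -
  note v = horizontal_fields_D(1)[OF X] horizontal_fields_D(1)[OF Y] vertical_fields_D(1)[OF U]
  have "X p (\<lambda>q. g q (Y q) (U q)) = X p (\<lambda>q. 0)"
    by (rule M.TS_cong[OF p M.VF_TS[OF v(1) p] M.g_CF[OF v(2,3)] M.CF_const])
      (rule HS_D(2)[OF horizontal_fields_D(2)[OF Y] vertical_fields_D(2)[OF U]])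
  also have "\<dots> = 0" by (rule M.TS_const[OF M.VF_TS[OF v(1) p]])
  finally show ?thesis using M.D_metric[OF v p] by simp
qed

lemma lifts_horizontal: "lifts X X' \<Longrightarrow> X \<in> horizontal_fields M M' \<pi> g"
  by (simp add: lifts_def horizontal_fields_def)

text \<open>The difference of \<open>\<nabla>\<^sub>UX\<close> and \<open>\<nabla>\<^sub>XU\<close> is a bracket of a basic and a vertical field, which is vertical.\<close>

lemma D_vertical_lift:
  assumes X: "lifts X X'" and Y: "lifts Y Y'" and U: "U \<in> vertical_fields M M' \<pi>" and p: "p \<in> points M"
  shows "g p (D U X p) (Y p) = - g p (D X Y p) (U p)"
proof -
  note v = lifts_D(1)[OF X] lifts_D(1)[OF Y] vertical_fields_D(1)[OF U]
  note T = M.VF_TS[OF v(2) p] M.D_TS[OF v(1,3) p] M.D_TS[OF v(3,1) p]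
  have "lie_bracket X U p = D X U p - D U X p" using fun_cong[OF M.D_torsion[OF v(1,3)], of p] by simp
  then have "g p (D X U p - D U X p) (Y p) = 0"
    using HS_D2[OF p lifts_D(3)[OF Y p] lifts_vertical_bracket[OF X U p]] by simp
  then have "g p (D U X p) (Y p) = g p (D X U p) (Y p)" by (simp add: M.g_diff p T)
  also have "\<dots> = g p (Y p) (D X U p)" by (rule M.g_sym[OF p T(2,1)])
  also have "\<dots> = - g p (D X Y p) (U p)"
    using horizontal_component_tensorial[OF lifts_horizontal[OF X] lifts_horizontal[OF Y] U p] by simp
  finally show ?thesis .
qed

text \<open>The function \<open>g(X, Y)\<close> is constant along the fibres, and its derivative along \<open>U\<close> is the
  symmetric part.\<close>

lemma lifts_antisymmetric:
  assumes X: "lifts X X'" and Y: "lifts Y Y'" and U: "U \<in> vertical_fields M M' \<pi>" and p: "p \<in> points M"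
  shows "g p (D X Y p) (U p) = - g p (D Y X p) (U p)"
proof -
  note v = lifts_D(1)[OF X] lifts_D(1)[OF Y] vertical_fields_D(1)[OF U]
  note cf = N.g_CF[OF lifts_D(2)[OF X] lifts_D(2)[OF Y]]
  have "U p (\<lambda>q. g q (X q) (Y q)) = U p (\<lambda>q. g' (\<pi> q) (X' (\<pi> q)) (Y' (\<pi> q)))"
    by (rule M.TS_cong[OF p M.VF_TS[OF v(3) p] M.g_CF[OF v(1,2)] pullback[OF cf]]) (rule metric_lifts[OF X Y])
  also have "\<dots> = 0" by (rule vertical_apply[OF vertical_fields_D(2)[OF U p] cf])
  finally have "g p (D U X p) (Y p) + g p (X p) (D U Y p) = 0" using M.D_metric[OF v(3,1,2) p] by simp
  moreover have "g p (X p) (D U Y p) = g p (D U Y p) (X p)"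
    by (rule M.g_sym[OF p M.VF_TS[OF v(1) p] M.D_TS[OF v(3,2) p]])
  ultimately show ?thesis using D_vertical_lift[OF X Y U p] D_vertical_lift[OF Y X U p] by simp
qed

end

section \<open>Contact-complex submersions from \<open>C\<^sub>1\<^sub>2\<close>-manifolds\<close>

locale almost_contact = riemannian M g for M :: "('a, 'e::euclidean_space) manifold" and g +
  fixes \<phi> :: "'a endo" and \<xi> :: "'a vfield" and \<eta> :: "'a form1"
  assumes acm: "acm_manifold M \<phi> \<xi> \<eta> g"
begin

abbreviation "\<Phi> \<equiv> endo_apply M \<phi>"

lemma phi_TS: "p \<in> points M \<Longrightarrow> u \<in> TS p \<Longrightarrow> \<phi> p u \<in> TS p"
  and phi_add: "p \<in> points M \<Longrightarrow> u \<in> TS p \<Longrightarrow> v \<in> TS p \<Longrightarrow> \<phi> p (u + v) = \<phi> p u + \<phi> p v"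
  and phi_scale: "p \<in> points M \<Longrightarrow> u \<in> TS p \<Longrightarrow> \<phi> p (a *\<^sub>R u) = a *\<^sub>R \<phi> p u"
  and phi_VF: "X \<in> VF \<Longrightarrow> \<Phi> X \<in> VF"
  and xi_VF: "\<xi> \<in> VF"
  and eta_add: "p \<in> points M \<Longrightarrow> u \<in> TS p \<Longrightarrow> v \<in> TS p \<Longrightarrow> \<eta> p (u + v) = \<eta> p u + \<eta> p v"
  and eta_scale: "p \<in> points M \<Longrightarrow> u \<in> TS p \<Longrightarrow> \<eta> p (a *\<^sub>R u) = a * \<eta> p u"
  and eta_CF: "X \<in> VF \<Longrightarrow> (\<lambda>p. \<eta> p (X p)) \<in> CF"
  and eta_xi: "p \<in> points M \<Longrightarrow> \<eta> p (\<xi> p) = 1"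
  and phi_phi: "p \<in> points M \<Longrightarrow> u \<in> TS p \<Longrightarrow> \<phi> p (\<phi> p u) = - u + \<eta> p u *\<^sub>R \<xi> p"
  and g_phi_phi: "p \<in> points M \<Longrightarrow> u \<in> TS p \<Longrightarrow> v \<in> TS p \<Longrightarrow>
    g p (\<phi> p u) (\<phi> p v) = g p u v - \<eta> p u * \<eta> p v"
  using acm by (auto simp: acm_manifold_def endo_field_def form1_field_def form1_apply_def)

lemma Phi_apply: "p \<in> points M \<Longrightarrow> \<Phi> X p = \<phi> p (X p)"
  by (simp add: endo_apply_def)

lemma xi_TS: "p \<in> points M \<Longrightarrow> \<xi> p \<in> TS p" by (rule VF_TS[OF xi_VF])

lemma phi_0: "p \<in> points M \<Longrightarrow> \<phi> p 0 = 0" using phi_scale[of p 0 0] by (simp add: TS_0)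
lemma eta_0: "p \<in> points M \<Longrightarrow> \<eta> p 0 = 0" using eta_scale[of p 0 0] by (simp add: TS_0)
lemma phi_neg: "p \<in> points M \<Longrightarrow> u \<in> TS p \<Longrightarrow> \<phi> p (- u) = - \<phi> p u" using phi_scale[of p u "-1"] by simp
lemma eta_neg: "p \<in> points M \<Longrightarrow> u \<in> TS p \<Longrightarrow> \<eta> p (- u) = - \<eta> p u" using eta_scale[of p u "-1"] by simp
lemma phi_diff: "p \<in> points M \<Longrightarrow> u \<in> TS p \<Longrightarrow> v \<in> TS p \<Longrightarrow> \<phi> p (u - v) = \<phi> p u - \<phi> p v"
  using phi_add[of p u "- v"] by (simp add: phi_neg TS_neg)
lemma eta_diff: "p \<in> points M \<Longrightarrow> u \<in> TS p \<Longrightarrow> v \<in> TS p \<Longrightarrow> \<eta> p (u - v) = \<eta> p u - \<eta> p v"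
  using eta_add[of p u "- v"] by (simp add: eta_neg TS_neg)

lemma xi_nz: "p \<in> points M \<Longrightarrow> \<xi> p \<noteq> 0" using eta_xi eta_0 by force

text \<open>Since \<open>\<phi>\<^sup>2\<xi> = 0\<close>, the vector \<open>\<phi>\<xi>\<close> is a multiple of \<open>\<xi>\<close>, with a coefficient whose square is \<open>0\<close>.\<close>

lemma phi_xi: assumes p: "p \<in> points M" shows "\<phi> p (\<xi> p) = 0"
proof -
  note x = xi_TS[OF p] and f = phi_TS[OF p xi_TS[OF p]]
  have 0: "\<phi> p (\<phi> p (\<xi> p)) = 0" using phi_phi[OF p x] eta_xi[OF p] by simp
  then have 1: "\<phi> p (\<xi> p) = \<eta> p (\<phi> p (\<xi> p)) *\<^sub>R \<xi> p" using phi_phi[OF p f] phi_0[OF p] by simp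
  have "\<eta> p (\<phi> p (\<xi> p)) *\<^sub>R \<phi> p (\<xi> p) = 0" using 0 phi_scale[OF p x] by (metis 1)
  then show ?thesis using 1 by (cases "\<eta> p (\<phi> p (\<xi> p)) = 0") auto
qed

text \<open>Computing \<open>\<phi>\<^sup>3u\<close> in two ways gives \<open>\<eta>(\<phi>u)\<xi> = 0\<close>.\<close>

lemma eta_phi: assumes p: "p \<in> points M" and u: "u \<in> TS p" shows "\<eta> p (\<phi> p u) = 0"
proof -
  note x = xi_TS[OF p] and f = phi_TS[OF p u]
  have "\<phi> p (\<phi> p (\<phi> p u)) = \<phi> p (- u + \<eta> p u *\<^sub>R \<xi> p)" by (simp only: phi_phi[OF p u])
  also have "\<dots> = - \<phi> p u"
    using phi_xi[OF p] by (simp add: phi_diff[OF p] phi_scale[OF p x] TS_scale u x)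
  finally have "\<eta> p (\<phi> p u) *\<^sub>R \<xi> p = 0" using phi_phi[OF p f] by simp
  then show ?thesis using xi_nz[OF p] by (metis scaleR_eq_0_iff)
qed

lemma eta_eq: assumes p: "p \<in> points M" and u: "u \<in> TS p" shows "g p u (\<xi> p) = \<eta> p u"
  using g_phi_phi[OF p u xi_TS[OF p]] phi_xi[OF p] eta_xi[OF p] g_02[OF p phi_TS[OF p u]] by simp

lemma eta_eq2: "p \<in> points M \<Longrightarrow> u \<in> TS p \<Longrightarrow> g p (\<xi> p) u = \<eta> p u"
  using eta_eq g_sym xi_TS by metis

lemma phi_skew:
  assumes p: "p \<in> points M" and u: "u \<in> TS p" and v: "v \<in> TS p"
  shows "g p (\<phi> p u) v = - g p u (\<phi> p v)"
proof -
  note f = phi_TS[OF p u] phi_TS[OF p v] and x = xi_TS[OF p]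
  have "g p (\<phi> p u) (- v + \<eta> p v *\<^sub>R \<xi> p) = g p u (\<phi> p v)"
    using g_phi_phi[OF p u f(2)] eta_phi[OF p v] phi_phi[OF p v] by simp
  then show ?thesis
    using eta_eq[OF p f(1)] eta_phi[OF p u] by (simp add: g_diff2 g_scale2 p f x v TS_scale)
qed

end

locale almost_contact_connection = riemannian_connection M g D + almost_contact M g \<phi> \<xi> \<eta>
  for M :: "('a, 'e::euclidean_space) manifold" and g D \<phi> \<xi> \<eta>
begin

text \<open>Both \<open>\<eta>(\<phi>Y)\<close> and \<open>g(\<xi>, \<phi>Y)\<close> vanish identically, and \<open>\<eta> = g(\<cdot>, \<xi>)\<close>. The right-hand side shows that
  \<open>(\<nabla>\<^sub>\<xi>\<eta>)(\<phi>Y)\<close> depends only on the value of \<open>Y\<close>.\<close>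

lemma D_xi_phi:
  assumes Y: "Y \<in> VF" and p: "p \<in> points M"
  shows "cov_form1 D \<eta> \<xi> (\<Phi> Y) p = g p (D \<xi> \<xi> p) (\<phi> p (Y p))"
proof -
  note x = VF_TS[OF xi_VF p] and f = VF_TS[OF phi_VF[OF Y] p]
  have eta0: "\<eta> q (\<Phi> Y q) = 0" if "q \<in> points M" for q
    using eta_phi[OF that VF_TS[OF Y that]] Phi_apply[OF that] by simp
  have "\<xi> p (\<lambda>q. \<eta> q (\<Phi> Y q)) = \<xi> p (\<lambda>q. 0)"
    by (rule TS_cong[OF p x eta_CF[OF phi_VF[OF Y]] CF_const]) (rule eta0)
  then have 1: "\<xi> p (form1_apply \<eta> (\<Phi> Y)) = 0" using TS_const[OF x] by (simp add: form1_apply_def)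
  have "\<xi> p (\<lambda>q. g q (\<xi> q) (\<Phi> Y q)) = \<xi> p (\<lambda>q. 0)"
  proof (rule TS_cong[OF p x g_CF[OF xi_VF phi_VF[OF Y]] CF_const])
    fix q assume q: "q \<in> points M"
    show "g q (\<xi> q) (\<Phi> Y q) = 0" using eta_eq2[OF q VF_TS[OF phi_VF[OF Y] q]] eta0[OF q] by simp
  qed
  then have "g p (D \<xi> \<xi> p) (\<Phi> Y p) + g p (\<xi> p) (D \<xi> (\<Phi> Y) p) = 0"
    using D_metric[OF xi_VF xi_VF phi_VF[OF Y] p] TS_const[OF x] by simp
  then show ?thesis
    using eta_eq2[OF p D_TS[OF xi_VF phi_VF[OF Y] p]] by (simp add: cov_form1_def 1 Phi_apply[OF p])
qed

text \<open>The negative of the right-hand side of the \<open>C\<^sub>1\<^sub>2\<close>-equation, with \<open>g(\<nabla>\<^sub>\<xi>\<xi>, \<phi>Y)\<close> in place of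
  \<open>(\<nabla>\<^sub>\<xi>\<eta>)(\<phi>Y)\<close>; in this form it visibly depends only on the values of \<open>X\<close> and \<open>Y\<close>.\<close>

definition C12_rhs :: "'a vfield \<Rightarrow> 'a vfield \<Rightarrow> 'a \<Rightarrow> 'a tvec" where
  "C12_rhs X Y p = \<eta> p (X p) *\<^sub>R
    (g p (D \<xi> \<xi> p) (\<phi> p (Y p)) *\<^sub>R \<xi> p + \<eta> p (Y p) *\<^sub>R \<phi> p (D \<xi> \<xi> p))"

lemma C12_rhs_eq:
  assumes "Y \<in> VF" "p \<in> points M"
  shows "(- (form1_apply \<eta> X \<odot> (cov_form1 D \<eta> \<xi> (\<Phi> Y) \<odot> \<xi> + form1_apply \<eta> Y \<odot> \<Phi> (D \<xi> \<xi>)))) p = - C12_rhs X Y p"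
  by (simp add: C12_rhs_def fun_scale_apply form1_apply_def Phi_apply[OF assms(2)] D_xi_phi[OF assms])

lemma cov_Phi_tensorial:
  assumes X: "X \<in> VF" "X' \<in> VF" "X p = X' p" and Y: "Y \<in> VF" "Y' \<in> VF" "Y p = Y' p" and p: "p \<in> points M"
  shows "cov_endo M D \<phi> X Y p = cov_endo M D \<phi> X' Y' p"
proof -
  have e: "cov_endo M D \<phi> A B p = D A (\<Phi> B) p - \<phi> p (D A B p)" for A B
    by (simp add: cov_endo_def Phi_apply[OF p])
  have Padd: "\<Phi> (A + B) = \<Phi> A + \<Phi> B" if "A \<in> VF" "B \<in> VF" for A B
    using that by (auto simp: endo_apply_def fun_eq_iff phi_add VF_TS)
  have Psc: "\<Phi> (f \<odot> A) = f \<odot> \<Phi> A" if "A \<in> VF" for A f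
    using that by (auto simp: endo_apply_def fun_eq_iff phi_scale VF_TS fun_scale_def)
  have "cov_endo M D \<phi> X Y p = cov_endo M D \<phi> X' Y p"
    unfolding e by (simp only: D_tensorial[OF X(1,2) phi_VF[OF Y(1)] p X(3)] D_tensorial[OF X(1,2) Y(1) p X(3)])
  also have "\<dots> = cov_endo M D \<phi> X' Y' p"
  proof (rule tensorial[OF p, of "\<lambda>Y. cov_endo M D \<phi> X' Y p"])
    fix A B assume A: "A \<in> VF" and B: "B \<in> VF"
    show "cov_endo M D \<phi> X' (A + B) p = cov_endo M D \<phi> X' A p + cov_endo M D \<phi> X' B p"
      unfolding e Padd[OF A B] D_add2[OF X(2) phi_VF[OF A] phi_VF[OF B]] D_add2[OF X(2) A B]
      by (simp add: phi_add[OF p D_TS[OF X(2) A p] D_TS[OF X(2) B p]])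
  next
    fix f A assume f: "f \<in> CF" and A: "A \<in> VF"
    show "cov_endo M D \<phi> X' (f \<odot> A) p = f p *\<^sub>R cov_endo M D \<phi> X' A p"
      unfolding e Psc[OF A] D_scale2[OF X(2) phi_VF[OF A] f] D_scale2[OF X(2) A f]
      by (simp add: fun_scale_apply phi_add[OF p] phi_scale[OF p] TS_scale VF_TS[OF A p] D_TS[OF X(2) A p]
          Phi_apply[OF p] scaleR_diff_right)
  qed (use Y in auto)
  finally show ?thesis .
qed

end

locale C12 = almost_contact_connection M g D \<phi> \<xi> \<eta>
  for M :: "('a, 'e::euclidean_space) manifold" and g D \<phi> \<xi> \<eta> +
  assumes C12: "C12_manifold M \<phi> \<xi> \<eta> g"
begin

text \<open>The connection in the definition of a \<open>C\<^sub>1\<^sub>2\<close>-manifold is the given one by uniqueness.\<close>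

lemma C12_equation:
  assumes X: "X \<in> VF" and Y: "Y \<in> VF" and p: "p \<in> points M"
  shows "D X (\<Phi> Y) p = \<phi> p (D X Y p) -
    \<eta> p (X p) *\<^sub>R (g p (D \<xi> \<xi> p) (\<phi> p (Y p)) *\<^sub>R \<xi> p + \<eta> p (Y p) *\<^sub>R \<phi> p (D \<xi> \<xi> p))"
proof -
  obtain D' where D': "levi_civita M g D'" and eq: "cov_endo M D' \<phi> X Y =
      - (form1_apply \<eta> X \<odot> (cov_form1 D' \<eta> \<xi> (\<Phi> Y) \<odot> \<xi> + form1_apply \<eta> Y \<odot> \<Phi> (D' \<xi> \<xi>)))"
    using C12 X Y unfolding C12_manifold_def by blast
  note u = levi_civita_unique[OF D' levi_civita]
  have "cov_form1 D' \<eta> \<xi> (\<Phi> Y) = cov_form1 D \<eta> \<xi> (\<Phi> Y)"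
    by (simp add: cov_form1_def u[OF xi_VF phi_VF[OF Y]])
  then have "cov_endo M D \<phi> X Y p =
      - (form1_apply \<eta> X \<odot> (cov_form1 D \<eta> \<xi> (\<Phi> Y) \<odot> \<xi> + form1_apply \<eta> Y \<odot> \<Phi> (D \<xi> \<xi>))) p"
    using eq by (simp add: cov_endo_def u[OF X phi_VF[OF Y]] u[OF X Y] u[OF xi_VF xi_VF])
  then show ?thesis
    by (simp add: cov_endo_def fun_scale_apply form1_apply_def Phi_apply[OF p] D_xi_phi[OF Y p] diff_eq_eq)
qed

end

locale C12_submersion = submersion M g D M' g' \<pi> + A: C12 M g D \<phi> \<xi> \<eta>
  for M :: "('a, 'e::euclidean_space) manifold" and g D
    and M' :: "('b, 'f::euclidean_space) manifold" and g' \<pi> \<phi> \<xi> \<eta> +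
  fixes J :: "'b endo"
  assumes contact: "contact_complex_submersion M \<phi> \<xi> \<eta> g M' J g' \<pi>"
begin

abbreviation "\<Phi> \<equiv> endo_apply M \<phi>"

lemma hermitian: "almost_hermitian M' J g'"
  and J_push: "p \<in> points M \<Longrightarrow> u \<in> TS p \<Longrightarrow> J (\<pi> p) (push u) = push (\<phi> p u)"
  using contact by (auto simp: contact_complex_submersion_def)

lemma J_VF: "X \<in> VF' \<Longrightarrow> endo_apply M' J X \<in> VF'"
  and J_J: "q \<in> points M' \<Longrightarrow> s \<in> TS' q \<Longrightarrow> J q (J q s) = - s"
  and J_scale: "q \<in> points M' \<Longrightarrow> s \<in> TS' q \<Longrightarrow> J q (a *\<^sub>R s) = a *\<^sub>R J q s"
  using hermitian by (auto simp: almost_hermitian_def endo_field_def)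

lemma J_0: "q \<in> points M' \<Longrightarrow> J q 0 = 0" using J_scale[of q 0 0] by (simp add: N.TS_0)

text \<open>As \<open>\<phi>\<xi> = 0\<close>, the projection of \<open>\<xi>\<close> is annihilated by \<open>J\<close>.\<close>

lemma xi_vertical: assumes p: "p \<in> points M" shows "\<xi> p \<in> VS p"
proof (rule VS_I[OF A.xi_TS[OF p]])
  note q = maps_points[OF p] and s = push_TS[OF A.xi_TS[OF p]]
  have "J (\<pi> p) (push (\<xi> p)) = 0" using J_push[OF p A.xi_TS[OF p]] A.phi_xi[OF p] push_0 by simp
  then show "push (\<xi> p) = 0" using J_J[OF q s] J_0[OF q] by simp
qed

lemma xi_VV: "\<xi> \<in> VV" using A.xi_VF xi_vertical by (simp add: vertical_fields_def)

lemma phi_vertical: assumes p: "p \<in> points M" and v: "v \<in> VS p" shows "\<phi> p v \<in> VS p"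
  using J_push[OF p VS_D(1)[OF v]] VS_D(2)[OF v] J_0[OF maps_points[OF p]] A.phi_TS[OF p VS_D(1)[OF v]]
  by (intro VS_I) simp_all

lemma phi_horizontal: assumes p: "p \<in> points M" and u: "u \<in> HS p" shows "\<phi> p u \<in> HS p"
proof (rule HS_I[OF A.phi_TS[OF p HS_D(1)[OF u]]])
  fix v assume v: "v \<in> VS p"
  show "g p (\<phi> p u) v = 0"
    using A.phi_skew[OF p HS_D(1)[OF u] VS_D(1)[OF v]] HS_D(2)[OF u phi_vertical[OF p v]] by simp
qed

lemma eta_horizontal: "p \<in> points M \<Longrightarrow> u \<in> HS p \<Longrightarrow> \<eta> p u = 0"
  using A.eta_eq[OF _ HS_D(1)] HS_D(2)[OF _ xi_vertical] by metis

lemma Phi_VV: "U \<in> VV \<Longrightarrow> \<Phi> U \<in> VV"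
  using A.phi_VF phi_vertical by (simp add: vertical_fields_def A.Phi_apply)

lemma Phi_HV: "X \<in> HV \<Longrightarrow> \<Phi> X \<in> HV"
  using A.phi_VF phi_horizontal by (simp add: horizontal_fields_def A.Phi_apply)

lemma Phi_lifts: assumes X: "lifts X X'" shows "lifts (\<Phi> X) (endo_apply M' J X')"
  unfolding lifts_def
proof (intro conjI ballI)
  show "\<Phi> X \<in> VF" "endo_apply M' J X' \<in> VF'" using A.phi_VF J_VF lifts_D[OF X] by blast+
  fix p assume p: "p \<in> points M"
  show "\<Phi> X p \<in> HS p" using phi_horizontal[OF p lifts_D(3)[OF X p]] A.Phi_apply[OF p] by simp
  show "push (\<Phi> X p) = endo_apply M' J X' (\<pi> p)"
    using J_push[OF p HS_D(1)[OF lifts_D(3)[OF X p]]] lifts_D(4)[OF X p] maps_points[OF p]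
    by (simp add: A.Phi_apply[OF p] endo_apply_def[of M'])
qed

lemma D_horizontal_Phi:
  assumes X: "X \<in> VF" "X p \<in> HS p" and Y: "Y \<in> VF" and p: "p \<in> points M"
  shows "D X (\<Phi> Y) p = \<phi> p (D X Y p)"
  using A.C12_equation[OF X(1) Y p] eta_horizontal[OF p X(2)] by simp

lemma Phi_Phi_horizontal: assumes X: "X \<in> HV" shows "\<Phi> (\<Phi> X) = - X"
proof (rule M.VF_eqI)
  note x = horizontal_fields_D[OF X]
  show "\<Phi> (\<Phi> X) \<in> VF" "- X \<in> VF" using A.phi_VF M.VF_uminus x(1) by blast+
  fix p assume p: "p \<in> points M"
  show "\<Phi> (\<Phi> X) p = (- X) p"
    using A.phi_phi[OF p HS_D(1)[OF x(2)[OF p]]] eta_horizontal[OF p x(2)[OF p]] by (simp add: A.Phi_apply[OF p])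
qed

lemma D_uminus: "X \<in> VF \<Longrightarrow> Y \<in> VF \<Longrightarrow> D X (- Y) = - D X Y"
  using M.D_scale2[OF _ _ M.CF_const[of "-1"], of X Y] M.D_add2[of X Y "- Y"] M.D_0[of X] M.VF_uminus[of Y]
  by (simp add: eq_neg_iff_add_eq_0 add.commute)

text \<open>Up to sign, \<open>\<nabla>\<^sub>XY\<close> is \<open>\<nabla>\<^sub>X(\<phi>(\<phi>Y)) = \<phi>(\<nabla>\<^sub>X(\<phi>Y))\<close>, which lies in the image of \<open>\<phi>\<close>.\<close>

lemma eta_D_horizontal:
  assumes X: "X \<in> HV" and Y: "Y \<in> HV" and p: "p \<in> points M"
  shows "\<eta> p (D X Y p) = 0"
proof -
  note x = horizontal_fields_D[OF X] and y = horizontal_fields_D[OF Y] and y' = horizontal_fields_D[OF Phi_HV[OF Y]]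
  have "D X (\<Phi> (\<Phi> Y)) p = \<phi> p (D X (\<Phi> Y) p)" by (rule D_horizontal_Phi[OF x(1) x(2)[OF p] y'(1) p])
  then have "D X (\<Phi> (\<Phi> Y)) p = - D X Y p"
    unfolding Phi_Phi_horizontal[OF Y] D_uminus[OF x(1) y(1)] by simp
  moreover have "\<eta> p (D X (\<Phi> (\<Phi> Y)) p) = 0"
    using D_horizontal_Phi[OF x(1) x(2)[OF p] y'(1) p] A.eta_phi[OF p M.D_TS[OF x(1) y'(1) p]] by simp
  ultimately show ?thesis using A.eta_neg[OF p M.D_TS[OF x(1) y(1) p]] by simp
qed

text \<open>For basic fields, \<open>A\<^sub>X\<close> anticommutes past \<open>\<phi>\<close> by the \<open>C\<^sub>1\<^sub>2\<close>-equation in a vertical direction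
  annihilated by \<open>\<eta>\<close>, but commutes past it by the equation in horizontal directions.\<close>

lemma lifts_D_vertical_0:
  assumes X: "lifts X X'" and Y: "lifts Y Y'" and U: "U \<in> VV" and p: "p \<in> points M" and e: "\<eta> p (U p) = 0"
  shows "g p (D X Y p) (U p) = 0"
proof -
  note fX = Phi_lifts[OF X] and fY = Phi_lifts[OF Y]
  note UV = vertical_fields_D(1)[OF U]
  have T: "D A B p \<in> TS p" if "A \<in> VF" "B \<in> VF" for A B by (rule M.D_TS[OF that p])
  have skew: "g p (D (\<Phi> A) B p) (U p) = - g p (D A (\<Phi> B) p) (U p)" if A: "lifts A A'" and B: "lifts B B'" for A A' B B'
  proof -
    note a = lifts_D(1)[OF A] and b = lifts_D(1)[OF B]
    have "- g p (D (\<Phi> A) B p) (U p) = g p (D U (\<Phi> A) p) (B p)" using D_vertical_lift[OF Phi_lifts[OF A] B U p] by simp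
    also have "\<dots> = g p (\<phi> p (D U A p)) (B p)" using A.C12_equation[OF UV a p] e by simp
    also have "\<dots> = - g p (D U A p) (\<Phi> B p)"
      using A.phi_skew[OF p T[OF UV a] M.VF_TS[OF b p]] by (simp add: A.Phi_apply[OF p])
    also have "\<dots> = g p (D A (\<Phi> B) p) (U p)" using D_vertical_lift[OF A Phi_lifts[OF B] U p] by simp
    finally show ?thesis by simp
  qed
  have comm: "g p (D (\<Phi> A) B p) (U p) = g p (D A (\<Phi> B) p) (U p)" if A: "lifts A A'" and B: "lifts B B'" for A A' B B'
  proof -
    note a = lifts_D(1)[OF A] and b = lifts_D(1)[OF B]
    have fU: "g p (\<phi> p (D E F p)) (U p) = - g p (D E F p) (\<Phi> U p)" if "E \<in> VF" "F \<in> VF" for E F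
      using A.phi_skew[OF p T[OF that] M.VF_TS[OF UV p]] by (simp add: A.Phi_apply[OF p])
    have "g p (D (\<Phi> A) B p) (U p) = - g p (D B (\<Phi> A) p) (U p)" by (rule lifts_antisymmetric[OF Phi_lifts[OF A] B U p])
    also have "\<dots> = g p (D B A p) (\<Phi> U p)"
      unfolding D_horizontal_Phi[OF b lifts_D(3)[OF B p] a p] fU[OF b a] by simp
    also have "\<dots> = - g p (D A B p) (\<Phi> U p)" by (rule lifts_antisymmetric[OF B A Phi_VV[OF U] p])
    also have "\<dots> = g p (D A (\<Phi> B) p) (U p)"
      unfolding D_horizontal_Phi[OF a lifts_D(3)[OF A p] b p] fU[OF a b] by simp
    finally show ?thesis .
  qed
  have "g p (D X (\<Phi> (\<Phi> Y)) p) (U p) = 0" using skew[OF X fY] comm[OF X fY] by simp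
  then show ?thesis
    unfolding Phi_Phi_horizontal[OF lifts_horizontal[OF Y]] D_uminus[OF lifts_D(1)[OF X] lifts_D(1)[OF Y]]
    using M.g_neg[OF p T[OF lifts_D(1)[OF X] lifts_D(1)[OF Y]] M.VF_TS[OF UV p]] by simp
qed

text \<open>Given a vertical vector, a vertical field \<open>U\<close> through it is split into \<open>U - \<eta>(U)\<xi>\<close>, which is annihilated
  by \<open>\<eta>\<close>, and a multiple of \<open>\<xi>\<close>. By tensoriality the horizontal fields may be replaced by basic ones with
  the same values.\<close>

lemma D_horizontal:
  assumes X: "X \<in> HV" and Y: "Y \<in> HV" and p: "p \<in> points M"
  shows "D X Y p \<in> HS p"
proof (rule HS_I)
  note x = horizontal_fields_D[OF X] and y = horizontal_fields_D[OF Y]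
  show "D X Y p \<in> TS p" by (rule M.D_TS[OF x(1) y(1) p])
  fix v assume v: "v \<in> VS p"
  obtain W where W: "W \<in> VF" "W p = v" using M.VF_extend[OF p VS_D(1)[OF v]] by blast
  define U where "U = vproj M M' \<pi> g W"
  have U: "U \<in> VV" unfolding U_def using vproj_VF[OF W(1)] by (simp add: vertical_fields_def)
  have Up: "U p = v" unfolding U_def
    by (rule vproj_eqI[OF p v]) (simp add: W subspace_0[OF subspace_HS[OF p]])
  note UV = vertical_fields_D(1)[OF U]
  define e where "e q = - \<eta> q (U q)" for q
  have e: "e \<in> CF" unfolding e_def by (rule M.CF_uminus[OF A.eta_CF[OF UV]])
  define U0 where "U0 = U + e \<odot> \<xi>"
  have U0: "U0 \<in> VV"
    unfolding U0_def using M.VF_add[OF UV M.VF_scale[OF e A.xi_VF]] vertical_fields_D(2)[OF U] xi_vertical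
    by (auto simp: vertical_fields_def fun_scale_apply intro!: subspace_add[OF subspace_VS] subspace_scale[OF subspace_VS])
  have eta0: "\<eta> p (U0 p) = 0"
    using A.eta_xi[OF p] M.VF_TS[OF UV p] A.xi_TS[OF p]
    by (simp add: U0_def fun_scale_apply e_def A.eta_diff[OF p] A.eta_scale[OF p] M.TS_scale)
  obtain X1 X1' where X1: "lifts X1 X1'" "X1 p = X p" using lift_through[OF p x(2)[OF p]] by blast
  obtain Y1 Y1' where Y1: "lifts Y1 Y1'" "Y1 p = Y p" using lift_through[OF p y(2)[OF p]] by blast
  have "g p (D X Y p) (U0 p) = - g p (Y p) (D X U0 p)" by (rule horizontal_component_tensorial[OF X Y U0 p])
  also have "\<dots> = - g p (Y1 p) (D X1 U0 p)"
    using M.D_tensorial[OF x(1) lifts_D(1)[OF X1(1)] vertical_fields_D(1)[OF U0] p] X1(2) Y1(2) by simp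
  also have "\<dots> = g p (D X1 Y1 p) (U0 p)"
    using horizontal_component_tensorial[OF lifts_horizontal[OF X1(1)] lifts_horizontal[OF Y1(1)] U0 p] by simp
  also have "\<dots> = 0" by (rule lifts_D_vertical_0[OF X1(1) Y1(1) U0 p eta0])
  finally have 0: "g p (D X Y p) (U0 p) = 0" .
  have "g p (D X Y p) (U0 p) = g p (D X Y p) (U p) + e p * g p (D X Y p) (\<xi> p)"
    using M.D_TS[OF x(1) y(1) p] M.VF_TS[OF UV p] A.xi_TS[OF p]
    by (simp add: U0_def fun_scale_apply M.g_add2[OF p] M.g_scale2[OF p] M.TS_scale)
  moreover have "g p (D X Y p) (\<xi> p) = 0"
    using A.eta_eq[OF p M.D_TS[OF x(1) y(1) p]] eta_D_horizontal[OF X Y p] by simp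
  ultimately show "g p (D X Y p) v = 0" using 0 Up by simp
qed

theorem horizontal_totally_geodesic: "horizontal_totally_geodesic M M' \<pi> g D"
  unfolding horizontal_totally_geodesic_def
proof (intro ballI)
  fix X Y assume X: "X \<in> HV" and Y: "Y \<in> HV"
  show "D X Y \<in> HV"
    using D_horizontal[OF X Y] M.D_VF[OF horizontal_fields_D(1)[OF X] horizontal_fields_D(1)[OF Y]]
    by (simp add: horizontal_fields_def)
qed

text \<open>The equation \<open>\<nabla>\<^sub>X(\<phi>Y) = \<phi>(\<nabla>\<^sub>XY)\<close> for horizontal lifts projects to
  \<open>\<nabla>'\<^bsub>X'\<^esub>(JY') = J(\<nabla>'\<^bsub>X'\<^esub>Y')\<close>.\<close>

theorem base_kaehler: "kaehler_manifold M' J g'"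
proof -
  obtain D' where D': "levi_civita M' g' D'" by (rule N.levi_civita_exists)
  interpret N': riemannian_connection M' g' D' by unfold_locales (rule D')
  have "cov_endo M' D' J X' Y' = 0" if X': "X' \<in> VF'" and Y': "Y' \<in> VF'" for X' Y'
  proof
    fix q
    obtain X where X: "lifts X X'" using lift_exists[OF X'] by blast
    obtain Y where Y: "lifts Y Y'" using lift_exists[OF Y'] by blast
    note d = N'.D_VF[OF X' J_VF[OF Y']]
    show "cov_endo M' D' J X' Y' q = 0 q"
    proof (cases "q \<in> points M'")
      case True
      then obtain p where p: "p \<in> points M" "\<pi> p = q" using base_point by blast
      have "D' X' (endo_apply M' J Y') q = push (D X (\<Phi> Y) p)"
        using push_connection[OF D' X Phi_lifts[OF Y] p(1)] p(2) by simp
      also have "\<dots> = push (\<phi> p (D X Y p))"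
        using D_horizontal_Phi[OF lifts_D(1)[OF X] lifts_D(3)[OF X p(1)] lifts_D(1)[OF Y] p(1)] by simp
      also have "\<dots> = J q (D' X' Y' q)"
        using J_push[OF p(1) M.D_TS[OF lifts_D(1)[OF X] lifts_D(1)[OF Y] p(1)]] push_connection[OF D' X Y p(1)] p(2) by simp
      finally show ?thesis using True by (simp add: cov_endo_def endo_apply_def[of M'])
    next
      case False
      then show ?thesis using N.VF_outside[OF d False] by (simp add: cov_endo_def endo_apply_def[of M' J "D' X' Y'"])
    qed
  qed
  then show ?thesis unfolding kaehler_manifold_def using hermitian D' by blast
qed

abbreviation "T \<equiv> oneill_T M M' \<pi> g D"

lemma T_properties:
  assumes U: "U \<in> VV" and V: "V \<in> VV" and p: "p \<in> points M"
  shows "T U V p \<in> HS p" "D U V p - T U V p \<in> VS p"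
proof -
  note d = M.D_VF[OF vertical_fields_D(1)[OF U] vertical_fields_D(1)[OF V]]
  show "T U V p \<in> HS p" "D U V p - T U V p \<in> VS p"
    unfolding oneill_T_vertical[OF U V] using vproj_VF(3,4)[OF d p] by (simp_all add: hproj_def)
qed

lemma T_VF: "U \<in> VV \<Longrightarrow> V \<in> VV \<Longrightarrow> T U V \<in> VF"
  using oneill_T_vertical vproj_VF(2) M.D_VF vertical_fields_D(1) by metis

lemma T_eqI:
  assumes U: "U \<in> VV" and V: "V \<in> VV" and p: "p \<in> points M" and u: "u \<in> HS p" "D U V p - u \<in> VS p"
  shows "T U V p = u"
  unfolding oneill_T_vertical[OF U V] by (rule hproj_eqI[OF p u(1), where E = "D U V", OF u(2)])

lemma vertical_bracket:
  assumes U: "U \<in> VV" and V: "V \<in> VV" and p: "p \<in> points M"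
  shows "lie_bracket U V p \<in> VS p"
proof (rule VS_I)
  note u = vertical_fields_D[OF U] and v = vertical_fields_D[OF V]
  show "lie_bracket U V p \<in> TS p" using M.VF_TS[OF M.VF_lie_bracket[OF u(1) v(1)] p] .
  have 1: "A p (\<lambda>q. B q (\<lambda>q. f (\<pi> q))) = 0" if A: "A \<in> VV" and B: "B \<in> VV" and f: "f \<in> CF'" for A B f
  proof -
    note a = vertical_fields_D[OF A] and b = vertical_fields_D[OF B]
    have "A p (\<lambda>q. B q (\<lambda>q. f (\<pi> q))) = A p (\<lambda>q. 0)"
      by (rule M.TS_cong[OF p M.VF_TS[OF a(1) p] M.VF_CF[OF b(1) pullback[OF f]] M.CF_const])
        (rule vertical_apply[OF b(2) f])
    then show ?thesis using M.TS_const[OF M.VF_TS[OF a(1) p]] by simp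
  qed
  show "push (lie_bracket U V p) = 0"
  proof
    fix f show "push (lie_bracket U V p) f = 0 f"
    proof (cases "f \<in> CF'")
      case True
      then show ?thesis using 1[OF U V] 1[OF V U] by (simp add: push_apply lie_bracket_def)
    qed (simp add: pushforward_def)
  qed
qed

text \<open>The bracket of vertical fields is vertical.\<close>

lemma T_sym:
  assumes U: "U \<in> VV" and V: "V \<in> VV" and p: "p \<in> points M"
  shows "T U V p = T V U p"
proof (rule T_eqI[OF U V p T_properties(1)[OF V U p]])
  have "D U V p - T V U p = lie_bracket U V p + (D V U p - T V U p)"
    using fun_cong[OF M.D_torsion[OF vertical_fields_D(1)[OF U] vertical_fields_D(1)[OF V]], of p] by (simp add: algebra_simps)
  then show "D U V p - T V U p \<in> VS p"
    using subspace_add[OF subspace_VS vertical_bracket[OF U V p] T_properties(2)[OF V U p]] by (simp only:)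
qed

text \<open>The horizontal part of the \<open>C\<^sub>1\<^sub>2\<close>-equation; the term with the factor \<open>\<xi>\<close> is vertical and drops out.\<close>

lemma T_Phi:
  assumes U: "U \<in> VV" and V: "V \<in> VV" and p: "p \<in> points M"
  shows "T U (\<Phi> V) p = \<phi> p (T U V p) - (\<eta> p (U p) * \<eta> p (V p)) *\<^sub>R \<phi> p (T \<xi> \<xi> p)"
proof (rule T_eqI[OF U Phi_VV[OF V] p])
  note u = vertical_fields_D[OF U] and v = vertical_fields_D[OF V]
  note t = T_properties[OF U V p] and x = T_properties[OF xi_VV xi_VV p]
  note tT = HS_D(1)[OF t(1)] HS_D(1)[OF x(1)] VS_D(1)[OF t(2)] VS_D(1)[OF x(2)]
  let ?c = "\<eta> p (U p) * \<eta> p (V p)"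
  show "\<phi> p (T U V p) - ?c *\<^sub>R \<phi> p (T \<xi> \<xi> p) \<in> HS p"
    by (intro subspace_diff[OF subspace_HS[OF p]] subspace_scale[OF subspace_HS[OF p]] phi_horizontal[OF p] t x)
  have 1: "\<phi> p (D U V p) = \<phi> p (T U V p) + \<phi> p (D U V p - T U V p)"
    using A.phi_add[OF p tT(1,3)] by simp
  have 2: "\<phi> p (D \<xi> \<xi> p) = \<phi> p (T \<xi> \<xi> p) + \<phi> p (D \<xi> \<xi> p - T \<xi> \<xi> p)"
    using A.phi_add[OF p tT(2,4)] by simp
  have eq: "D U (\<Phi> V) p - (\<phi> p (T U V p) - ?c *\<^sub>R \<phi> p (T \<xi> \<xi> p)) =
      \<phi> p (D U V p - T U V p) - (\<eta> p (U p) * g p (D \<xi> \<xi> p) (\<phi> p (V p))) *\<^sub>R \<xi> p - ?c *\<^sub>R \<phi> p (D \<xi> \<xi> p - T \<xi> \<xi> p)"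
    unfolding A.C12_equation[OF u(1) v(1) p] 1 2 by (simp add: algebra_simps)
  show "D U (\<Phi> V) p - (\<phi> p (T U V p) - ?c *\<^sub>R \<phi> p (T \<xi> \<xi> p)) \<in> VS p"
    unfolding eq
    by (rule subspace_diff[OF subspace_VS subspace_diff[OF subspace_VS phi_vertical[OF p t(2)]
          subspace_scale[OF subspace_VS xi_vertical[OF p]]] subspace_scale[OF subspace_VS phi_vertical[OF p x(2)]]])
qed

theorem T_Phi_field:
  assumes U: "U \<in> VV" and V: "V \<in> VV"
  shows "T U (\<Phi> V) = \<Phi> (T U V) - form1_apply \<eta> U \<odot> form1_apply \<eta> V \<odot> \<Phi> (T \<xi> \<xi>)"
proof (rule M.VF_eqI)
  have e: "form1_apply \<eta> A \<in> CF" if "A \<in> VV" for A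
    unfolding form1_apply_def by (rule A.eta_CF[OF vertical_fields_D(1)[OF that]])
  show "T U (\<Phi> V) \<in> VF" by (rule T_VF[OF U Phi_VV[OF V]])
  show "\<Phi> (T U V) - form1_apply \<eta> U \<odot> form1_apply \<eta> V \<odot> \<Phi> (T \<xi> \<xi>) \<in> VF"
    by (intro M.VF_diff M.VF_scale A.phi_VF T_VF U V xi_VV e)
  fix p assume p: "p \<in> points M"
  show "T U (\<Phi> V) p = (\<Phi> (T U V) - form1_apply \<eta> U \<odot> form1_apply \<eta> V \<odot> \<Phi> (T \<xi> \<xi>)) p"
    by (simp add: T_Phi[OF U V p] A.Phi_apply[OF p] fun_scale_apply form1_apply_def)
qed

text \<open>Applying \<open>T_Phi\<close> twice, with \<open>T\<close> symmetric in between, gives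
  \<open>T\<^bsub>\<phi>U\<^esub>\<phi>V = \<phi>(T\<^sub>V(\<phi>U)) = \<phi>\<^sup>2(T\<^sub>VU) - \<eta>(U)\<eta>(V)\<phi>\<^sup>2(T\<^sub>\<xi>\<xi>)\<close>, and \<open>\<phi>\<^sup>2 = -1\<close> on horizontal vectors.\<close>

theorem T_Phi_Phi_field:
  assumes U: "U \<in> VV" and V: "V \<in> VV"
  shows "T U V + T (\<Phi> U) (\<Phi> V) = form1_apply \<eta> U \<odot> form1_apply \<eta> V \<odot> T \<xi> \<xi>"
proof (rule M.VF_eqI)
  have e: "form1_apply \<eta> A \<in> CF" if "A \<in> VV" for A
    unfolding form1_apply_def by (rule A.eta_CF[OF vertical_fields_D(1)[OF that]])
  show "T U V + T (\<Phi> U) (\<Phi> V) \<in> VF" by (intro M.VF_add T_VF Phi_VV U V)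
  show "form1_apply \<eta> U \<odot> form1_apply \<eta> V \<odot> T \<xi> \<xi> \<in> VF"
    by (intro M.VF_scale T_VF U V xi_VV e)
  fix p assume p: "p \<in> points M"
  note u = vertical_fields_D[OF U]
  note t = T_properties(1)[OF V U p] and x = T_properties(1)[OF xi_VV xi_VV p]
  have ff: "\<phi> p (\<phi> p w) = - w" if "w \<in> HS p" for w
    using A.phi_phi[OF p HS_D(1)[OF that]] eta_horizontal[OF p that] by simp
  have 0: "\<eta> p (\<Phi> U p) = 0"
    using A.eta_phi[OF p M.VF_TS[OF u(1) p]] by (simp add: A.Phi_apply[OF p])
  have "T (\<Phi> U) (\<Phi> V) p = \<phi> p (T (\<Phi> U) V p)"
    using T_Phi[OF Phi_VV[OF U] V p] 0 by simp
  also have "\<dots> = \<phi> p (T V (\<Phi> U) p)" using T_sym[OF Phi_VV[OF U] V p] by simp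
  also have "\<dots> = \<phi> p (\<phi> p (T V U p)) - (\<eta> p (V p) * \<eta> p (U p)) *\<^sub>R \<phi> p (\<phi> p (T \<xi> \<xi> p))"
    unfolding T_Phi[OF V U p]
    using HS_D(1)[OF t] HS_D(1)[OF x] by (simp add: A.phi_diff[OF p] A.phi_scale[OF p] A.phi_TS[OF p] M.TS_scale)
  also have "\<dots> = - T U V p + (\<eta> p (U p) * \<eta> p (V p)) *\<^sub>R T \<xi> \<xi> p"
    by (simp only: ff[OF t] ff[OF x] ff[OF T_properties(1)[OF U V p]] T_sym[OF V U p]) (simp add: mult.commute)
  finally show "(T U V + T (\<Phi> U) (\<Phi> V)) p = (form1_apply \<eta> U \<odot> form1_apply \<eta> V \<odot> T \<xi> \<xi>) p"
    by (simp add: fun_scale_apply form1_apply_def)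
qed

text \<open>Here \<open>\<eta>(X) = 0\<close>, and only the horizontal part \<open>T\<^sub>\<xi>\<xi>\<close> of \<open>\<nabla>\<^sub>\<xi>\<xi>\<close> is seen by \<open>\<phi>X\<close>.\<close>

theorem cov_Phi_vertical_horizontal:
  assumes U: "U \<in> VV" and X: "X \<in> HV"
  shows "cov_endo M D \<phi> U X = - (form1_apply \<eta> U \<odot> form2_apply g (T \<xi> \<xi>) (\<Phi> X) \<odot> \<xi>)"
proof (rule M.VF_eqI)
  note u = vertical_fields_D[OF U] and x = horizontal_fields_D[OF X]
  have e: "form1_apply \<eta> U \<in> CF" "form2_apply g (T \<xi> \<xi>) (\<Phi> X) \<in> CF"
    unfolding form1_apply_def form2_apply_def
    by (rule A.eta_CF[OF u(1)], rule M.g_CF[OF T_VF[OF xi_VV xi_VV] A.phi_VF[OF x(1)]])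
  show "cov_endo M D \<phi> U X \<in> VF"
    unfolding cov_endo_def by (intro M.VF_diff M.D_VF A.phi_VF u(1) x(1))
  show "- (form1_apply \<eta> U \<odot> form2_apply g (T \<xi> \<xi>) (\<Phi> X) \<odot> \<xi>) \<in> VF"
    by (intro M.VF_uminus M.VF_scale A.xi_VF e)
  fix p assume p: "p \<in> points M"
  note t = T_properties[OF xi_VV xi_VV p]
  have "g p (D \<xi> \<xi> p) (\<phi> p (X p)) = g p (T \<xi> \<xi> p) (\<phi> p (X p)) + g p (D \<xi> \<xi> p - T \<xi> \<xi> p) (\<phi> p (X p))"
    using M.g_add[OF p HS_D(1)[OF t(1)] VS_D(1)[OF t(2)] A.phi_TS[OF p HS_D(1)[OF x(2)[OF p]]]] by simp
  also have "g p (D \<xi> \<xi> p - T \<xi> \<xi> p) (\<phi> p (X p)) = 0"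
    by (rule HS_D2[OF p phi_horizontal[OF p x(2)[OF p]] t(2)])
  finally have "g p (D \<xi> \<xi> p) (\<phi> p (X p)) = g p (T \<xi> \<xi> p) (\<phi> p (X p))" by simp
  then show "cov_endo M D \<phi> U X p = (- (form1_apply \<eta> U \<odot> form2_apply g (T \<xi> \<xi>) (\<Phi> X) \<odot> \<xi>)) p"
    using A.C12_equation[OF u(1) x(1) p] eta_horizontal[OF p x(2)[OF p]]
    by (simp add: cov_endo_def fun_scale_apply form1_apply_def form2_apply_def A.Phi_apply[OF p])
qed

theorem cov_Phi_horizontal_vertical:
  assumes U: "U \<in> VV" and X: "X \<in> HV"
  shows "cov_endo M D \<phi> X U = 0"
proof (rule M.VF_eqI)
  note u = vertical_fields_D[OF U] and x = horizontal_fields_D[OF X]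
  show "cov_endo M D \<phi> X U \<in> VF"
    unfolding cov_endo_def by (intro M.VF_diff M.D_VF A.phi_VF u(1) x(1))
  show "0 \<in> VF" by (rule M.VF_0)
  fix p assume p: "p \<in> points M"
  show "cov_endo M D \<phi> X U p = 0 p"
    using D_horizontal_Phi[OF x(1) x(2)[OF p] u(1) p] by (simp add: cov_endo_def A.Phi_apply[OF p])
qed

end

section \<open>Level sets and immersions\<close>

text \<open>A right inverse \<open>Bp\<close> of \<open>B\<close> splits the space into the range of \<open>Bp\<close> and the kernel of \<open>B\<close>; by the
  assumption on dimensions, the latter has a linear parametrisation \<open>j\<close> by the given space.\<close>

lemma surjective_linear_splitting:
  fixes B :: "'e::euclidean_space \<Rightarrow> 'f::euclidean_space"
  assumes B: "linear B" "surj B" and dim: "DIM('k::euclidean_space) + DIM('f) = DIM('e)"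
  obtains Bp :: "'f \<Rightarrow> 'e" and j :: "'k::euclidean_space \<Rightarrow> 'e" and l :: "'e \<Rightarrow> 'k::euclidean_space"
  where "linear Bp" "linear j" "linear l" "\<And>y. B (Bp y) = y" "\<And>z. B (j z) = 0"
    "\<And>z. l (j z) = z" "\<And>x. B x = 0 \<Longrightarrow> j (l x) = x"
proof -
  obtain Bp where Bp: "linear Bp" "B \<circ> Bp = id" using linear_surjective_right_inverse[OF B] by blast
  have BBp: "B (Bp y) = y" for y using fun_cong[OF Bp(2), of y] by simp
  define K where "K = {x. B x = 0}"
  have K: "subspace K" unfolding K_def by (rule linear_subspace_kernel[OF B(1)])
  have rB: "subspace (range Bp)" by (rule linear_subspace_image[OF Bp(1) subspace_UNIV])
  have "inj Bp" using BBp by (metis injI)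
  then have dr: "dim (range Bp) = DIM('f)"
    using dim_image_eq[OF Bp(1), of UNIV] by (simp add: inj_on_def)
  have "K \<inter> range Bp = {0}"
    using BBp linear_0[OF Bp(1)] linear_0[OF B(1)] by (auto simp: K_def image_iff)
  moreover have "{x + y |x y. x \<in> K \<and> y \<in> range Bp} = UNIV"
  proof -
    have "x = (x - Bp (B x)) + Bp (B x) \<and> x - Bp (B x) \<in> K \<and> Bp (B x) \<in> range Bp" for x
      by (simp add: K_def linear_diff[OF B(1)] BBp)
    then show ?thesis by blast
  qed
  ultimately have "dim K = DIM('k)"
    using dim_sums_Int[OF K rB] dr dim by simp
  then obtain j :: "'k \<Rightarrow> 'e" where j: "linear j" "j ` UNIV = K" "inj_on j UNIV"
    using subspace_isomorphism[OF subspace_UNIV K] by auto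
  obtain l where l: "linear l" "l \<circ> j = id" using linear_injective_left_inverse[OF j(1,3)] by blast
  have lj: "l (j z) = z" for z using fun_cong[OF l(2), of z] by simp
  have "j (l x) = x" if "B x = 0" for x
  proof -
    have "x \<in> range j" using that j(2) by (simp add: K_def)
    then show ?thesis using lj by auto
  qed
  moreover have "B (j z) = 0" for z using j(2) by (auto simp: K_def)
  ultimately show thesis using that[OF Bp(1) j(1) l(1) BBp _ lj] by blast
qed

text \<open>The implicit function theorem, as a parametrisation of a level set by a linear coordinate \<open>R\<close>.\<close>

lemma level_set_chart:
  fixes f :: "'e::euclidean_space \<Rightarrow> 'f::euclidean_space"
  assumes W: "open W" "x0 \<in> W" and f: "smooth_on W f" and surj: "surj (frechet_derivative f (at x0))"
    and dim: "DIM('k::euclidean_space) + DIM('f) = DIM('e)"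
  obtains W0 Z and R :: "'e \<Rightarrow> 'k::euclidean_space" and e where "open W0" "W0 \<subseteq> W" "x0 \<in> W0" "open Z" "linear R" "smooth_on Z e"
    "\<And>x. x \<in> W0 \<Longrightarrow> f x = f x0 \<Longrightarrow> R x \<in> Z \<and> e (R x) = x"
    "\<And>z. z \<in> Z \<Longrightarrow> e z \<in> W0 \<and> f (e z) = f x0 \<and> R (e z) = z"
proof -
  define B where "B = frechet_derivative f (at x0)"
  have df: "(f has_derivative B) (at x0)" unfolding B_def by (rule smooth_on_has_derivative[OF f W(2)])
  note B = has_derivative_linear[OF df]
  obtain Bp j and l :: "'e \<Rightarrow> 'k" where Bp: "linear Bp" and j: "linear j" and l: "linear l" and
    BBp: "\<And>y. B (Bp y) = y" and Bj: "\<And>z. B (j z) = 0" and lj: "\<And>z. l (j z) = z" and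
    jl: "\<And>x. B x = 0 \<Longrightarrow> j (l x) = x"
    by (rule surjective_linear_splitting[OF B surj[folded B_def] dim]) blast
  define R where "R x = l (x - Bp (B x))" for x
  have R: "linear R"
  proof -
    have "R = l \<circ> (\<lambda>x. x - (Bp \<circ> B) x)" by (auto simp: R_def)
    then show ?thesis
      by (simp only:) (rule linear_compose[OF linear_compose_sub[OF linear_ident linear_compose[OF B Bp]] l])
  qed
  define \<Psi> where "\<Psi> x = Bp (f x) + j (R x)" for x
  have sm: "smooth_on W \<Psi>" unfolding \<Psi>_def
    by (rule smooth_on_add[OF W(1) smooth_on_bounded_linear[OF _ W(1) f]
          smooth_on_bounded_linear[OF _ W(1) smooth_on_linear[OF R W(1)]]])
      (simp_all add: linear_conv_bounded_linear[symmetric] Bp j)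
  have "linear (\<lambda>x. j (R x))" using linear_compose[OF R j] by (simp add: o_def)
  then have "(\<Psi> has_derivative (\<lambda>v. Bp (B v) + j (R v))) (at x0)" unfolding \<Psi>_def
    using has_derivative_add[OF bounded_linear.has_derivative[OF _ df, of Bp] bounded_linear_imp_has_derivative[of "\<lambda>x. j (R x)"]]
    by (simp add: linear_conv_bounded_linear[symmetric] Bp)
  moreover have "(\<lambda>v. Bp (B v) + j (R v)) = id"
    using jl by (auto simp: R_def fun_eq_iff linear_diff[OF B] BBp)
  ultimately have d: "(\<Psi> has_derivative id) (at x0)" by simp
  obtain W0 V0 \<Theta> where *: "open W0" "W0 \<subseteq> W" "x0 \<in> W0" "open V0" "homeomorphism W0 V0 \<Psi> \<Theta>" "smooth_on V0 \<Theta>"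
    by (rule smooth_inverse_function[OF W(1) sm W(2) d])
  have h: "\<And>x. x \<in> W0 \<Longrightarrow> \<Theta> (\<Psi> x) = x" "\<And>x. x \<in> W0 \<Longrightarrow> \<Psi> x \<in> V0"
    "\<And>y. y \<in> V0 \<Longrightarrow> \<Psi> (\<Theta> y) = y" "\<And>y. y \<in> V0 \<Longrightarrow> \<Theta> y \<in> W0"
    using *(5) by (auto simp: homeomorphism_def)
  define \<tau> where "\<tau> z = j z + Bp (f x0)" for z
  have st: "smooth_on UNIV \<tau>" unfolding \<tau>_def
    by (rule smooth_on_add[OF open_UNIV smooth_on_linear[OF j open_UNIV] smooth_on_const])
  define Z where "Z = \<tau> -` V0"
  have Z: "open Z" unfolding Z_def
    by (rule open_vimage[OF *(4) smooth_on_imp_continuous_on[OF st]])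
  define e where "e z = \<Theta> (\<tau> z)" for z
  have e: "smooth_on Z e" unfolding e_def
    by (rule smooth_on_compose[where g = \<Theta>, OF Z *(4) _ smooth_on_subset[OF st] *(6)]) (auto simp: Z_def)
  have 1: "R x \<in> Z \<and> e (R x) = x" if x: "x \<in> W0" "f x = f x0" for x
  proof -
    have "\<tau> (R x) = \<Psi> x" by (simp add: \<tau>_def \<Psi>_def x(2))
    then show ?thesis using h(1,2)[OF x(1)] by (simp add: Z_def e_def)
  qed
  have 2: "e z \<in> W0 \<and> f (e z) = f x0 \<and> R (e z) = z" if z: "z \<in> Z" for z
  proof -
    have zV: "\<tau> z \<in> V0" using z by (simp add: Z_def)
    have "\<Psi> (e z) = \<tau> z" using h(3)[OF zV] by (simp add: e_def)
    then have eq: "Bp (f (e z)) + j (R (e z)) = j z + Bp (f x0)" by (simp add: \<Psi>_def \<tau>_def)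
    then have "B (Bp (f (e z)) + j (R (e z))) = B (j z + Bp (f x0))" by simp
    then have fe: "f (e z) = f x0" by (simp add: linear_add[OF B] BBp Bj)
    then have "l (j (R (e z))) = l (j z)" using eq by simp
    then show ?thesis using fe h(4)[OF zV] by (simp add: lj e_def)
  qed
  show thesis by (rule that[OF *(1,2,3) Z R e 1 2])
qed

text \<open>Composing with a linear left inverse of the derivative reduces this to the inverse function theorem.\<close>

lemma immersion_left_inverse:
  fixes \<psi> :: "'k::euclidean_space \<Rightarrow> 'e::euclidean_space"
  assumes W: "open W" "z0 \<in> W" and s: "smooth_on W \<psi>" and inj: "inj (frechet_derivative \<psi> (at z0))"
  obtains W1 Y r where "open W1" "W1 \<subseteq> W" "z0 \<in> W1" "open Y" "smooth_on Y r"
    "\<And>z. z \<in> W1 \<Longrightarrow> \<psi> z \<in> Y \<and> r (\<psi> z) = z"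
proof -
  define A where "A = frechet_derivative \<psi> (at z0)"
  have dA: "(\<psi> has_derivative A) (at z0)" unfolding A_def by (rule smooth_on_has_derivative[OF s W(2)])
  obtain L where L: "linear L" "L \<circ> A = id"
    using linear_injective_left_inverse[OF has_derivative_linear[OF dA] inj[folded A_def]] by blast
  have bL: "bounded_linear L" using L(1) by (simp add: linear_conv_bounded_linear)
  have d: "((\<lambda>z. L (\<psi> z)) has_derivative id) (at z0)"
    using bounded_linear.has_derivative[OF bL dA] L(2) by (simp add: o_def)
  obtain W1 V1 \<theta> where *: "open W1" "W1 \<subseteq> W" "z0 \<in> W1" "open V1" "homeomorphism W1 V1 (\<lambda>z. L (\<psi> z)) \<theta>" "smooth_on V1 \<theta>"
    by (rule smooth_inverse_function[OF W(1) smooth_on_bounded_linear[OF bL W(1) s] W(2) d])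
  have oY: "open (L -` V1)" by (rule open_vimage[OF *(4) linear_continuous_on[OF bL]])
  have "smooth_on (L -` V1) (\<lambda>y. \<theta> (L y))"
    by (rule smooth_on_compose[where g = \<theta>, OF oY *(4) _ smooth_on_linear[OF L(1) oY] *(6)]) auto
  moreover have "\<psi> z \<in> L -` V1 \<and> \<theta> (L (\<psi> z)) = z" if "z \<in> W1" for z
    using *(5) that by (auto simp: homeomorphism_def)
  ultimately show thesis using that[OF *(1,2,3) oY] by blast
qed

section \<open>The fibres as submanifolds\<close>

locale submersion_fibre = submersion M g D M' g' \<pi>
  for M :: "('a, 'e::euclidean_space) manifold" and g D
    and M' :: "('b, 'f::euclidean_space) manifold" and g' \<pi> +
  fixes q :: 'b and F :: "('a, 'k::euclidean_space) manifold"
  assumes q: "q \<in> points M'" and F: "F = submanifold M (fibre M \<pi> q)"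
    and dim: "DIM('k) + DIM('f) = DIM('e)"
begin

abbreviation "S \<equiv> fibre M \<pi> q"

lemma S_D: "p \<in> S \<Longrightarrow> p \<in> points M" "p \<in> S \<Longrightarrow> \<pi> p = q"
  and S_I: "p \<in> points M \<Longrightarrow> \<pi> p = q \<Longrightarrow> p \<in> S"
  by (auto simp: fibre_def)

lemma top_F: "mfd_top F = subtopology (mfd_top M) S"
  by (simp add: F submanifold_def)

lemma points_F: "points F = S"
  using S_D(1) by (auto simp: points_def top_F)

lemma atlas_F: "(W, d) \<in> atlas F \<longleftrightarrow> is_chart (mfd_top F) W d \<and>
    (\<forall>(U, c)\<in>atlas M. smooth_on (d ` (W \<inter> U)) (c \<circ> inv_into W d) \<and>
      (\<forall>x\<in>d ` (W \<inter> U). inj (frechet_derivative (c \<circ> inv_into W d) (at x))))"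
  by (simp add: F submanifold_def)

lemma atlas_F_D:
  assumes d: "(W, d) \<in> atlas F" and c: "(U, c) \<in> atlas M"
  shows "smooth_on (d ` (W \<inter> U)) (\<lambda>x. c (inv_into W d x))"
    "\<And>x. x \<in> d ` (W \<inter> U) \<Longrightarrow> inj (frechet_derivative (\<lambda>x. c (inv_into W d x)) (at x))"
  using d c unfolding atlas_F by (auto simp: o_def)

lemma chart_F: "(W, d) \<in> atlas F \<Longrightarrow> is_chart (mfd_top F) W d"
  by (simp add: atlas_F)

lemma chart_F_subset: "(W, d) \<in> atlas F \<Longrightarrow> W \<subseteq> S"
  using chart_F openin_subset points_F unfolding is_chart_def points_def by metis

lemma inv_chart_F: "(W, d) \<in> atlas F \<Longrightarrow> r \<in> W \<Longrightarrow> inv_into W d (d r) = r"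
  using is_chart_inj[OF chart_F] by (simp add: inv_into_f_f)

lemma openin_F: "openin (mfd_top M) X \<Longrightarrow> openin (mfd_top F) (X \<inter> S)"
  by (auto simp: top_F openin_subtopology)

lemma chart_F_image_open:
  assumes d: "(W, d) \<in> atlas F" and X: "openin (mfd_top M) X"
  shows "open (d ` (W \<inter> X))"
proof -
  have "W \<inter> X = W \<inter> (X \<inter> S)" using chart_F_subset[OF d] by auto
  then show ?thesis using is_chart_image_open[OF chart_F[OF d] openin_F[OF X]] by simp
qed

text \<open>A chart of the fibre is locally the restriction of a smooth map defined on an open subset of the
  total space.\<close>

lemma chart_F_extend:
  assumes d: "(W, d) \<in> atlas F" and p: "p \<in> W" and c: "(U, c) \<in> atlas M" "p \<in> U"
  obtains Y s where "open Y" "Y \<subseteq> c ` U" "c p \<in> Y" "smooth_on Y s"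
    "\<And>r. r \<in> S \<Longrightarrow> r \<in> U \<Longrightarrow> c r \<in> Y \<Longrightarrow> r \<in> W \<and> d r = s (c r)"
proof -
  let ?\<psi> = "\<lambda>x. c (inv_into W d x)"
  note o = chart_F_image_open[OF d M.chart_openin[OF c(1)]]
  have dp: "d p \<in> d ` (W \<inter> U)" using p c by auto
  obtain W1 Y1 s where *: "open W1" "W1 \<subseteq> d ` (W \<inter> U)" "d p \<in> W1" "open Y1" "smooth_on Y1 s"
    "\<And>z. z \<in> W1 \<Longrightarrow> ?\<psi> z \<in> Y1 \<and> s (?\<psi> z) = z"
    by (rule immersion_left_inverse[OF o dp atlas_F_D(1)[OF d c(1)] atlas_F_D(2)[OF d c(1) dp]]) blast
  have "openin (mfd_top F) {r \<in> W. d r \<in> W1}" by (rule is_chart_vimage_open[OF chart_F[OF d] *(1)])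
  then obtain X where X: "openin (mfd_top M) X" "{r \<in> W. d r \<in> W1} = X \<inter> S"
    by (auto simp: top_F openin_subtopology)
  define Y where "Y = c ` (U \<inter> X) \<inter> Y1"
  have oY: "open Y" unfolding Y_def by (rule open_Int[OF M.chart_image_open[OF c(1) X(1)] *(4)])
  have YU: "Y \<subseteq> c ` U" by (auto simp: Y_def)
  have "p \<in> X" using X(2) p *(3) by blast
  moreover have "c p \<in> Y1" using *(6)[OF *(3)] by (simp add: inv_chart_F[OF d p])
  ultimately have cp: "c p \<in> Y" using c(2) by (auto simp: Y_def)
  have sY: "smooth_on Y s" by (rule smooth_on_subset[OF *(5)]) (auto simp: Y_def)
  have "r \<in> W \<and> d r = s (c r)" if r: "r \<in> S" "r \<in> U" "c r \<in> Y" for r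
  proof -
    obtain r' where r': "r' \<in> U" "r' \<in> X" "c r = c r'" using r(3) by (auto simp: Y_def)
    then have "r = r'" using inj_onD[OF M.chart_inj[OF c(1)] r'(3) r(2) r'(1)] by simp
    then have "r \<in> X \<inter> S" using r' r by simp
    then have rW: "r \<in> W" "d r \<in> W1" using X(2) by auto
    then show ?thesis using *(6)[OF rW(2)] by (simp add: inv_chart_F[OF d rW(1)])
  qed
  then show thesis by (rule that[OF oY YU cp sY])
qed

text \<open>In charts, \<open>\<pi>\<close> has a surjective derivative, so that its level set is locally parametrised by a linear coordinate
  \<open>R\<close>. The map \<open>d = R \<circ> c\<close> is then a chart of the fibre. The inclusion is an immersion in this chart because the
  smooth map \<open>R \<circ> c\<close> is a left inverse of it.\<close>

lemma F_charts_cover: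
  assumes p: "p \<in> S"
  shows "\<exists>(W, d)\<in>atlas F. p \<in> W"
proof -
  note pM = S_D(1)[OF p] and pq = S_D(2)[OF p]
  obtain U c where c: "(U, c) \<in> atlas M" "p \<in> U" using M.chart_exists[OF pM] .
  obtain V c' where c': "(V, c') \<in> atlas M'" "q \<in> V" using N.chart_exists[OF q] .
  have c'p: "\<pi> p \<in> V" using c' pq by simp
  let ?f = "\<lambda>x. c' (\<pi> (inv_into U c x))"
  let ?\<Omega> = "c ` (U \<inter> \<pi> -` V)"
  note o = chart_domain_open[OF c(1) c'(1)] and fs = chart_map_smooth[OF c(1) c'(1)]
  have cp: "c p \<in> ?\<Omega>" using c c'p by auto
  from level_set_chart[OF o cp fs push_chart_surj[OF c c'(1) c'p] dim]
  obtain W0 Z and R :: "'e \<Rightarrow> 'k" and e where *: "open W0" "W0 \<subseteq> ?\<Omega>" "c p \<in> W0" "open Z" "linear R" "smooth_on Z e"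
    and Re: "\<And>x. x \<in> W0 \<Longrightarrow> ?f x = ?f (c p) \<Longrightarrow> R x \<in> Z \<and> e (R x) = x"
    and eR: "\<And>z. z \<in> Z \<Longrightarrow> e z \<in> W0 \<and> ?f (e z) = ?f (c p) \<and> R (e z) = z" by blast
  have f0: "?f (c p) = c' q" by (simp add: M.inv_chart[OF c] pq)
  define X where "X = {r \<in> U. c r \<in> W0}"
  have X: "openin (mfd_top M) X" unfolding X_def by (rule M.chart_vimage_open[OF c(1) *(1)])
  define W where "W = X \<inter> S"
  define d where "d = (\<lambda>r. R (c r))"
  define i where "i = (\<lambda>z. inv_into U c (e z))"
  have dW: "d r \<in> Z" "i (d r) = r" if r: "r \<in> W" for r
  proof -
    have r': "r \<in> U" "c r \<in> W0" "\<pi> r = q" using r S_D(2) by (auto simp: W_def X_def)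
    have "?f (c r) = ?f (c p)" unfolding f0 by (simp add: M.inv_chart[OF c(1) r'(1)] r'(3))
    then show "d r \<in> Z" "i (d r) = r" using Re[OF r'(2)] by (simp_all add: d_def i_def M.inv_chart[OF c(1) r'(1)])
  qed
  have iZ: "i z \<in> W" "d (i z) = z" "c (i z) = e z" if z: "z \<in> Z" for z
  proof -
    note ez = eR[OF z]
    then obtain r where r: "r \<in> U" "\<pi> r \<in> V" "e z = c r" using *(2) by blast
    then have ir: "i z = r" by (simp add: i_def M.inv_chart[OF c(1)])
    have "c' (\<pi> r) = c' q" using ez f0 r by (simp add: M.inv_chart[OF c(1)])
    then have "\<pi> r = q" using inj_onD[OF N.chart_inj[OF c'(1)] _ r(2) c'(2)] by simp
    then show "i z \<in> W" "c (i z) = e z" "d (i z) = z"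
      using r ez S_I M.chart_subset[OF c(1)] unfolding ir by (auto simp: W_def X_def d_def)
  qed
  have dimg: "d ` W = Z" using dW(1) iZ by (auto simp: image_iff) metis
  have injd: "inj_on d W" using dW(2) by (metis inj_onI)
  have invd: "inv_into W d z = i z" if "z \<in> Z" for z
    using inv_into_f_f[OF injd iZ(1)[OF that]] iZ(2)[OF that] by simp
  have WS: "W \<subseteq> S" and WU: "W \<subseteq> U" by (auto simp: W_def X_def)
  have tops: "topspace (mfd_top M) \<inter> W = W" using M.chart_subset[OF c(1)] WU by (auto simp: points_def)
  have sub: "subtopology (mfd_top F) W = subtopology (mfd_top M) W"
    using WS by (simp add: top_F subtopology_subtopology Int_absorb1)
  have cc: "continuous_map (subtopology (mfd_top M) U) (top_of_set (c ` U)) c"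
    and ci: "continuous_map (top_of_set (c ` U)) (subtopology (mfd_top M) U) (inv_into U c)"
  proof -
    obtain k where k: "homeomorphic_maps (subtopology (mfd_top M) U) (top_of_set (c ` U)) c k"
      using M.chart_homeo[OF c(1)] homeomorphic_map_maps by blast
    then show "continuous_map (subtopology (mfd_top M) U) (top_of_set (c ` U)) c" by (simp add: homeomorphic_maps_def)
    have "k y = inv_into U c y" if y: "y \<in> c ` U" for y
    proof -
      obtain r where r: "r \<in> U" "y = c r" using y by auto
      then have "k (c r) = r" using k M.chart_subset[OF c(1)] by (auto simp: homeomorphic_maps_def points_def)
      then show ?thesis using r M.inv_chart[OF c(1)] by simp
    qed
    then show "continuous_map (top_of_set (c ` U)) (subtopology (mfd_top M) U) (inv_into U c)"
      using k continuous_map_eq[of "top_of_set (c ` U)" "subtopology (mfd_top M) U" k "inv_into U c"]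
      by (simp add: homeomorphic_maps_def)
  qed
  have eU: "e ` Z \<subseteq> c ` U" using eR *(2) by fast
  have "homeomorphic_maps (subtopology (mfd_top F) W) (top_of_set (d ` W)) d i"
    unfolding homeomorphic_maps_def
  proof (intro conjI ballI)
    have "continuous_map (subtopology (mfd_top M) W) (top_of_set (c ` U)) c"
      by (rule continuous_map_from_subtopology_mono[OF cc WU])
    then have "continuous_map (subtopology (mfd_top M) W) euclidean c" by (simp add: continuous_map_in_subtopology)
    moreover have "continuous_map euclidean euclidean R"
      using linear_continuous_on[of R UNIV] *(5) by (simp add: linear_conv_bounded_linear)
    ultimately have "continuous_map (subtopology (mfd_top M) W) euclidean (R \<circ> c)" by (rule continuous_map_compose)
    then show "continuous_map (subtopology (mfd_top F) W) (top_of_set (d ` W)) d"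
      unfolding sub by (auto simp: continuous_map_in_subtopology d_def o_def)
    have "continuous_map (top_of_set Z) (top_of_set (c ` U)) e"
      using smooth_on_imp_continuous_on[OF *(6)] eU by (auto simp: continuous_map_in_subtopology)
    from continuous_map_compose[OF this ci]
    have "continuous_map (top_of_set Z) (subtopology (mfd_top M) U) i" by (simp add: o_def i_def)
    then show "continuous_map (top_of_set (d ` W)) (subtopology (mfd_top F) W) i"
      unfolding sub dimg using iZ(1) by (auto simp: continuous_map_in_subtopology)
    show "i (d r) = r" if "r \<in> topspace (subtopology (mfd_top F) W)" for r
      using that dW(2) unfolding sub by simp
    show "d (i z) = z" if "z \<in> topspace (top_of_set (d ` W))" for z
      using that iZ(2) by (simp add: dimg)
  qed
  then have "is_chart (mfd_top F) W d"
    unfolding is_chart_def dimg using *(4) openin_F[OF X]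
    by (auto simp: W_def[symmetric] homeomorphic_map_maps)
  moreover have "smooth_on (d ` (W \<inter> U2)) (c2 \<circ> inv_into W d) \<and>
      (\<forall>x\<in>d ` (W \<inter> U2). inj (frechet_derivative (c2 \<circ> inv_into W d) (at x)))" if c2: "(U2, c2) \<in> atlas M" for U2 c2
  proof -
    let ?A = "d ` (W \<inter> U2)" and ?h = "c2 \<circ> inv_into W d"
    have oA: "open ?A"
    proof -
      have "W \<inter> U2 = W \<inter> (U2 \<inter> S)" using WS by auto
      then show ?thesis using is_chart_image_open[OF \<open>is_chart (mfd_top F) W d\<close> openin_F[OF M.chart_openin[OF c2]]] by simp
    qed
    have AZ: "?A \<subseteq> Z" using dimg by auto
    have oU: "open (c ` (U \<inter> U2))" by (rule M.chart_image_open[OF c(1) M.chart_openin[OF c2]])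
    have im: "e ` ?A \<subseteq> c ` (U \<inter> U2)" 
    proof (rule image_subsetI)
      fix z assume z: "z \<in> ?A"
      then obtain r where r: "r \<in> W" "r \<in> U2" "z = d r" by auto
      have "e z = c r" using iZ(3)[of z] dW[OF r(1)] r(3) by simp
      then show "e z \<in> c ` (U \<inter> U2)" using r WU by auto
    qed
    have "smooth_on ?A (\<lambda>z. (c2 \<circ> inv_into U c) (e z))"
      by (rule smooth_on_compose[where g = "c2 \<circ> inv_into U c", OF oA oU im smooth_on_subset[OF *(6) AZ] M.transition[OF c(1) c2]])
    then have sh: "smooth_on ?A ?h"
      by (rule smooth_on_cong[OF oA, rotated]) (use AZ in \<open>auto simp: invd i_def\<close>)
    have "inj (frechet_derivative ?h (at x))" if x: "x \<in> ?A" for x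
    proof -
      let ?G = "\<lambda>y. R ((c \<circ> inv_into U2 c2) y)"
      have hx: "?h x \<in> c2 ` (U2 \<inter> U)" using x WU inv_into_f_f[OF injd] by auto
      have oU': "open (c2 ` (U2 \<inter> U))" by (rule M.chart_image_open[OF c2 M.chart_openin[OF c(1)]])
      have "smooth_on (c2 ` (U2 \<inter> U)) ?G"
        by (rule smooth_on_bounded_linear[OF _ oU' M.transition[OF c2 c(1)]]) (use *(5) in \<open>simp add: linear_conv_bounded_linear\<close>)
      note dG = smooth_on_has_derivative[OF this hx]
      note dh = smooth_on_has_derivative[OF sh x]
      have "((\<lambda>z. ?G (?h z)) has_derivative (\<lambda>v. frechet_derivative ?G (at (?h x)) (frechet_derivative ?h (at x) v))) (at x)"
        by (rule has_derivative_compose[OF dh dG])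
      then have "((\<lambda>z. z) has_derivative (\<lambda>v. frechet_derivative ?G (at (?h x)) (frechet_derivative ?h (at x) v))) (at x)"
      proof (rule has_derivative_transform_within_open[OF _ oA x])
        fix z assume "z \<in> ?A"
        then obtain r where r: "r \<in> W" "r \<in> U2" "z = d r" by auto
        have "inv_into W d z = r" unfolding r(3) by (rule inv_into_f_f[OF injd r(1)])
        then show "?G (?h z) = z" using r by (simp add: M.inv_chart[OF c2] d_def)
      qed
      then have "(\<lambda>v. frechet_derivative ?G (at (?h x)) (frechet_derivative ?h (at x) v)) = (\<lambda>v. v)"
        using has_derivative_unique[OF _ has_derivative_ident] by blast
      then show ?thesis by (metis injI)
    qed
    then show ?thesis using sh by blast
  qed
  ultimately have "(W, d) \<in> atlas F" unfolding atlas_F by blast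
  moreover have "p \<in> W" using p c(2) *(3) by (simp add: W_def X_def)
  ultimately show ?thesis by blast
qed

text \<open>Locally, the second chart is a smooth map of the total space composed with the inclusion, which is smooth
  in the first chart.\<close>

lemma F_transition:
  assumes d1: "(W1, d1) \<in> atlas F" and d2: "(W2, d2) \<in> atlas F"
  shows "smooth_on (d1 ` (W1 \<inter> W2)) (d2 \<circ> inv_into W1 d1)"
proof -
  have o: "open (d1 ` (W1 \<inter> W2))"
    using is_chart_image_open[OF chart_F[OF d1], of W2] chart_F[OF d2] by (simp add: is_chart_def)
  show ?thesis
  proof (rule smooth_on_local[OF o])
    fix x assume "x \<in> d1 ` (W1 \<inter> W2)"
    then obtain p where p: "p \<in> W1" "p \<in> W2" "x = d1 p" by auto
    have "p \<in> points M" using chart_F_subset[OF d1] p(1) S_D(1) by blast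
    then obtain U c where c: "(U, c) \<in> atlas M" "p \<in> U" using M.chart_exists by blast
    obtain Y s where Y: "open Y" "Y \<subseteq> c ` U" "c p \<in> Y" "smooth_on Y s"
      and s: "\<And>r. r \<in> S \<Longrightarrow> r \<in> U \<Longrightarrow> c r \<in> Y \<Longrightarrow> r \<in> W2 \<and> d2 r = s (c r)"
      by (rule chart_F_extend[OF d2 p(2) c]) blast
    let ?X = "{r \<in> U. c r \<in> Y}"
    let ?A = "d1 ` (W1 \<inter> ?X)"
    have oA: "open ?A" by (rule chart_F_image_open[OF d1 M.chart_vimage_open[OF c(1) Y(1)]])
    have im: "(\<lambda>x. c (inv_into W1 d1 x)) ` ?A \<subseteq> Y" using inv_chart_F[OF d1] by auto
    have "smooth_on ?A (\<lambda>x. c (inv_into W1 d1 x))"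
      by (rule smooth_on_subset[OF atlas_F_D(1)[OF d1 c(1)]]) auto
    then have "smooth_on ?A (\<lambda>x. s (c (inv_into W1 d1 x)))"
      by (rule smooth_on_compose[where g = s, OF oA Y(1) im _ Y(4)])
    then have "smooth_on ?A (d2 \<circ> inv_into W1 d1)"
    proof (rule smooth_on_cong[OF oA, rotated])
      fix y assume "y \<in> ?A"
      then obtain r where r: "r \<in> W1" "r \<in> U" "c r \<in> Y" "y = d1 r" by auto
      then show "s (c (inv_into W1 d1 y)) = (d2 \<circ> inv_into W1 d1) y"
        using s[of r] chart_F_subset[OF d1] inv_chart_F[OF d1] by auto
    qed
    then show "\<exists>A. open A \<and> x \<in> A \<and> smooth_on (d1 ` (W1 \<inter> W2) \<inter> A) (d2 \<circ> inv_into W1 d1)"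
    proof (intro exI[of _ ?A] conjI)
      show "x \<in> ?A" using p c(2) Y(3) by blast
    qed (rule oA, rule smooth_on_subset[OF _ Int_lower2])
  qed
qed

lemma smooth_manifold_F: "smooth_manifold F"
  unfolding smooth_manifold_def
proof (intro conjI)
  have M: "Hausdorff_space (mfd_top M)" "second_countable_top (mfd_top M)"
    using M.smooth_manifold by (auto simp: smooth_manifold_def)
  show "Hausdorff_space (mfd_top F)" unfolding top_F by (rule Hausdorff_space_subtopology[OF M(1)])
  obtain \<B> where B: "countable \<B>" "\<forall>B\<in>\<B>. openin (mfd_top M) B"
    "\<forall>U x. openin (mfd_top M) U \<and> x \<in> U \<longrightarrow> (\<exists>B\<in>\<B>. x \<in> B \<and> B \<subseteq> U)"
    using M(2) by (auto simp: second_countable_top_def)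
  show "second_countable_top (mfd_top F)"
    unfolding second_countable_top_def
  proof (intro exI[of _ "(\<lambda>B. B \<inter> S) ` \<B>"] conjI ballI allI impI)
    show "countable ((\<lambda>B. B \<inter> S) ` \<B>)" using B(1) by simp
    show "openin (mfd_top F) B" if "B \<in> (\<lambda>B. B \<inter> S) ` \<B>" for B using that B(2) openin_F by blast
    fix U x assume U: "openin (mfd_top F) U \<and> x \<in> U"
    then obtain X where X: "openin (mfd_top M) X" "U = X \<inter> S" by (auto simp: top_F openin_subtopology)
    have "openin (mfd_top M) X \<and> x \<in> X" using X U by simp
    then obtain B where "B \<in> \<B>" "x \<in> B" "B \<subseteq> X" using B(3)[rule_format, of X x] by blast
    then show "\<exists>B\<in>(\<lambda>B. B \<inter> S) ` \<B>. x \<in> B \<and> B \<subseteq> U"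
      using X U by (intro bexI[of _ "B \<inter> S"]) auto
  qed
  show "\<forall>(U, c)\<in>atlas F. is_chart (mfd_top F) U c" using chart_F by blast
  show "(\<Union>(U, c)\<in>atlas F. U) = points F" unfolding points_F using F_charts_cover chart_F_subset by fast
  show "\<forall>(U, c)\<in>atlas F. \<forall>(V, d)\<in>atlas F. smooth_on (c ` (U \<inter> V)) (d \<circ> inv_into U c)"
    using F_transition by blast
qed

section \<open>The induced structure on a fibre\<close>

lemma smooth_inclusion: "smooth_map F M id"
  unfolding smooth_map_def
proof (intro conjI)
  show "continuous_map (mfd_top F) (mfd_top M) id"
    unfolding top_F by (rule continuous_map_from_subtopology[OF continuous_map_id])
  have "smooth_on (d ` (W \<inter> id -` U)) (c \<circ> id \<circ> inv_into W d)" if "(W, d) \<in> atlas F" "(U, c) \<in> atlas M" for W d U c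
    using atlas_F_D(1)[OF that] by (simp add: o_def)
  then show "\<forall>(U, c)\<in>atlas F. \<forall>(V, d)\<in>atlas M. smooth_on (c ` (U \<inter> id -` V)) (d \<circ> id \<circ> inv_into U c)" by blast
qed

sublocale FM: smooth_mfd F
  by unfold_locales (rule smooth_manifold_F)

sublocale incl: metric_map F M id g
  by unfold_locales (rule smooth_inclusion)

abbreviation "CFF \<equiv> smooth_funs F"
abbreviation "TSF \<equiv> tangent_space F"
abbreviation "VFF \<equiv> vector_fields F"
abbreviation "\<iota> \<equiv> pushforward F M id"

lemma CF_restrict: "f \<in> CF \<Longrightarrow> f \<in> CFF"
  using incl.pullback by simp

lemma iota_apply: "f \<in> CF \<Longrightarrow> \<iota> v f = v f"
  by (simp add: incl.push_apply)

lemma iota_TS: "v \<in> TSF p \<Longrightarrow> \<iota> v \<in> TS p"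
  using incl.push_TS by simp

lemma iota_VS: assumes p: "p \<in> S" and v: "v \<in> TSF p" shows "\<iota> v \<in> VS p"
proof (rule VS_I[OF iota_TS[OF v]])
  show "push (\<iota> v) = 0"
  proof
    fix f show "push (\<iota> v) f = 0 f"
    proof (cases "f \<in> CF'")
      case True
      note pf = pullback[OF True]
      have "v (\<lambda>r. f (\<pi> r)) = v (\<lambda>r. f q)"
        by (rule FM.TS_cong[OF _ v CF_restrict[OF pf] FM.CF_const]) (use p S_D(2) in \<open>auto simp: points_F\<close>)
      then show ?thesis using FM.TS_const[OF v] by (simp add: push_apply[OF True] iota_apply[OF pf])
    qed (simp add: pushforward_def)
  qed
qed

text \<open>Injectivity is the immersion property. The image consists of vertical vectors, as \<open>\<pi>\<close> is constant on the
  fibre, and has the dimension of the vertical space.\<close>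

lemma iota_bij: assumes p: "p \<in> S" shows "inj_on \<iota> (TSF p)" "\<iota> ` TSF p = VS p"
proof -
  note pM = S_D(1)[OF p] and pq = S_D(2)[OF p]
  obtain W d where d: "(W, d) \<in> atlas F" "p \<in> W" using FM.chart_exists p points_F by blast
  obtain U c where c: "(U, c) \<in> atlas M" "p \<in> U" using M.chart_exists[OF pM] .
  obtain V c' where c': "(V, c') \<in> atlas M'" "\<pi> p \<in> V" using N.chart_exists[OF maps_points[OF pM]] .
  let ?A = "frechet_derivative (\<lambda>x. c (inv_into W d x)) (at (d p))"
  let ?B = "frechet_derivative (\<lambda>x. c' (\<pi> (inv_into U c x))) (at (c p))"
  have dp: "d p \<in> d ` (W \<inter> U)" using d c by auto
  have cp: "c p \<in> c ` (U \<inter> \<pi> -` V)" using c c' by auto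
  have linA: "linear ?A" by (rule has_derivative_linear[OF smooth_on_has_derivative[OF atlas_F_D(1)[OF d(1) c(1)] dp]])
  have linB: "linear ?B" by (rule has_derivative_linear[OF smooth_on_has_derivative[OF chart_map_smooth[OF c(1) c'(1)] cp]])
  have injA: "inj ?A" by (rule atlas_F_D(2)[OF d(1) c(1) dp])
  have iA: "\<iota> (FM.chart_vec W d p w) = M.chart_vec U c p (?A w)" for w
    using incl.push_chart_vec[OF d c(1), of w] c(2) by simp
  have pB: "push (M.chart_vec U c p w) = N.chart_vec V c' (\<pi> p) (?B w)" for w
    by (rule push_chart_vec[OF c c'])
  note injM = injD[OF M.chart_vec_inj[OF c]] and injN = injD[OF N.chart_vec_inj[OF c']]
  note linN0 = linear_0[OF N.linear_chart_vec[OF c']]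
  show "inj_on \<iota> (TSF p)"
  proof (rule inj_onI)
    fix u v assume "u \<in> TSF p" "v \<in> TSF p" and eq: "\<iota> u = \<iota> v"
    then obtain w z where w: "u = FM.chart_vec W d p w" and z: "v = FM.chart_vec W d p z"
      using FM.TS_eq_chart_vec[OF d] by blast
    have "?A w = ?A z" using eq unfolding w z iA by (rule injM)
    then show "u = v" using injD[OF injA] w z by metis
  qed
  have ker: "push (M.chart_vec U c p w) = 0 \<longleftrightarrow> ?B w = 0" for w
    unfolding pB using injN[of "?B w" 0] linN0 by auto
  have BA: "?B (?A w) = 0" for w
    using VS_D(2)[OF iota_VS[OF p FM.chart_vec_TS[OF d]], of w] unfolding iA ker .
  have "range ?A = {w. ?B w = 0}"
  proof (rule subspace_dim_equal)
    show "subspace (range ?A)" by (rule linear_subspace_image[OF linA subspace_UNIV])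
    show "subspace {w. ?B w = 0}" by (rule linear_subspace_kernel[OF linB])
    show "range ?A \<subseteq> {w. ?B w = 0}" using BA by auto
    obtain Bp :: "'f \<Rightarrow> 'e" and j :: "'k \<Rightarrow> 'e" and l :: "'e \<Rightarrow> 'k" where j: "linear j"
      and jl: "\<And>x. ?B x = 0 \<Longrightarrow> j (l x) = x"
      by (rule surjective_linear_splitting[OF linB push_chart_surj[OF c c'] dim]) (rule that)
    have "{w. ?B w = 0} \<subseteq> range j"
    proof
      fix x assume "x \<in> {w. ?B w = 0}"
      then have "j (l x) = x" by (intro jl) simp
      then show "x \<in> range j" by (rule range_eqI[OF sym])
    qed
    then have "dim {w. ?B w = 0} \<le> dim (range j)" by (rule dim_subset)
    also have "\<dots> \<le> DIM('k)" using dim_image_le[OF j, of UNIV] by simp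
    also have "\<dots> = dim (range ?A)" using dim_image_eq[OF linA, of UNIV] injA by simp
    finally show "dim {w. ?B w = 0} \<le> dim (range ?A)" .
  qed
  then have "u \<in> \<iota> ` TSF p" if u: "u \<in> VS p" for u
  proof -
    obtain w where w: "u = M.chart_vec U c p w" using VS_D(1)[OF u] M.TS_eq_chart_vec[OF c] by blast
    have "?B w = 0" using VS_D(2)[OF u] unfolding w ker .
    then obtain z where "w = ?A z" using \<open>range ?A = {w. ?B w = 0}\<close> by blast
    then have "u = \<iota> (FM.chart_vec W d p z)" by (simp add: w iA)
    then show ?thesis using FM.chart_vec_TS[OF d] by blast
  qed
  then show "\<iota> ` TSF p = VS p" using iota_VS[OF p] by blast
qed

text \<open>Smooth functions on the fibre are locally quotients of restrictions.\<close>

lemma CFF_extend: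
  assumes f: "f \<in> CFF" and p: "p \<in> S"
  shows "\<exists>b\<in>CF. \<exists>h\<in>CF. b p \<noteq> 0 \<and> (\<forall>r\<in>S. b r * f r = h r)"
proof -
  obtain W d where d: "(W, d) \<in> atlas F" "p \<in> W" using FM.chart_exists p points_F by blast
  obtain U c where c: "(U, c) \<in> atlas M" "p \<in> U" using M.chart_exists[OF S_D(1)[OF p]] .
  obtain Y s where Y: "open Y" "Y \<subseteq> c ` U" "c p \<in> Y" "smooth_on Y s"
    and s: "\<And>r. r \<in> S \<Longrightarrow> r \<in> U \<Longrightarrow> c r \<in> Y \<Longrightarrow> r \<in> W \<and> d r = s (c r)"
    by (rule chart_F_extend[OF d c]) blast
  define X where "X = Y \<inter> s -` (d ` W)"
  have X: "open X" unfolding X_def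
    by (rule continuous_open_preimage[OF smooth_on_imp_continuous_on[OF Y(4)] Y(1) FM.chart_open[OF d(1)]])
  have "s (c p) \<in> d ` W" using s[OF p c(2) Y(3)] by (metis imageI)
  then have cp: "c p \<in> X" using Y(3) by (simp add: X_def)
  define k where "k y = f (inv_into W d (s y))" for y
  have k: "smooth_on X k" unfolding k_def
    by (rule smooth_on_compose[where g = "\<lambda>z. f (inv_into W d z)", OF X FM.chart_open[OF d(1)] _ smooth_on_subset[OF Y(4)]
          smooth_funs_chart'[OF f d(1)]]) (auto simp: X_def)
  obtain R where R: "R > 0" "cball (c p) R \<subseteq> X" using X cp open_contains_cball by blast
  obtain \<beta> where \<beta>: "smooth_on UNIV \<beta>" "\<And>y. y \<in> ball (c p) (R / 2) \<Longrightarrow> \<beta> y = 1"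
    "\<And>y. y \<notin> cball (c p) (2 * (R / 2)) \<Longrightarrow> \<beta> y = (0::real)"
    by (rule smooth_plateau_exists[of "R / 2" "c p"]) (use R(1) in auto)
  have XU: "X \<subseteq> c ` U" using Y(2) by (auto simp: X_def)
  have sb: "smooth_on X \<beta>" by (rule smooth_on_subset[OF \<beta>(1)]) simp
  let ?b = "\<lambda>r. if r \<in> U \<and> c r \<in> X then \<beta> (c r) else 0"
  let ?h = "\<lambda>r. if r \<in> U \<and> c r \<in> X then \<beta> (c r) * k (c r) else 0"
  have 1: "?b \<in> CF" by (rule M.CF_extend_zero[OF c(1) X XU compact_cball R(2) sb]) (use \<beta>(3) in simp)
  have 2: "?h \<in> CF"
    by (rule M.CF_extend_zero[OF c(1) X XU compact_cball R(2) smooth_on_mult[OF X sb k]]) (use \<beta>(3) in simp)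
  have 3: "?b p \<noteq> 0" using c(2) cp \<beta>(2) R(1) by simp
  have 4: "?b r * f r = ?h r" if r: "r \<in> S" for r
  proof (cases "r \<in> U \<and> c r \<in> X")
    case True
    then have rW: "r \<in> W" "d r = s (c r)" using s[OF r] by (auto simp: X_def)
    have "inv_into W d (s (c r)) = r" using FM.inv_chart[OF d(1) rW(1)] rW(2) by simp
    then show ?thesis using True by (simp add: k_def)
  next
    case False
    then show ?thesis by (simp only: if_False mult_zero_left)
  qed
  have 5: "\<forall>r\<in>S. ?b r * f r = ?h r" by (intro ballI 4)
  show ?thesis
    by (rule bexI[where x = ?b, OF _ 1], rule bexI[where x = ?h, OF _ 2], rule conjI[OF 3 5])
qed

text \<open>The inverse of the differential of the inclusion, on vertical vectors.\<close>

definition pull :: "'a \<Rightarrow> 'a tvec \<Rightarrow> 'a tvec" where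
  "pull p = inv_into (TSF p) \<iota>"

lemma pull_TSF: "p \<in> S \<Longrightarrow> u \<in> VS p \<Longrightarrow> pull p u \<in> TSF p"
  and iota_pull: "p \<in> S \<Longrightarrow> u \<in> VS p \<Longrightarrow> \<iota> (pull p u) = u"
  unfolding pull_def using iota_bij(2) by (metis inv_into_into, metis f_inv_into_f)

lemma pull_iota: "p \<in> S \<Longrightarrow> v \<in> TSF p \<Longrightarrow> pull p (\<iota> v) = v"
  unfolding pull_def using iota_bij(1) by (metis inv_into_f_f)

lemma iota_eqI: "p \<in> S \<Longrightarrow> u \<in> TSF p \<Longrightarrow> v \<in> TSF p \<Longrightarrow> \<iota> u = \<iota> v \<Longrightarrow> u = v"
  using iota_bij(1) by (metis inj_onD)

text \<open>A vertical field along the fibre that is smooth as a derivation of functions on the total space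
  is smooth as a vector field of the fibre.\<close>

lemma pull_VFF:
  assumes Z: "\<And>p. p \<in> S \<Longrightarrow> Z p \<in> VS p" and sm: "\<And>f. f \<in> CF \<Longrightarrow> (\<lambda>p. Z p f) \<in> CFF"
  shows "(\<lambda>p. if p \<in> S then pull p (Z p) else 0) \<in> VFF" (is "?X \<in> _")
proof (rule FM.VF_I)
  show "?X p \<in> TSF p" if "p \<in> points F" for p using that Z pull_TSF by (simp add: points_F)
  show "?X p = 0" if "p \<notin> points F" for p using that by (simp add: points_F)
  fix f assume f: "f \<in> CFF"
  show "(\<lambda>p. ?X p f) \<in> CFF"
  proof (rule FM.CF_local)
    fix p assume "p \<in> points F"
    then have p: "p \<in> S" by (simp add: points_F)
    obtain b h where b: "b \<in> CF" "b p \<noteq> 0" and h: "h \<in> CF" and bh: "\<forall>r\<in>S. b r * f r = h r"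
      using CFF_extend[OF f p] by blast
    have eq: "Z r h - f r * Z r b = b r * ?X r f" if r: "r \<in> points F" for r
    proof -
      have rS: "r \<in> S" using r by (simp add: points_F)
      note x = pull_TSF[OF rS Z[OF rS]]
      have ix: "pull r (Z r) k = Z r k" if "k \<in> CF" for k
        using iota_apply[OF that, of "pull r (Z r)"] iota_pull[OF rS Z[OF rS]] by simp
      have "pull r (Z r) h = pull r (Z r) (\<lambda>r. b r * f r)"
        by (rule FM.TS_cong[OF r x CF_restrict[OF h] FM.CF_mult[OF CF_restrict[OF b(1)] f]]) (simp add: bh points_F)
      also have "\<dots> = pull r (Z r) b * f r + b r * pull r (Z r) f"
        by (rule FM.TS_D(3)[OF x CF_restrict[OF b(1)] f])
      finally show ?thesis using rS by (simp add: ix h b)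
    qed
    have "(\<lambda>r. Z r h - f r * Z r b) \<in> CFF"
      by (rule FM.CF_diff[OF sm[OF h] FM.CF_mult[OF f sm[OF b(1)]]])
    then have "(\<lambda>r. b r * ?X r f) \<in> CFF" by (rule FM.CF_points_cong) (rule eq)
    then show "\<exists>b\<in>CFF. b p \<noteq> 0 \<and> (\<lambda>r. b r * ?X r f) \<in> CFF" using CF_restrict[OF b(1)] b(2) by blast
  qed
qed

abbreviation "\<rho> \<equiv> restr_field F M"

lemma rho_apply: "p \<in> S \<Longrightarrow> \<rho> U p = pull p (U p)"
  by (simp add: restr_field_def pull_def points_F)

lemma rho_VFF: assumes U: "U \<in> VV" shows "\<rho> U \<in> VFF"
proof -
  note u = vertical_fields_D[OF U]
  have "(\<lambda>p. if p \<in> S then pull p (U p) else 0) \<in> VFF"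
    by (rule pull_VFF[OF u(2)[OF S_D(1)] CF_restrict[OF M.VF_CF[OF u(1)]]])
  moreover have "\<rho> U = (\<lambda>p. if p \<in> S then pull p (U p) else 0)"
    by (auto simp: restr_field_def pull_def points_F)
  ultimately show ?thesis by simp
qed

lemma iota_rho: "U \<in> VV \<Longrightarrow> p \<in> S \<Longrightarrow> \<iota> (\<rho> U p) = U p"
  using rho_apply iota_pull vertical_fields_D(2) S_D(1) by metis

lemma rho_fun: "U \<in> VV \<Longrightarrow> p \<in> S \<Longrightarrow> f \<in> CF \<Longrightarrow> \<rho> U p f = U p f"
  using iota_rho iota_apply by metis

text \<open>Every tangent vector of the fibre extends to a vertical field on the total space.\<close>

lemma vertical_through:
  assumes p: "p \<in> S" and v: "v \<in> TSF p"
  shows "\<exists>U\<in>VV. \<rho> U p = v"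
proof -
  note pM = S_D(1)[OF p]
  obtain W where W: "W \<in> VF" "W p = \<iota> v" using M.VF_extend[OF pM iota_TS[OF v]] by blast
  have "vproj M M' \<pi> g W p = \<iota> v"
    by (rule vproj_eqI[OF pM iota_VS[OF p v]]) (simp add: W subspace_0[OF subspace_HS[OF pM]])
  moreover have "vproj M M' \<pi> g W \<in> VV" using vproj_VF[OF W(1)] by (simp add: vertical_fields_def)
  ultimately show ?thesis using rho_apply[OF p] pull_iota[OF p v] by (intro bexI) auto
qed

abbreviation "gF \<equiv> restr_form2 F M g"

lemma gF_apply: "gF p u v = g p (\<iota> u) (\<iota> v)"
  by (simp add: restr_form2_def)

lemma riemannian_F: "riemannian_metric F gF"
  unfolding riemannian_metric_def
proof (intro conjI ballI impI allI)
  fix p u assume "p \<in> points F" and u: "u \<in> TSF p"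
  then have p: "p \<in> S" by (simp add: points_F)
  note pM = S_D(1)[OF p]
  {
    fix v assume v: "v \<in> TSF p"
    show "gF p u v = gF p v u" using M.g_sym[OF pM iota_TS[OF u] iota_TS[OF v]] by (simp add: restr_form2_def)
    show "gF p (a *\<^sub>R u) v = a * gF p u v" for a
      using M.g_scale[OF pM iota_TS[OF u] iota_TS[OF v]] by (simp add: restr_form2_def incl.push_scale)
    fix w assume w: "w \<in> TSF p"
    show "gF p (u + v) w = gF p u w + gF p v w"
      using M.g_add[OF pM iota_TS[OF u] iota_TS[OF v] iota_TS[OF w]] by (simp add: restr_form2_def incl.push_add)
  }
  assume "u \<noteq> 0"
  then have "\<iota> u \<noteq> 0" using iota_eqI[OF p u FM.TS_0] linear_0[OF incl.linear_push] by auto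
  then show "0 < gF p u u" using M.g_pos[OF pM iota_TS[OF u]] by (simp add: restr_form2_def)
next
  fix X Y assume "X \<in> VFF" "Y \<in> VFF"
  then show "form2_apply gF X Y \<in> CFF"
    using incl.along_metric[OF incl.along_push incl.along_push] by (simp add: form2_apply_def restr_form2_def)
qed

sublocale FR: riemannian F gF
  by unfold_locales (rule riemannian_F)

lemma gF_rho: "U \<in> VV \<Longrightarrow> V \<in> VV \<Longrightarrow> p \<in> S \<Longrightarrow> gF p (\<rho> U p) (\<rho> V p) = g p (U p) (V p)"
  by (simp add: restr_form2_def iota_rho)

lemma iota_bracket:
  assumes U: "U \<in> VV" and V: "V \<in> VV" and p: "p \<in> S"
  shows "\<iota> (lie_bracket (\<rho> U) (\<rho> V) p) = lie_bracket U V p"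
proof
  have pF: "p \<in> points F" using p by (simp add: points_F)
  fix f
  show "\<iota> (lie_bracket (\<rho> U) (\<rho> V) p) f = lie_bracket U V p f"
  proof (cases "f \<in> CF")
    case True
    have 1: "\<rho> A p (\<lambda>r. \<rho> B r f) = A p (\<lambda>r. B r f)" if A: "A \<in> VV" and B: "B \<in> VV" for A B
    proof -
      note Bf = M.VF_CF[OF vertical_fields_D(1)[OF B] True]
      have "\<rho> A p (\<lambda>r. \<rho> B r f) = \<rho> A p (\<lambda>r. B r f)"
        by (rule FM.TS_cong[OF pF FM.VF_TS[OF rho_VFF[OF A] pF] FM.VF_CF[OF rho_VFF[OF B] CF_restrict[OF True]] CF_restrict[OF Bf]])
          (simp add: points_F rho_fun[OF B _ True])
      then show ?thesis by (simp add: rho_fun[OF A p Bf])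
    qed
    show ?thesis using 1[OF U V] 1[OF V U] by (simp add: iota_apply[OF True] lie_bracket_def)
  next
    case False
    then show ?thesis
      using M.VF_zero_fun[OF M.VF_lie_bracket[OF vertical_fields_D(1)[OF U] vertical_fields_D(1)[OF V]] False]
      by (simp add: pushforward_def)
  qed
qed

text \<open>Along the fibre, values of metrics and brackets of vertical fields agree with those of their restrictions.\<close>

lemma koszul_rho:
  assumes U: "U \<in> VV" and V: "V \<in> VV" and W: "W \<in> VV" and p: "p \<in> S"
  shows "FR.koszul (\<rho> U) (\<rho> V) (\<rho> W) p = M.koszul U V W p"
proof -
  have pF: "p \<in> points F" using p by (simp add: points_F)
  have 1: "\<rho> A p (\<lambda>r. gF r (\<rho> B r) (\<rho> C r)) = A p (\<lambda>r. g r (B r) (C r))"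
    if A: "A \<in> VV" and B: "B \<in> VV" and C: "C \<in> VV" for A B C
  proof -
    note cf = M.g_CF[OF vertical_fields_D(1)[OF B] vertical_fields_D(1)[OF C]]
    have "\<rho> A p (\<lambda>r. gF r (\<rho> B r) (\<rho> C r)) = \<rho> A p (\<lambda>r. g r (B r) (C r))"
      by (rule FM.TS_cong[OF pF FM.VF_TS[OF rho_VFF[OF A] pF] FR.g_CF[OF rho_VFF[OF B] rho_VFF[OF C]] CF_restrict[OF cf]])
        (simp add: points_F gF_rho[OF B C])
    then show ?thesis by (simp add: rho_fun[OF A p cf])
  qed
  have 2: "gF p (lie_bracket (\<rho> A) (\<rho> B) p) (\<rho> C p) = g p (lie_bracket A B p) (C p)"
    if A: "A \<in> VV" and B: "B \<in> VV" and C: "C \<in> VV" for A B C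
    by (simp add: restr_form2_def iota_bracket[OF A B p] iota_rho[OF C p])
  show ?thesis
    unfolding FR.koszul_def M.koszul_def
    by (simp only: 1[OF U V W] 1[OF V U W] 1[OF W U V] 2[OF U V W] 2[OF U W V] 2[OF V W U])
qed

text \<open>Both sides have the same scalar products with the restrictions of vertical fields, by the Koszul formula.\<close>

lemma fibre_connection:
  assumes DF: "levi_civita F gF DF" and U: "U \<in> VV" and V: "V \<in> VV" and p: "p \<in> S"
  shows "\<iota> (DF (\<rho> U) (\<rho> V) p) = vproj M M' \<pi> g (D U V) p"
proof -
  have pF: "p \<in> points F" using p by (simp add: points_F)
  note pM = S_D(1)[OF p]
  interpret FC: riemannian_connection F gF DF by unfold_locales (rule DF)
  note u = vertical_fields_D(1)[OF U] and v = vertical_fields_D(1)[OF V]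
  note dT = FC.D_TS[OF rho_VFF[OF U] rho_VFF[OF V] pF]
  let ?P = "vproj M M' \<pi> g (D U V) p"
  have P: "?P \<in> VS p" "D U V p - ?P \<in> HS p"
    using vproj_VF(3,4)[OF M.D_VF[OF u v] pM] by (simp_all add: hproj_def)
  have "DF (\<rho> U) (\<rho> V) p = pull p ?P"
  proof (rule FR.g_eqI[OF pF dT pull_TSF[OF p P(1)]])
    fix w assume "w \<in> TSF p"
    then obtain W where W: "W \<in> VV" "\<rho> W p = w" using vertical_through[OF p] by blast
    note Wp = vertical_fields_D(2)[OF W(1) pM] and w = vertical_fields_D(1)[OF W(1)]
    have "2 * gF p (DF (\<rho> U) (\<rho> V) p) w = 2 * g p (D U V p) (W p)"
      unfolding M.koszul_formula[OF M.levi_civita u v w pM] W(2)[symmetric]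
        FR.koszul_formula[OF DF rho_VFF[OF U] rho_VFF[OF V] rho_VFF[OF W(1)] pF]
      by (rule koszul_rho[OF U V W(1) p])
    moreover have "g p (D U V p) (W p) = g p ?P (W p)"
      using HS_D(2)[OF P(2) Wp] M.D_TS[OF u v pM] VS_D(1)[OF P(1)] VS_D(1)[OF Wp] by (simp add: M.g_diff[OF pM])
    ultimately show "gF p (DF (\<rho> U) (\<rho> V) p) w = gF p (pull p ?P) w"
      by (simp add: restr_form2_def iota_pull[OF p P(1)] W(2)[symmetric] iota_rho[OF W(1) p])
  qed
  then show ?thesis by (simp add: iota_pull[OF p P(1)])
qed

end

locale C12_fibre = C12_submersion M g D M' g' \<pi> \<phi> \<xi> \<eta> J + submersion_fibre M g D M' g' \<pi> q F
  for M :: "('a, 'e::euclidean_space) manifold" and g D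
    and M' :: "('b, 'f::euclidean_space) manifold" and g' \<pi> \<phi> \<xi> \<eta> J q
    and F :: "('a, 'k::euclidean_space) manifold" +
  assumes odd_dim: "odd DIM('k)"
begin

abbreviation "\<phi>F \<equiv> restr_endo F M \<phi>"
abbreviation "\<eta>F \<equiv> restr_form1 F M \<eta>"
abbreviation "\<xi>F \<equiv> restr_field F M \<xi>"

lemma phiF: "\<phi>F p v = pull p (\<phi> p (\<iota> v))"
  by (simp add: restr_endo_def pull_def)

lemma phiF_TSF: assumes p: "p \<in> S" and v: "v \<in> TSF p" shows "\<phi>F p v \<in> TSF p" "\<iota> (\<phi>F p v) = \<phi> p (\<iota> v)"
  unfolding phiF using phi_vertical[OF S_D(1)[OF p] iota_VS[OF p v]] pull_TSF[OF p] iota_pull[OF p] by auto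

text \<open>The derivative of \<open>f\<close> along \<open>\<phi>X\<close> is \<open>g(\<phi>X, G) = - g(X, \<phi>G)\<close> for the gradient \<open>G\<close> of \<open>f\<close>, which is a
  metric product of smooth fields along the inclusion.\<close>

lemma phiF_VFF: assumes X: "X \<in> VFF" shows "endo_apply F \<phi>F X \<in> VFF"
proof -
  let ?Z = "\<lambda>p. \<phi> p (\<iota> (X p))"
  have XT: "X p \<in> TSF p" if "p \<in> S" for p using FM.VF_TS[OF X] that by (simp add: points_F)
  have sm: "(\<lambda>p. ?Z p f) \<in> CFF" if f: "f \<in> CF" for f
  proof -
    have "form1_field M (\<lambda>p v. v f)"
      unfolding form1_field_def form1_apply_def using M.VF_CF[OF _ f] by auto
    then obtain G where G: "G \<in> VF" "\<And>p v. p \<in> points M \<Longrightarrow> v \<in> TS p \<Longrightarrow> g p (G p) v = v f"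
      by (rule M.sharp) (rule that)
    note fG = A.phi_VF[OF G(1)]
    have "(\<lambda>p. - g p (\<iota> (X p)) (\<Phi> G p)) \<in> CFF"
      using FM.CF_uminus[OF incl.along_metric[OF incl.along_push[OF X] incl.along_base[OF fG]]] by simp
    then show ?thesis
    proof (rule FM.CF_points_cong)
      fix p assume "p \<in> points F"
      then have p: "p \<in> S" by (simp add: points_F)
      note pM = S_D(1)[OF p] and x = iota_TS[OF XT[OF p]]
      have "?Z p f = g p (G p) (?Z p)" using G(2)[OF pM A.phi_TS[OF pM x]] by simp
      also have "\<dots> = g p (?Z p) (G p)" by (rule M.g_sym[OF pM M.VF_TS[OF G(1) pM] A.phi_TS[OF pM x]])
      also have "\<dots> = - g p (\<iota> (X p)) (\<Phi> G p)"
        using A.phi_skew[OF pM x M.VF_TS[OF G(1) pM]] by (simp add: A.Phi_apply[OF pM])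
      finally show "- g p (\<iota> (X p)) (\<Phi> G p) = ?Z p f" by (rule sym)
    qed
  qed
  have "(\<lambda>p. if p \<in> S then pull p (?Z p) else 0) \<in> VFF"
    by (rule pull_VFF[OF phi_vertical[OF S_D(1) iota_VS[OF _ XT]] sm])
  moreover have "endo_apply F \<phi>F X = (\<lambda>p. if p \<in> S then pull p (?Z p) else 0)"
    by (auto simp: endo_apply_def points_F phiF)
  ultimately show ?thesis by simp
qed

lemma iota_xiF: "p \<in> S \<Longrightarrow> \<iota> (\<xi>F p) = \<xi> p"
  using iota_rho[OF xi_VV] by simp

lemma etaF: "\<eta>F p v = \<eta> p (\<iota> v)"
  by (simp add: restr_form1_def)

lemma acm_F: "acm_manifold F \<phi>F \<xi>F \<eta>F gF"
  unfolding acm_manifold_def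
proof (intro conjI ballI)
  have e: "endo_field F \<phi>F"
    unfolding endo_field_def
  proof (intro conjI ballI allI)
    fix p u assume "p \<in> points F" and u: "u \<in> TSF p"
    then have p: "p \<in> S" by (simp add: points_F)
    note pM = S_D(1)[OF p]
    show "\<phi>F p u \<in> TSF p" by (rule phiF_TSF[OF p u])
    show "\<phi>F p (a *\<^sub>R u) = a *\<^sub>R \<phi>F p u" for a
      by (rule iota_eqI[OF p]) (simp_all add: phiF_TSF[OF p] u FM.TS_scale incl.push_scale A.phi_scale[OF pM iota_TS[OF u]])
    fix v assume v: "v \<in> TSF p"
    show "\<phi>F p (u + v) = \<phi>F p u + \<phi>F p v"
      by (rule iota_eqI[OF p]) (simp_all add: phiF_TSF[OF p] u v FM.TS_add incl.push_add A.phi_add[OF pM iota_TS[OF u] iota_TS[OF v]])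
  qed (rule phiF_VFF)
  show "endo_field F \<phi>F" by (rule e)
  show "form1_field F \<eta>F"
    unfolding form1_field_def
  proof (intro conjI ballI allI)
    fix p u assume "p \<in> points F" and u: "u \<in> TSF p"
    then have p: "p \<in> S" by (simp add: points_F)
    note pM = S_D(1)[OF p]
    show "\<eta>F p (a *\<^sub>R u) = a * \<eta>F p u" for a
      by (simp add: etaF incl.push_scale A.eta_scale[OF pM iota_TS[OF u]])
    fix v assume v: "v \<in> TSF p"
    show "\<eta>F p (u + v) = \<eta>F p u + \<eta>F p v"
      by (simp add: etaF incl.push_add A.eta_add[OF pM iota_TS[OF u] iota_TS[OF v]])
  next
    fix X assume X: "X \<in> VFF"
    have "(\<lambda>p. g p (\<iota> (X p)) (\<xi> p)) \<in> CFF"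
      using incl.along_metric[OF incl.along_push[OF X] incl.along_base[OF A.xi_VF]] by simp
    then show "form1_apply \<eta>F X \<in> CFF"
    proof (rule FM.CF_points_cong)
      fix p assume pF: "p \<in> points F"
      then have p: "p \<in> S" by (simp add: points_F)
      show "g p (\<iota> (X p)) (\<xi> p) = form1_apply \<eta>F X p"
        using A.eta_eq[OF S_D(1)[OF p] iota_TS[OF FM.VF_TS[OF X pF]]] by (simp add: form1_apply_def etaF)
    qed
  qed
  show "smooth_manifold F" "odd DIM('k)" "riemannian_metric F gF" "\<xi>F \<in> VFF"
    by (rule smooth_manifold_F, rule odd_dim, rule riemannian_F, rule rho_VFF[OF xi_VV])
  fix p assume pF: "p \<in> points F"
  then have p: "p \<in> S" by (simp add: points_F)
  note pM = S_D(1)[OF p] and xT = FM.VF_TS[OF rho_VFF[OF xi_VV] pF]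
  show "\<eta>F p (\<xi>F p) = 1" using A.eta_xi[OF pM] by (simp add: etaF iota_xiF[OF p])
  fix u assume u: "u \<in> TSF p"
  note fu = phiF_TSF[OF p u]
  show "\<phi>F p (\<phi>F p u) = - u + \<eta>F p u *\<^sub>R \<xi>F p"
  proof (rule iota_eqI[OF p phiF_TSF(1)[OF p fu(1)]])
    show "- u + \<eta>F p u *\<^sub>R \<xi>F p \<in> TSF p" by (intro FM.TS_add FM.TS_neg FM.TS_scale u xT)
    show "\<iota> (\<phi>F p (\<phi>F p u)) = \<iota> (- u + \<eta>F p u *\<^sub>R \<xi>F p)"
      using A.phi_phi[OF pM iota_TS[OF u]]
      by (simp only: phiF_TSF(2)[OF p fu(1)] fu(2) incl.push_add incl.push_scale linear_neg[OF incl.linear_push] iota_xiF[OF p] etaF)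
  qed
  fix v assume v: "v \<in> TSF p"
  show "gF p (\<phi>F p u) (\<phi>F p v) = gF p u v - \<eta>F p u * \<eta>F p v"
    using A.g_phi_phi[OF pM iota_TS[OF u] iota_TS[OF v]]
    by (simp add: restr_form2_def fu(2) phiF_TSF(2)[OF p v] etaF)
qed

lemma Phi_rho: assumes V: "V \<in> VV" shows "endo_apply F \<phi>F (\<rho> V) = \<rho> (\<Phi> V)"
proof (rule FM.VF_eqI[OF phiF_VFF[OF rho_VFF[OF V]] rho_VFF[OF Phi_VV[OF V]]])
  fix p assume "p \<in> points F"
  then have p: "p \<in> S" and pF: "p \<in> points F" by (simp_all add: points_F)
  have "endo_apply F \<phi>F (\<rho> V) p = pull p (\<phi> p (\<iota> (\<rho> V p)))" using pF by (simp add: endo_apply_def[of F] phiF)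
  also have "\<dots> = pull p (\<Phi> V p)" by (simp only: iota_rho[OF V p] A.Phi_apply[OF S_D(1)[OF p]])
  also have "\<dots> = \<rho> (\<Phi> V) p" by (rule rho_apply[OF p, symmetric])
  finally show "endo_apply F \<phi>F (\<rho> V) p = \<rho> (\<Phi> V) p" .
qed

text \<open>Both sides of the equation on the fibre depend only on the values of the two fields at the point, so
  the fields may be taken to be restrictions of vertical fields. For these the equation is the vertical part
  of the one on the total space: the vertical projections \<open>a\<close> of \<open>\<nabla>\<^sub>UV\<close> and \<open>c\<close> of \<open>\<nabla>\<^sub>\<xi>\<xi>\<close> are
  the covariant derivatives on the fibre, and \<open>\<phi>\<close> commutes with the projection.\<close>

theorem C12_F: "C12_manifold F \<phi>F \<xi>F \<eta>F gF"
proof -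
  obtain DF where DF: "levi_civita F gF DF" by (rule FR.levi_civita_exists)
  interpret FC: almost_contact_connection F gF DF \<phi>F \<xi>F \<eta>F
    by unfold_locales (rule DF, rule acm_F)
  have conn: "\<iota> (DF (\<rho> U) (\<rho> V) p) = vproj M M' \<pi> g (D U V) p" if "U \<in> VV" "V \<in> VV" "p \<in> S" for U V p
    by (rule fibre_connection[OF DF that])
  have rhoT: "\<rho> U p \<in> TSF p" if "U \<in> VV" "p \<in> S" for U p using FM.VF_TS[OF rho_VFF[OF that(1)]] that(2) by (simp add: points_F)
  have vert: "cov_endo F DF \<phi>F (\<rho> U) (\<rho> V) p = - FC.C12_rhs (\<rho> U) (\<rho> V) p"
    if U: "U \<in> VV" and V: "V \<in> VV" and p: "p \<in> S" for U V p
  proof -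
    have pF: "p \<in> points F" using p by (simp add: points_F)
    note pM = S_D(1)[OF p]
    note u = vertical_fields_D[OF U] and v = vertical_fields_D[OF V]
    have proj: "vproj M M' \<pi> g (D A B) p \<in> VS p" "D A B p - vproj M M' \<pi> g (D A B) p \<in> HS p"
      if "A \<in> VV" "B \<in> VV" for A B
      using vproj_VF(3,4)[OF M.D_VF[OF vertical_fields_D(1)[OF that(1)] vertical_fields_D(1)[OF that(2)]] pM]
      by (simp_all add: hproj_def)
    define a where "a = vproj M M' \<pi> g (D U V) p"
    define c where "c = vproj M M' \<pi> g (D \<xi> \<xi>) p"
    note aV = proj[OF U V, folded a_def] and cV = proj[OF xi_VV xi_VV, folded c_def]
    note xV = xi_vertical[OF pM] and fV = phi_vertical[OF pM v(2)[OF pM]]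
    note tT = VS_D(1)[OF aV(1)] VS_D(1)[OF cV(1)] HS_D(1)[OF aV(2)] HS_D(1)[OF cV(2)] VS_D(1)[OF fV]
    let ?R = "\<eta> p (U p) *\<^sub>R (g p c (\<phi> p (V p)) *\<^sub>R \<xi> p + \<eta> p (V p) *\<^sub>R \<phi> p c)"
    have gc: "g p (D \<xi> \<xi> p) (\<phi> p (V p)) = g p c (\<phi> p (V p))"
      using HS_D(2)[OF cV(2) fV] M.g_add[OF pM tT(2) tT(4) tT(5)] by simp
    have f1: "\<phi> p (D U V p) = \<phi> p a + \<phi> p (D U V p - a)" using A.phi_add[OF pM tT(1,3)] by simp
    have f2: "\<phi> p (D \<xi> \<xi> p) = \<phi> p c + \<phi> p (D \<xi> \<xi> p - c)" using A.phi_add[OF pM tT(2,4)] by simp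
    have RV: "?R \<in> VS p"
      by (rule subspace_scale[OF subspace_VS subspace_add[OF subspace_VS subspace_scale[OF subspace_VS xV]
              subspace_scale[OF subspace_VS phi_vertical[OF pM cV(1)]]]])
    have eq: "D U (\<Phi> V) p - (\<phi> p a - ?R) =
        \<phi> p (D U V p - a) - (\<eta> p (U p) * \<eta> p (V p)) *\<^sub>R \<phi> p (D \<xi> \<xi> p - c)"
      unfolding A.C12_equation[OF u(1) v(1) pM] gc f1 f2 by (simp add: algebra_simps)
    have HR: "D U (\<Phi> V) p - (\<phi> p a - ?R) \<in> HS p"
      unfolding eq
      by (rule subspace_diff[OF subspace_HS[OF pM] phi_horizontal[OF pM aV(2)]
            subspace_scale[OF subspace_HS[OF pM] phi_horizontal[OF pM cV(2)]]])
    have "vproj M M' \<pi> g (D U (\<Phi> V)) p = \<phi> p a - ?R"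
      by (rule vproj_eqI[OF pM subspace_diff[OF subspace_VS phi_vertical[OF pM aV(1)] RV], where E = "D U (\<Phi> V)", OF HR])
    then have d1: "\<iota> (DF (\<rho> U) (\<rho> (\<Phi> V)) p) = \<phi> p a - ?R" using conn[OF U Phi_VV[OF V] p] by simp
    have d2: "\<iota> (\<phi>F p (DF (\<rho> U) (\<rho> V) p)) = \<phi> p a"
      using phiF_TSF(2)[OF p FC.D_TS[OF rho_VFF[OF U] rho_VFF[OF V] pF]] conn[OF U V p] by (simp add: a_def)
    have cT: "DF \<xi>F \<xi>F p \<in> TSF p" by (rule FC.D_TS[OF rho_VFF[OF xi_VV] rho_VFF[OF xi_VV] pF])
    have c': "\<iota> (DF \<xi>F \<xi>F p) = c" using conn[OF xi_VV xi_VV p] by (simp add: c_def)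
    have "\<iota> (FC.C12_rhs (\<rho> U) (\<rho> V) p) = ?R"
      by (simp only: FC.C12_rhs_def incl.push_scale incl.push_add iota_xiF[OF p] etaF iota_rho[OF U p] iota_rho[OF V p]
          gF_apply phiF_TSF(2)[OF p cT] phiF_TSF(2)[OF p rhoT[OF V p]] c')
    moreover have "\<iota> (cov_endo F DF \<phi>F (\<rho> U) (\<rho> V) p) = - ?R"
    proof -
      have "cov_endo F DF \<phi>F (\<rho> U) (\<rho> V) p = DF (\<rho> U) (\<rho> (\<Phi> V)) p - \<phi>F p (DF (\<rho> U) (\<rho> V) p)"
        by (simp add: cov_endo_def Phi_rho[OF V] FC.Phi_apply[OF pF])
      then show ?thesis by (simp only: linear_diff[OF incl.linear_push] d1 d2) simp
    qed
    ultimately have "\<iota> (cov_endo F DF \<phi>F (\<rho> U) (\<rho> V) p) = \<iota> (- FC.C12_rhs (\<rho> U) (\<rho> V) p)"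
      by (simp add: linear_neg[OF incl.linear_push])
    moreover have "cov_endo F DF \<phi>F (\<rho> U) (\<rho> V) p \<in> TSF p"
      unfolding cov_endo_def
      by (rule FM.VF_TS[OF FM.VF_diff[OF FC.D_VF[OF rho_VFF[OF U] phiF_VFF[OF rho_VFF[OF V]]]
              phiF_VFF[OF FC.D_VF[OF rho_VFF[OF U] rho_VFF[OF V]]]] pF])
    moreover have "- FC.C12_rhs (\<rho> U) (\<rho> V) p \<in> TSF p"
      unfolding FC.C12_rhs_def
      by (intro FM.TS_neg FM.TS_scale FM.TS_add phiF_TSF[OF p] cT rhoT[OF xi_VV p])
    ultimately show ?thesis by (metis iota_eqI[OF p])
  qed
  have "cov_endo F DF \<phi>F X Y =
      - (form1_apply \<eta>F X \<odot> (cov_form1 DF \<eta>F \<xi>F (endo_apply F \<phi>F Y) \<odot> \<xi>F +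
        form1_apply \<eta>F Y \<odot> endo_apply F \<phi>F (DF \<xi>F \<xi>F)))" (is "?L = ?R") if X: "X \<in> VFF" and Y: "Y \<in> VFF" for X Y
  proof
    fix p
    show "?L p = ?R p"
    proof (cases "p \<in> points F")
      case True
      then have p: "p \<in> S" by (simp add: points_F)
      obtain U where U: "U \<in> VV" "\<rho> U p = X p" using vertical_through[OF p FM.VF_TS[OF X True]] by blast
      obtain V where V: "V \<in> VV" "\<rho> V p = Y p" using vertical_through[OF p FM.VF_TS[OF Y True]] by blast
      have "?L p = cov_endo F DF \<phi>F (\<rho> U) (\<rho> V) p"
        by (rule FC.cov_Phi_tensorial[OF X rho_VFF[OF U(1)] U(2)[symmetric] Y rho_VFF[OF V(1)] V(2)[symmetric] True])
      also have "\<dots> = - FC.C12_rhs (\<rho> U) (\<rho> V) p" by (rule vert[OF U(1) V(1) p])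
      also have "\<dots> = - FC.C12_rhs X Y p" by (simp add: FC.C12_rhs_def U(2) V(2))
      also have "\<dots> = ?R p" by (rule FC.C12_rhs_eq[OF Y True, symmetric])
      finally show ?thesis .
    next
      case False
      have "?L p = 0" using FM.VF_outside[OF FC.D_VF[OF X phiF_VFF[OF Y]] False] False
        by (simp add: cov_endo_def endo_apply_def[of F \<phi>F "DF X Y"])
      moreover have "?R p = 0" using FM.VF_outside[OF rho_VFF[OF xi_VV] False] False
        by (simp add: fun_scale_apply endo_apply_def[of F \<phi>F "DF \<xi>F \<xi>F"])
      ultimately show ?thesis by simp
    qed
  qed
  then show ?thesis unfolding C12_manifold_def using acm_F DF by blast
qed

end

theorem theorem3p4:
  fixes M :: "('a, 'e::euclidean_space) manifold"
    and \<phi> :: "'a endo" and \<xi> :: "'a vfield" and \<eta> :: "'a form1" and g :: "'a form2"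
    and M' :: "('b, 'f::euclidean_space) manifold"
    and J :: "'b endo" and g' :: "'b form2"
    and \<pi> :: "'a \<Rightarrow> 'b" and D :: "'a conn" and T :: "'a vfield \<Rightarrow> 'a vfield \<Rightarrow> 'a vfield"
    and m n :: nat
  assumes "contact_complex_submersion M \<phi> \<xi> \<eta> g M' J g' \<pi>"
    and "DIM('e) = 2 * m + 1" and "2 * m + 1 \<ge> 5"
    and "DIM('f) = 2 * n" and "2 * n \<ge> 2"
    and "C12_manifold M \<phi> \<xi> \<eta> g"
    and "levi_civita M g D"
    and "T = oneill_T M M' \<pi> g D"
  shows "kaehler_manifold M' J g' \<and>
    horizontal_totally_geodesic M M' \<pi> g D \<and>
    (\<forall>q\<in>points M'. \<forall>F :: ('a, 'k::euclidean_space) manifold.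
       F = submanifold M (fibre M \<pi> q) \<and> DIM('k) + DIM('f) = DIM('e) \<and> DIM('k) \<ge> 3 \<longrightarrow>
       C12_manifold F (restr_endo F M \<phi>) (restr_field F M \<xi>) (restr_form1 F M \<eta>)
         (restr_form2 F M g)) \<and>
    (\<forall>U\<in>vertical_fields M M' \<pi>. \<forall>V\<in>vertical_fields M M' \<pi>.
       T U (endo_apply M \<phi> V) = endo_apply M \<phi> (T U V) -
         form1_apply \<eta> U \<odot> form1_apply \<eta> V \<odot> endo_apply M \<phi> (T \<xi> \<xi>) \<and>
       T U V + T (endo_apply M \<phi> U) (endo_apply M \<phi> V) =
         form1_apply \<eta> U \<odot> form1_apply \<eta> V \<odot> T \<xi> \<xi>) \<and>
    (\<forall>U\<in>vertical_fields M M' \<pi>. \<forall>X\<in>horizontal_fields M M' \<pi> g.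
       cov_endo M D \<phi> U X =
         - (form1_apply \<eta> U \<odot> form2_apply g (T \<xi> \<xi>) (endo_apply M \<phi> X) \<odot> \<xi>) \<and>
       cov_endo M D \<phi> X U = 0)"
proof -
  note s = assms(1)[unfolded contact_complex_submersion_def]
  interpret C12_submersion M g D M' g' \<pi> \<phi> \<xi> \<eta> J
    by unfold_locales
      (use s assms in \<open>simp_all add: riemannian_submersion_def acm_manifold_def\<close>)
  have "C12_manifold F (restr_endo F M \<phi>) (restr_field F M \<xi>) (restr_form1 F M \<eta>) (restr_form2 F M g)"
    if "q \<in> points M'" "F = submanifold M (fibre M \<pi> q)" "DIM('k) + DIM('f) = DIM('e)"
    for q and F :: "('a, 'k::euclidean_space) manifold"
  proof -
    have "odd (DIM('k) + DIM('f))" unfolding that(3) assms(2) by simp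
    then have "odd DIM('k)" unfolding assms(4) by simp
    then interpret C12_fibre M g D M' g' \<pi> \<phi> \<xi> \<eta> J q F
      by unfold_locales (use that in simp_all)
    show ?thesis by (rule C12_F)
  qed
  then show ?thesis
    using base_kaehler horizontal_totally_geodesic T_Phi_field T_Phi_Phi_field
      cov_Phi_vertical_horizontal cov_Phi_horizontal_vertical
    unfolding assms(8) by blast
qed

end
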